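(* Let $d\ge1$ and suppose that $A\in M_d(\mathbb Z)$ has $N:=|\det A|\ne0$. Then there is a KMS$_{\log N}$ state $\phi$ of $(\mathcal O(M_L),\sigma)$ such that, for all $m,n\in\mathbb Z^d$ and $k,l\in\mathbb N$, $$\phi(\bar u_m\bar v^k\bar v^{*l}\bar u_n^* )=\begin{cases}0&\text{unless $k=l$ and $m=n$}\\ N^{-k}&\text{if $k=l$ and $m=n$.}\end{cases}$$ If $A$ is a dilation matrix, then this is the only KMS state of $(\mathcal O(M_L),\sigma)$.
   Context: $\mathbb N=\{0,1,2,\dots\}$, $B=A^t$, and $\Sigma$ is a set of coset representatives for $\mathbb Z^d/B\mathbb Z^d$ containing $0$. $A$ is a dilation matrix if all its (complex) eigenvalues $\lambda$ satisfy $|\lambda|>1$. $\mathbb T^d=\mathbb R^d/\mathbb Z^d$, with points written $e^{2\pi ix}$; $\gamma_m(z)=z^m=\prod_i z_i^{m_i}$; $\sigma_A(e^{2\pi ix})=e^{2\pi iAx}$; $\alpha_A(f)=f\circ\sigma_A$; $L(f)(z)=\frac1{|\det A|}\sum_{\sigma_A(w)=z}f(w)$. The right-Hilbert bimodule $M_L$ over $C(\mathbb T^d)$ has underlying space $C(\mathbb T^d)$, actions $f\cdot m\cdot g=fm\alpha_A(g)$ and inner product $\langle m,n\rangle=L(m^*n)$. $\mathcal O(M_L)$ is the Cuntz–Pimsner algebra of $M_L$ (the Exel crossed product $C(\mathbb T^d)\rtimes_{\alpha_A,L}\mathbb N$), with universal Cuntz–Pimsner covariant representation $(j_{M_L},j_{C(\mathbb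 T^d)})$; put $\bar u_m=j_{C(\mathbb T^d)}(\gamma_m)$ and $\bar v=j_{M_L}(1)$. Equivalently, $\mathcal O(M_L)$ is the universal $C^*$-algebra generated by a unitary representation $\bar u$ of $\mathbb Z^d$ and an isometry $\bar v$ with $\bar v\bar u_m=\bar u_{Bm}\bar v$; $\bar v^*\bar u_m\bar v=\bar u_{B^{-1}m}$ if $m\in B\mathbb Z^d$ and $0$ otherwise; and $\sum_{m\in\Sigma}\bar u_m\bar v\bar v^*\bar u_m^*=1$. The dynamics $\sigma:\mathbb R\to\operatorname{Aut}\mathcal O(M_L)$ is characterised by $\sigma_t(\bar u_m)=\bar u_m$, $\sigma_t(\bar v)=e^{it}\bar v$. An element $c$ is analytic if $t\mapsto\sigma_t(c)$ extends to an entire function. For $\beta\in(0,\infty)$, a state $\phi$ is a KMS$_\beta$ state (KMS state at inverse temperature $\beta$) if $\phi(dc)=\phi(c\,\sigma_{i\beta}(d))$ for all analytic $c,d$. The KMS$_0$ states are the $\sigma$-invariant tracial states. A KMS state is a KMS$_\beta$ state for some $\beta\in[0,\infty)$. *)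

theory Defs
  imports
    "HOL-Analysis.Analysis"
    "HOL-Library.Poly_Mapping"
    "HOL-Algebra.Module"
begin

section \<open>Unital C*-algebras\<close>

text \<open>
  C*-algebras are records with an explicit carrier, extending the module records of HOL-Algebra,
  because the algebra studied below depends on a matrix and hence cannot be a type.
\<close>

definition complex_ring :: "complex ring" where
  "complex_ring = \<lparr>carrier = UNIV, monoid.mult = (*), one = 1, zero = 0, add = (+)\<rparr>"

record 'a cstar = "(complex, 'a) module" +
  star :: "'a \<Rightarrow> 'a"
  nrm :: "'a \<Rightarrow> real"

locale star_algebra = ring C + Module.module complex_ring C
  for C :: "('a, 'm) cstar_scheme" (structure) +
  assumes smult_mult_left:
      "x \<in> carrier C \<Longrightarrow> y \<in> carrier C \<Longrightarrow> (c \<odot> x) \<otimes> y = c \<odot> (x \<otimes> y)"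
    and smult_mult_right:
      "x \<in> carrier C \<Longrightarrow> y \<in> carrier C \<Longrightarrow> x \<otimes> (c \<odot> y) = c \<odot> (x \<otimes> y)"
    and star_closed: "x \<in> carrier C \<Longrightarrow> star C x \<in> carrier C"
    and star_star: "x \<in> carrier C \<Longrightarrow> star C (star C x) = x"
    and star_add:
      "x \<in> carrier C \<Longrightarrow> y \<in> carrier C \<Longrightarrow> star C (x \<oplus> y) = star C x \<oplus> star C y"
    and star_smult: "x \<in> carrier C \<Longrightarrow> star C (c \<odot> x) = cnj c \<odot> star C x"
    and star_mult:
      "x \<in> carrier C \<Longrightarrow> y \<in> carrier C \<Longrightarrow> star C (x \<otimes> y) = star C y \<otimes> star C x"

locale seminormed_star_algebra = star_algebra C
  for C :: "('a, 'm) cstar_scheme" (structure) +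
  assumes nrm_nonneg: "x \<in> carrier C \<Longrightarrow> 0 \<le> nrm C x"
    and nrm_triangle:
      "x \<in> carrier C \<Longrightarrow> y \<in> carrier C \<Longrightarrow> nrm C (x \<oplus> y) \<le> nrm C x + nrm C y"
    and nrm_smult: "x \<in> carrier C \<Longrightarrow> nrm C (c \<odot> x) = cmod c * nrm C x"
    and nrm_mult:
      "x \<in> carrier C \<Longrightarrow> y \<in> carrier C \<Longrightarrow> nrm C (x \<otimes> y) \<le> nrm C x * nrm C y"
    and cstar_identity: "x \<in> carrier C \<Longrightarrow> nrm C (star C x \<otimes> x) = (nrm C x)\<^sup>2"

definition converges :: "('a, 'm) cstar_scheme \<Rightarrow> (nat \<Rightarrow> 'a) \<Rightarrow> 'a \<Rightarrow> bool" where
  "converges C s x \<longleftrightarrow> (\<lambda>n. nrm C (s n \<ominus>\<^bsub>C\<^esub> x)) \<longlonglongrightarrow> 0"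

definition cauchy_seqs :: "('a, 'm) cstar_scheme \<Rightarrow> (nat \<Rightarrow> 'a) set" where
  "cauchy_seqs C = {s. (\<forall>n. s n \<in> carrier C) \<and>
     (\<forall>e>0. \<exists>K. \<forall>m\<ge>K. \<forall>n\<ge>K. nrm C (s m \<ominus>\<^bsub>C\<^esub> s n) < e)}"

locale cstar_algebra = seminormed_star_algebra C
  for C :: "('a, 'm) cstar_scheme" (structure) +
  assumes nrm_zero: "x \<in> carrier C \<Longrightarrow> nrm C x = 0 \<Longrightarrow> x = \<zero>"
    and complete: "s \<in> cauchy_seqs C \<Longrightarrow> \<exists>x\<in>carrier C. converges C s x"

definition star_hom :: "('a, 'm) cstar_scheme \<Rightarrow> ('b, 'n) cstar_scheme \<Rightarrow> ('a \<Rightarrow> 'b) set" where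
  "star_hom C D = {h \<in> ring_hom C D.
     (\<forall>c. \<forall>x\<in>carrier C. h (c \<odot>\<^bsub>C\<^esub> x) = c \<odot>\<^bsub>D\<^esub> h x) \<and>
     (\<forall>x\<in>carrier C. h (star C x) = star D (h x))}"

definition star_aut :: "('a, 'm) cstar_scheme \<Rightarrow> ('a \<Rightarrow> 'a) set" where
  "star_aut C = {h \<in> star_hom C C. bij_betw h (carrier C) (carrier C)}"

subsection \<open>Separated completion\<close>

definition cauchy_class :: "('a, 'm) cstar_scheme \<Rightarrow> (nat \<Rightarrow> 'a) \<Rightarrow> (nat \<Rightarrow> 'a) set" where
  "cauchy_class C s = {t \<in> cauchy_seqs C. (\<lambda>n. nrm C (s n \<ominus>\<^bsub>C\<^esub> t n)) \<longlonglongrightarrow> 0}"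

definition repr :: "'b set \<Rightarrow> 'b" where
  "repr X = (SOME s. s \<in> X)"

definition completion :: "('a, 'm) cstar_scheme \<Rightarrow> (nat \<Rightarrow> 'a) set cstar" where
  "completion C = \<lparr>
     carrier = cauchy_class C ` cauchy_seqs C,
     monoid.mult = (\<lambda>X Y. cauchy_class C (\<lambda>n. repr X n \<otimes>\<^bsub>C\<^esub> repr Y n)),
     one = cauchy_class C (\<lambda>n. \<one>\<^bsub>C\<^esub>),
     zero = cauchy_class C (\<lambda>n. \<zero>\<^bsub>C\<^esub>),
     add = (\<lambda>X Y. cauchy_class C (\<lambda>n. repr X n \<oplus>\<^bsub>C\<^esub> repr Y n)),
     smult = (\<lambda>c X. cauchy_class C (\<lambda>n. c \<odot>\<^bsub>C\<^esub> repr X n)),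
     star = (\<lambda>X. cauchy_class C (\<lambda>n. star C (repr X n))),
     nrm = (\<lambda>X. lim (\<lambda>n. nrm C (repr X n)))\<rparr>"

definition embed :: "('a, 'm) cstar_scheme \<Rightarrow> 'a \<Rightarrow> (nat \<Rightarrow> 'a) set" where
  "embed C x = cauchy_class C (\<lambda>n. x)"

subsection \<open>The free unital *-algebra on a set of generators\<close>

text \<open>
  A word is a list of letters; the letter \<open>(g, True)\<close> stands for the adjoint of the
  generator \<open>g\<close>.  Words form a monoid under concatenation, written additively so that
  the product of \<^typ>\<open>'a \<Rightarrow>\<^sub>0 complex\<close> is the noncommutative polynomial product.
\<close>

datatype 'g word = Word (letters: "('g \<times> bool) list")

instantiation word :: (type) monoid_add
begin
definition "0 = Word []"
definition "v + w = Word (letters v @ letters w)"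
instance
  by standard (auto simp: zero_word_def plus_word_def)
end

definition star_word :: "'g word \<Rightarrow> 'g word" where
  "star_word w = Word (rev (map (\<lambda>(g, b). (g, \<not> b)) (letters w)))"

type_synonym 'g nc_poly = "'g word \<Rightarrow>\<^sub>0 complex"

definition free_star_algebra :: "'g set \<Rightarrow> ('g nc_poly \<Rightarrow> real) \<Rightarrow> 'g nc_poly cstar" where
  "free_star_algebra G p = \<lparr>
     carrier = {x. \<forall>w\<in>Poly_Mapping.keys x. fst ` set (letters w) \<subseteq> G},
     monoid.mult = (*),
     one = 1,
     zero = 0,
     add = (+),
     smult = (\<lambda>c x. Poly_Mapping.single 0 c * x),
     star = (\<lambda>x. \<Sum>w\<in>Poly_Mapping.keys x.
       Poly_Mapping.single (star_word w) (cnj (Poly_Mapping.lookup x w))),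
     nrm = p\<rparr>"

definition gen :: "'g \<Rightarrow> 'g nc_poly" where
  "gen g = Poly_Mapping.single (Word [(g, False)]) 1"

section \<open>The torus and the bimodule \<open>M_L\<close>\<close>

typedef ('d :: finite) torus = "{z :: complex ^ 'd. \<forall>i. cmod (z $ i) = 1}"
  morphisms coords Torus
  by (rule exI[of _ "\<chi> i. 1"]) simp

instantiation torus :: (finite) metric_space
begin
definition "dist z w = dist (coords z) (coords w)"
definition "(uniformity :: ('a torus \<times> 'a torus) filter) =
  (INF e\<in>{0<..}. principal {(z, w). dist z w < e})"
definition "open (U :: 'a torus set) \<longleftrightarrow>
  (\<forall>z\<in>U. eventually (\<lambda>(z', w). z' = z \<longrightarrow> w \<in> U) uniformity)"
instance
  by standard (auto simp: dist_torus_def uniformity_torus_def open_torus_def coords_inject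
      dist_triangle2)
end

text \<open>The point \<open>exp (2 \<pi> i x)\<close> of the torus.\<close>

definition torus_exp :: "real ^ 'd \<Rightarrow> ('d :: finite) torus" where
  "torus_exp x = Torus (\<chi> i. cis (2 * pi * x $ i))"

definition CT :: "(('d :: finite) torus \<Rightarrow> complex) set" where
  "CT = {f. continuous_on UNIV f}"

definition character :: "int ^ 'd \<Rightarrow> ('d :: finite) torus \<Rightarrow> complex" where
  "character m z = (\<Prod>i\<in>UNIV. coords z $ i powi m $ i)"

definition torus_map :: "int ^ 'd ^ 'd \<Rightarrow> ('d :: finite) torus \<Rightarrow> 'd torus" where
  "torus_map A z = Torus (\<chi> i. character (A $ i) z)"

lemma character_torus_exp:
  "character m (torus_exp x) = cis (2 * pi * (\<Sum>i\<in>UNIV. real_of_int (m $ i) * x $ i))"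
proof -
  have "coords (torus_exp x) = (\<chi> i. cis (2 * pi * x $ i))"
    unfolding torus_exp_def by (rule Torus_inverse) simp
  moreover have "(\<Prod>i\<in>I. cis (f i)) = cis (\<Sum>i\<in>I. f i)" if "finite I" for I :: "'a set" and f
    using that by induction (auto simp: cis_mult)
  ultimately show ?thesis
    by (simp add: character_def cis_power_int sum_distrib_left algebra_simps)
qed

lemma torus_map_torus_exp:
  "torus_map A (torus_exp x) = torus_exp ((\<chi> i j. real_of_int (A $ i $ j)) *v x)"
  unfolding torus_map_def character_torus_exp
  by (simp add: torus_exp_def matrix_vector_mult_def)

definition alpha ::
  "int ^ 'd ^ 'd \<Rightarrow> (('d :: finite) torus \<Rightarrow> complex) \<Rightarrow> 'd torus \<Rightarrow> complex" where
  "alpha A f = f \<circ> torus_map A"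

definition transfer ::
  "int ^ 'd ^ 'd \<Rightarrow> (('d :: finite) torus \<Rightarrow> complex) \<Rightarrow> 'd torus \<Rightarrow> complex" where
  "transfer A f z = (\<Sum>w | torus_map A w = z. f w) / of_int \<bar>det A\<bar>"

text \<open>
  Both the coefficient algebra and the underlying space of \<open>M_L\<close> are \<^term>\<open>CT\<close>.
\<close>

definition left_act ::
  "('d torus \<Rightarrow> complex) \<Rightarrow> ('d torus \<Rightarrow> complex) \<Rightarrow> ('d :: finite) torus \<Rightarrow> complex" where
  "left_act f m = (\<lambda>z. f z * m z)"

definition right_act :: "int ^ 'd ^ 'd \<Rightarrow>
  ('d torus \<Rightarrow> complex) \<Rightarrow> ('d torus \<Rightarrow> complex) \<Rightarrow> ('d :: finite) torus \<Rightarrow> complex" where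
  "right_act A m g = (\<lambda>z. m z * alpha A g z)"

definition inner_ML :: "int ^ 'd ^ 'd \<Rightarrow>
  ('d torus \<Rightarrow> complex) \<Rightarrow> ('d torus \<Rightarrow> complex) \<Rightarrow> ('d :: finite) torus \<Rightarrow> complex" where
  "inner_ML A m n = transfer A (\<lambda>z. cnj (m z) * n z)"

definition norm_ML :: "int ^ 'd ^ 'd \<Rightarrow> (('d :: finite) torus \<Rightarrow> complex) \<Rightarrow> real" where
  "norm_ML A m = sqrt (SUP z. cmod (inner_ML A m m z))"

text \<open>
  A list of pairs \<open>(x, y)\<close> encodes the finite-rank operator given by the sum of the
  rank-one operators \<open>m \<mapsto> x \<cdot> \<langle>y, m\<rangle>\<close>.
\<close>

type_synonym 'd rank_list = "(('d torus \<Rightarrow> complex) \<times> ('d torus \<Rightarrow> complex)) list"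

definition finite_rank :: "int ^ 'd ^ 'd \<Rightarrow> 'd rank_list \<Rightarrow>
  ('d torus \<Rightarrow> complex) \<Rightarrow> ('d :: finite) torus \<Rightarrow> complex" where
  "finite_rank A xs m = (\<lambda>z. \<Sum>(x, y)\<leftarrow>xs. right_act A x (inner_ML A y m) z)"

text \<open>
  Convergence of finite-rank operators in the operator norm of \<open>M_L\<close>.  The compact operators
  on \<open>M_L\<close> are exactly the limits \<open>T\<close> arising in this way.
\<close>

definition finite_rank_tendsto :: "int ^ 'd ^ 'd \<Rightarrow> (nat \<Rightarrow> 'd rank_list) \<Rightarrow>
  (('d torus \<Rightarrow> complex) \<Rightarrow> ('d :: finite) torus \<Rightarrow> complex) \<Rightarrow> bool" where
  "finite_rank_tendsto A Ts T \<longleftrightarrow>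
     (\<forall>k. set (Ts k) \<subseteq> CT \<times> CT) \<and>
     (\<forall>e>0. \<forall>\<^sub>F k in sequentially. \<forall>m\<in>CT.
        norm_ML A (\<lambda>z. finite_rank A (Ts k) m z - T m z) \<le> e * norm_ML A m)"

section \<open>The Cuntz--Pimsner algebra of \<open>M_L\<close>\<close>

definition rank_image :: "('c, 'm) cstar_scheme \<Rightarrow>
  (('d torus \<Rightarrow> complex) \<Rightarrow> 'c) \<Rightarrow> ('d :: finite) rank_list \<Rightarrow> 'c" where
  "rank_image C \<psi> xs = foldr (\<lambda>(x, y) s. (\<psi> x \<otimes>\<^bsub>C\<^esub> star C (\<psi> y)) \<oplus>\<^bsub>C\<^esub> s) xs \<zero>\<^bsub>C\<^esub>"

text \<open>
  Cuntz--Pimsner covariant (Toeplitz) representations \<open>(\<psi>, \<pi>)\<close> of \<open>M_L\<close>.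
  The induced homomorphism on the compact operators is the continuous extension of
  \<^const>\<open>rank_image\<close>, so \<open>covariant\<close> says that it sends the left action of \<open>a\<close> to \<open>\<pi> a\<close>
  whenever that action is by a compact operator.  Requiring \<open>\<pi>\<close> to be unital is no loss:
  both actions on \<open>M_L\<close> are unital, so \<open>\<pi> 1\<close> is a unit for the C*-algebra
  generated by the ranges of \<open>\<psi>\<close> and \<open>\<pi>\<close>.
\<close>

locale covariant_rep = cstar_algebra C
  for A :: "int ^ 'd ^ ('d :: finite)"
    and C :: "('c, 'm) cstar_scheme" (structure)
    and \<psi> :: "('d torus \<Rightarrow> complex) \<Rightarrow> 'c"
    and \<pi> :: "('d torus \<Rightarrow> complex) \<Rightarrow> 'c" +
  assumes psi_closed: "m \<in> CT \<Longrightarrow> \<psi> m \<in> carrier C"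
    and psi_add: "m \<in> CT \<Longrightarrow> n \<in> CT \<Longrightarrow> \<psi> (\<lambda>z. m z + n z) = \<psi> m \<oplus> \<psi> n"
    and psi_scale: "m \<in> CT \<Longrightarrow> \<psi> (\<lambda>z. c * m z) = c \<odot> \<psi> m"
    and pi_closed: "f \<in> CT \<Longrightarrow> \<pi> f \<in> carrier C"
    and pi_add: "f \<in> CT \<Longrightarrow> g \<in> CT \<Longrightarrow> \<pi> (\<lambda>z. f z + g z) = \<pi> f \<oplus> \<pi> g"
    and pi_scale: "f \<in> CT \<Longrightarrow> \<pi> (\<lambda>z. c * f z) = c \<odot> \<pi> f"
    and pi_mult: "f \<in> CT \<Longrightarrow> g \<in> CT \<Longrightarrow> \<pi> (\<lambda>z. f z * g z) = \<pi> f \<otimes> \<pi> g"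
    and pi_star: "f \<in> CT \<Longrightarrow> \<pi> (\<lambda>z. cnj (f z)) = star C (\<pi> f)"
    and pi_one: "\<pi> (\<lambda>z. 1) = \<one>"
    and psi_left: "f \<in> CT \<Longrightarrow> m \<in> CT \<Longrightarrow> \<psi> (left_act f m) = \<pi> f \<otimes> \<psi> m"
    and psi_right: "m \<in> CT \<Longrightarrow> g \<in> CT \<Longrightarrow> \<psi> (right_act A m g) = \<psi> m \<otimes> \<pi> g"
    and psi_inner: "m \<in> CT \<Longrightarrow> n \<in> CT \<Longrightarrow> star C (\<psi> m) \<otimes> \<psi> n = \<pi> (inner_ML A m n)"
    and covariant: "a \<in> CT \<Longrightarrow> finite_rank_tendsto A Ts (left_act a) \<Longrightarrow>
      converges C (\<lambda>k. rank_image C \<psi> (Ts k)) (\<pi> a)"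

datatype 'd generator = ModGen "'d torus \<Rightarrow> complex" | AlgGen "'d torus \<Rightarrow> complex"

definition free_ML ::
  "(('d :: finite) generator nc_poly \<Rightarrow> real) \<Rightarrow> 'd generator nc_poly cstar" where
  "free_ML p = free_star_algebra (ModGen ` CT \<union> AlgGen ` CT) p"

text \<open>
  The C*-seminorms on the free *-algebra for which the generators become a covariant
  representation in the completion.  Up to isomorphism, these completions are all the
  C*-algebras generated by covariant representations of \<open>M_L\<close>, so the supremum of these
  seminorms is the norm of the universal one.
\<close>

definition covariant_seminorms ::
  "int ^ 'd ^ 'd \<Rightarrow> (('d :: finite) generator nc_poly \<Rightarrow> real) set" where
  "covariant_seminorms A = {p. seminormed_star_algebra (free_ML p) \<and>
     covariant_rep A (completion (free_ML p))
       (\<lambda>m. embed (free_ML p) (gen (ModGen m)))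
       (\<lambda>f. embed (free_ML p) (gen (AlgGen f)))}"

definition universal_norm ::
  "int ^ 'd ^ 'd \<Rightarrow> ('d :: finite) generator nc_poly \<Rightarrow> real" where
  "universal_norm A x = (SUP p\<in>covariant_seminorms A. p x)"

type_synonym 'd cp_elem = "(nat \<Rightarrow> 'd generator nc_poly) set"

definition CP :: "int ^ 'd ^ 'd \<Rightarrow> ('d :: finite) cp_elem cstar" where
  "CP A = completion (free_ML (universal_norm A))"

definition j_M :: "int ^ 'd ^ 'd \<Rightarrow> (('d :: finite) torus \<Rightarrow> complex) \<Rightarrow> 'd cp_elem" where
  "j_M A m = embed (free_ML (universal_norm A)) (gen (ModGen m))"

definition j_CT :: "int ^ 'd ^ 'd \<Rightarrow> (('d :: finite) torus \<Rightarrow> complex) \<Rightarrow> 'd cp_elem" where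
  "j_CT A f = embed (free_ML (universal_norm A)) (gen (AlgGen f))"

definition u_bar :: "int ^ 'd ^ 'd \<Rightarrow> int ^ 'd \<Rightarrow> ('d :: finite) cp_elem" where
  "u_bar A m = j_CT A (character m)"

definition v_bar :: "int ^ 'd ^ 'd \<Rightarrow> ('d :: finite) cp_elem" where
  "v_bar A = j_M A (\<lambda>z. 1)"

section \<open>KMS states\<close>

definition state :: "('a, 'm) cstar_scheme \<Rightarrow> ('a \<Rightarrow> complex) \<Rightarrow> bool" where
  "state C \<phi> \<longleftrightarrow>
     (\<forall>x\<in>carrier C. \<forall>y\<in>carrier C. \<phi> (x \<oplus>\<^bsub>C\<^esub> y) = \<phi> x + \<phi> y) \<and>
     (\<forall>c. \<forall>x\<in>carrier C. \<phi> (c \<odot>\<^bsub>C\<^esub> x) = c * \<phi> x) \<and>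
     (\<forall>x\<in>carrier C. \<phi> (star C x \<otimes>\<^bsub>C\<^esub> x) \<in> \<real>\<^sub>\<ge>\<^sub>0) \<and>
     \<phi> \<one>\<^bsub>C\<^esub> = 1"

definition dynamics :: "('a, 'm) cstar_scheme \<Rightarrow> (real \<Rightarrow> 'a \<Rightarrow> 'a) \<Rightarrow> bool" where
  "dynamics C \<sigma> \<longleftrightarrow>
     (\<forall>t. \<sigma> t \<in> star_aut C) \<and>
     (\<forall>s t. \<forall>x\<in>carrier C. \<sigma> (s + t) x = \<sigma> s (\<sigma> t x)) \<and>
     (\<forall>x\<in>carrier C. ((\<lambda>t. nrm C (\<sigma> t x \<ominus>\<^bsub>C\<^esub> x)) \<longlongrightarrow> 0) (at 0))"

definition entire :: "('a, 'm) cstar_scheme \<Rightarrow> (complex \<Rightarrow> 'a) \<Rightarrow> bool" where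
  "entire C g \<longleftrightarrow> (\<forall>z. g z \<in> carrier C) \<and>
     (\<forall>z. \<exists>D\<in>carrier C.
        ((\<lambda>h. nrm C ((1 / h) \<odot>\<^bsub>C\<^esub> (g (z + h) \<ominus>\<^bsub>C\<^esub> g z) \<ominus>\<^bsub>C\<^esub> D)) \<longlongrightarrow> 0) (at 0))"

text \<open>
  \<open>g\<close> is the entire function extending \<open>t \<mapsto> \<sigma> t c\<close>; it is unique, and \<open>g (\<i> * \<beta>)\<close> is
  what is meant by \<open>\<sigma>\<close> at \<open>\<i> * \<beta>\<close> applied to \<open>c\<close>.
\<close>

definition analytic_extension ::
  "('a, 'm) cstar_scheme \<Rightarrow> (real \<Rightarrow> 'a \<Rightarrow> 'a) \<Rightarrow> 'a \<Rightarrow> (complex \<Rightarrow> 'a) \<Rightarrow> bool" where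
  "analytic_extension C \<sigma> c g \<longleftrightarrow> entire C g \<and> (\<forall>t. g (of_real t) = \<sigma> t c)"

definition analytic_elem ::
  "('a, 'm) cstar_scheme \<Rightarrow> (real \<Rightarrow> 'a \<Rightarrow> 'a) \<Rightarrow> 'a \<Rightarrow> bool" where
  "analytic_elem C \<sigma> c \<longleftrightarrow> c \<in> carrier C \<and> (\<exists>g. analytic_extension C \<sigma> c g)"

definition KMS :: "('a, 'm) cstar_scheme \<Rightarrow> (real \<Rightarrow> 'a \<Rightarrow> 'a) \<Rightarrow>
    real \<Rightarrow> ('a \<Rightarrow> complex) \<Rightarrow> bool" where
  "KMS C \<sigma> \<beta> \<phi> \<longleftrightarrow> state C \<phi> \<and>
     (if \<beta> = 0 then
        (\<forall>x\<in>carrier C. \<forall>y\<in>carrier C. \<phi> (x \<otimes>\<^bsub>C\<^esub> y) = \<phi> (y \<otimes>\<^bsub>C\<^esub> x)) \<and>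
        (\<forall>t. \<forall>x\<in>carrier C. \<phi> (\<sigma> t x) = \<phi> x)
      else
        (\<forall>c d g. analytic_elem C \<sigma> c \<longrightarrow> analytic_elem C \<sigma> d \<longrightarrow> analytic_extension C \<sigma> d g \<longrightarrow>
           \<phi> (d \<otimes>\<^bsub>C\<^esub> c) = \<phi> (c \<otimes>\<^bsub>C\<^esub> g (\<i> * of_real \<beta>))))"

text \<open>The dynamics on the Cuntz--Pimsner algebra, characterised by its values on generators.\<close>

definition gauge_dynamics ::
  "int ^ 'd ^ 'd \<Rightarrow> (real \<Rightarrow> ('d :: finite) cp_elem \<Rightarrow> 'd cp_elem) \<Rightarrow> bool" where
  "gauge_dynamics A \<sigma> \<longleftrightarrow> dynamics (CP A) \<sigma> \<and>
     (\<forall>t m. \<sigma> t (u_bar A m) = u_bar A m) \<and>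
     (\<forall>t. \<sigma> t (v_bar A) = cis t \<odot>\<^bsub>CP A\<^esub> v_bar A)"

definition dilation_matrix :: "int ^ 'd ^ ('d :: finite) \<Rightarrow> bool" where
  "dilation_matrix A \<longleftrightarrow>
     (\<forall>(ev::complex) x. x \<noteq> 0 \<and> (\<chi> i j. of_int (A $ i $ j)) *v x = ev *s x \<longrightarrow> cmod ev > 1)"

end

theory Submission
  imports
    Defs
    "HOL-Complex_Analysis.Conformal_Mappings"
    "HOL-Computational_Algebra.Fundamental_Theorem_Algebra"
begin

text \<open>
  Why the theorem holds.  Write \<open>u m\<close> and \<open>v\<close> for the images of the character \<open>\<gamma>\<^sub>m\<close> and of the
  constant function, and \<open>B\<close> for the transpose of \<open>A\<close>.

  The elements \<open>u m v\<^sup>k v*\<^sup>l u n*\<close> span a dense subspace of the algebra, because the closed span is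
  stable under left multiplication by the generators (\<open>generators_preserve_span\<close>).  States are
  continuous (\<open>state_bounded\<close>), so everything can be checked on these monomials, which the dynamics
  multiplies by \<open>e\<^sup>i\<^sup>t\<^sup>(\<^sup>k\<^sup>-\<^sup>l\<^sup>)\<close>.

  Uniqueness.  The KMS condition moves a monomial around at the cost of a factor
  \<open>e\<^sup>-\<^sup>\<beta>\<^sup>(\<^sup>k\<^sup>-\<^sup>l\<^sup>)\<close>.  Hence \<open>\<phi>\<close> vanishes off \<open>k = l\<close>.  Expanding \<open>u m\<close> with a partition
  of the unit into elements \<open>u s v v* u s*\<close> gives \<open>\<phi> (u m) = N e\<^sup>-\<^sup>\<beta> \<phi> (v* u m v)\<close>.  For \<open>m = 0\<close> this
  forces \<open>\<beta> = log N\<close>; for other \<open>m\<close> it says that \<open>\<phi> (u m)\<close> is \<open>\<phi> (u n)\<close> if \<open>m = B n\<close>, and zero if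
  there is no such \<open>n\<close>.  A dilation matrix leaves no nonzero \<open>m\<close> in all the lattices
  \<open>B\<^sup>k \<int>\<^sup>d\<close> (\<open>dilation_escape\<close>), so \<open>\<phi> (u m) = 0\<close> for \<open>m \<noteq> 0\<close>, and this determines \<open>\<phi>\<close>
  (\<open>kms_unique\<close>).

  Existence.  The algebra acts on finitely supported functions on the discrete set \<open>\<T>\<^sup>d \<times> \<int>\<close>:
  functions on the torus multiply, and \<open>v\<close> composes with \<open>\<sigma>\<^sub>A\<close> and shifts the second coordinate.
  The vector state of the basis vector at \<open>(z, 0)\<close> takes the value \<open>N\<^sup>-\<^sup>k \<gamma>\<^sub>m\<^sub>-\<^sub>n z\<close> at the monomial
  with \<open>k = l\<close> and zero at the others; averaging over \<open>z\<close> gives the required state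
  (\<open>trace_state_exists\<close>).  The condition \<open>\<phi> (d c) = N\<^sup>j \<phi> (c d)\<close> for \<open>c\<close> of degree \<open>j\<close> is
  multiplicative in \<open>c\<close>, so it is enough to check it for the generators, where it can be read off
  from the formula for \<open>\<phi>\<close>.  It extends to the KMS condition for all analytic elements by the identity
  theorem (\<open>trace_KMS\<close>).

  The universal norm is a supremum over covariant seminorms.  To handle it, covariance is rewritten as
  a list of algebraic relations (\<open>torus_rep_iff\<close>): the left action of the torus algebra is by
  finite-rank operators, since suitably scaled characters form a finite frame of the bimodule
  (\<open>finite_rank_frame\<close>).  This rests on the fact that the fibres of \<open>\<sigma>\<^sub>A\<close> have \<open>\<bar>det A\<bar>\<close> elements
  (\<open>card_fibre\<close>).
\<close>

section \<open>Elementary theory of C*-algebras\<close>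

lemma complex_ring_simps [simp]:
  "carrier complex_ring = UNIV" "x \<otimes>\<^bsub>complex_ring\<^esub> y = x * y" "\<one>\<^bsub>complex_ring\<^esub> = 1"
  "x \<oplus>\<^bsub>complex_ring\<^esub> y = x + y" "\<zero>\<^bsub>complex_ring\<^esub> = 0"
  by (simp_all add: complex_ring_def)

lemma cring_complex_ring: "cring complex_ring"
proof (intro cringI abelian_groupI comm_monoidI)
  fix x :: complex
  show "\<exists>y\<in>carrier complex_ring. y \<oplus>\<^bsub>complex_ring\<^esub> x = \<zero>\<^bsub>complex_ring\<^esub>"
    by (rule bexI[of _ "- x"]) simp_all
qed (simp_all add: algebra_simps)

context star_algebra
begin

lemma is_ring: "ring C"
  by unfold_locales

lemmas is_abelian_group = ring.is_abelian_group[OF is_ring]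

lemmas add_comm = abelian_monoid.a_comm[OF abelian_group.axioms(1)[OF is_abelian_group]]
  and add_assoc = abelian_monoid.a_assoc[OF abelian_group.axioms(1)[OF is_abelian_group]]
  and minus_unique = abelian_group.minus_equality[OF is_abelian_group]
  and minus_self = abelian_group.r_neg[OF is_abelian_group]
  and mult_assoc = monoid.m_assoc[OF ring.is_monoid[OF is_ring]]
  and distrib_right = ring.ring_simprules(13)[OF is_ring]
  and distrib_left = ring.ring_simprules(23)[OF is_ring]

lemma scale_closed [simp, intro]: "x \<in> carrier C \<Longrightarrow> c \<odot> x \<in> carrier C"
  by simp

lemma scale_add_left: "x \<in> carrier C \<Longrightarrow> (a + b) \<odot> x = a \<odot> x \<oplus> b \<odot> x"
  using smult_l_distr[of a b x] by simp

lemma scale_add_right: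
  "x \<in> carrier C \<Longrightarrow> y \<in> carrier C \<Longrightarrow> a \<odot> (x \<oplus> y) = a \<odot> x \<oplus> a \<odot> y"
  using smult_r_distr[of a x y] by simp

lemma scale_scale: "x \<in> carrier C \<Longrightarrow> a \<odot> (b \<odot> x) = (a * b) \<odot> x"
  using smult_assoc1[of a b x] by simp

lemma one_scale [simp]: "x \<in> carrier C \<Longrightarrow> 1 \<odot> x = x"
  using smult_one[of x] by simp

lemma zero_scale [simp]: "x \<in> carrier C \<Longrightarrow> 0 \<odot> x = \<zero>"
  using smult_l_null[of x] by simp

lemma scale_zero [simp]: "c \<odot> \<zero> = \<zero>"
  using smult_r_null[of c] by simp

lemma uminus_scale: "x \<in> carrier C \<Longrightarrow> \<ominus> x = (-1) \<odot> x"
proof -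
  assume x: "x \<in> carrier C"
  have "x \<oplus> (-1) \<odot> x = (1 + (-1)) \<odot> x" using x by (simp only: scale_add_left one_scale)
  also have "\<dots> = \<zero>" using x by simp
  finally show ?thesis using x by (intro minus_unique) (simp_all add: add_comm[of _ x])
qed

lemma minus_scale: "x \<in> carrier C \<Longrightarrow> y \<in> carrier C \<Longrightarrow> x \<ominus> y = x \<oplus> (-1) \<odot> y"
  by (simp only: a_minus_def uminus_scale)

lemma scale_minus_right:
  "x \<in> carrier C \<Longrightarrow> y \<in> carrier C \<Longrightarrow> a \<odot> (x \<ominus> y) = a \<odot> x \<ominus> a \<odot> y"
  by (simp add: minus_scale scale_add_right scale_scale)

lemma star_zero [simp]: "star C \<zero> = \<zero>"
  using star_smult[of \<zero> 0] star_closed[of \<zero>] by simp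

lemma star_one [simp]: "star C \<one> = \<one>"
  using star_mult[of "star C \<one>" \<one>] star_star[of \<one>] star_closed[of \<one>] by simp

lemma star_minus:
  "x \<in> carrier C \<Longrightarrow> y \<in> carrier C \<Longrightarrow> star C (x \<ominus> y) = star C x \<ominus> star C y"
  by (simp add: minus_scale star_add star_smult star_closed)

lemma plus_minus_plus: "x \<in> carrier C \<Longrightarrow> y \<in> carrier C \<Longrightarrow> z \<in> carrier C \<Longrightarrow> w \<in> carrier C \<Longrightarrow>
  (x \<oplus> y) \<ominus> (z \<oplus> w) = (x \<ominus> z) \<oplus> (y \<ominus> w)"
  by algebra

end

context seminormed_star_algebra
begin

lemma nrm_zero_element [simp]: "nrm C \<zero> = 0"
  using nrm_smult[of \<zero> 0] by simp

lemma nrm_uminus [simp]: "x \<in> carrier C \<Longrightarrow> nrm C (\<ominus> x) = nrm C x"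
  by (simp add: uminus_scale nrm_smult)

lemma nrm_minus_commute:
  "x \<in> carrier C \<Longrightarrow> y \<in> carrier C \<Longrightarrow> nrm C (x \<ominus> y) = nrm C (y \<ominus> x)"
proof -
  assume "x \<in> carrier C" "y \<in> carrier C"
  moreover from this have "x \<ominus> y = \<ominus> (y \<ominus> x)" by algebra
  ultimately show ?thesis by simp
qed

lemma nrm_minus_triangle:
  assumes "x \<in> carrier C" "y \<in> carrier C" "z \<in> carrier C"
  shows "nrm C (x \<ominus> z) \<le> nrm C (x \<ominus> y) + nrm C (y \<ominus> z)"
proof -
  have "x \<ominus> z = (x \<ominus> y) \<oplus> (y \<ominus> z)" using assms by algebra
  then show ?thesis using assms nrm_triangle[of "x \<ominus> y" "y \<ominus> z"] by simp
qed

lemma nrm_le_plus: "x \<in> carrier C \<Longrightarrow> y \<in> carrier C \<Longrightarrow> nrm C x \<le> nrm C y + nrm C (x \<ominus> y)"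
proof -
  assume *: "x \<in> carrier C" "y \<in> carrier C"
  then have "x = y \<oplus> (x \<ominus> y)" by algebra
  then show ?thesis using * nrm_triangle[of y "x \<ominus> y"] by simp
qed

lemma nrm_diff_le: "x \<in> carrier C \<Longrightarrow> y \<in> carrier C \<Longrightarrow> \<bar>nrm C x - nrm C y\<bar> \<le> nrm C (x \<ominus> y)"
  using nrm_le_plus[of x y] nrm_le_plus[of y x] nrm_minus_commute[of x y] by simp

lemma nrm_minus_self [simp]: "x \<in> carrier C \<Longrightarrow> nrm C (x \<ominus> x) = 0"
  by (simp add: a_minus_def minus_self)

lemma nrm_plus_minus_plus:
  assumes "x \<in> carrier C" "y \<in> carrier C" "z \<in> carrier C" "w \<in> carrier C"
  shows "nrm C ((x \<oplus> y) \<ominus> (z \<oplus> w)) \<le> nrm C (x \<ominus> z) + nrm C (y \<ominus> w)"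
  using plus_minus_plus[OF assms] nrm_triangle[of "x \<ominus> z" "y \<ominus> w"] assms by simp

lemma nrm_mult_minus_mult:
  assumes "x \<in> carrier C" "y \<in> carrier C" "z \<in> carrier C" "w \<in> carrier C"
  shows "nrm C ((x \<otimes> y) \<ominus> (z \<otimes> w)) \<le> nrm C (x \<ominus> z) * nrm C y + nrm C z * nrm C (y \<ominus> w)"
proof -
  have "(x \<otimes> y) \<ominus> (z \<otimes> w) = ((x \<ominus> z) \<otimes> y) \<oplus> (z \<otimes> (y \<ominus> w))" using assms by algebra
  then show ?thesis
    using assms nrm_triangle[of "(x \<ominus> z) \<otimes> y" "z \<otimes> (y \<ominus> w)"] nrm_mult[of "x \<ominus> z" y]
      nrm_mult[of z "y \<ominus> w"] by simp
qed

lemma nrm_star [simp]: assumes "x \<in> carrier C" shows "nrm C (star C x) = nrm C x"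
proof -
  have le: "nrm C y \<le> nrm C (star C y)" if y: "y \<in> carrier C" for y
  proof (cases "nrm C y = 0")
    case True then show ?thesis using nrm_nonneg star_closed y by simp
  next
    case False
    then have "nrm C y > 0" using nrm_nonneg[OF y] by simp
    moreover have "nrm C y * nrm C y \<le> nrm C (star C y) * nrm C y"
      using cstar_identity[OF y] nrm_mult[of "star C y" y] y star_closed by (simp add: power2_eq_square)
    ultimately show ?thesis by simp
  qed
  show ?thesis using le[of x] le[of "star C x"] assms star_closed star_star by simp
qed

lemma nrm_one_le: "nrm C \<one> \<le> 1"
proof -
  have "nrm C \<one> = (nrm C \<one>)\<^sup>2" using cstar_identity[of \<one>] by simp
  then have "nrm C \<one> = 0 \<or> nrm C \<one> = 1" by (simp add: power2_eq_square)
  then show ?thesis by auto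
qed

lemma nrm_star_minus_star:
  "x \<in> carrier C \<Longrightarrow> y \<in> carrier C \<Longrightarrow> nrm C (star C x \<ominus> star C y) = nrm C (x \<ominus> y)"
  by (simp add: star_minus[symmetric])

lemma nrm_scale_minus_scale:
  "x \<in> carrier C \<Longrightarrow> y \<in> carrier C \<Longrightarrow> nrm C (c \<odot> x \<ominus> c \<odot> y) = cmod c * nrm C (x \<ominus> y)"
  by (simp add: scale_minus_right[symmetric] nrm_smult)

lemma converges_const [simp]: "x \<in> carrier C \<Longrightarrow> converges C (\<lambda>n. x) x"
  by (simp add: converges_def)

lemma converges_nrm:
  assumes "\<And>n. s n \<in> carrier C" "x \<in> carrier C" "converges C s x"
  shows "(\<lambda>n. nrm C (s n)) \<longlonglongrightarrow> nrm C x"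
proof -
  have "(\<lambda>n. nrm C (s n) - nrm C x) \<longlonglongrightarrow> 0"
    by (rule tendsto_rabs_zero_cancel, rule tendsto_sandwich[of "\<lambda>_. 0" _ _ "\<lambda>n. nrm C (s n \<ominus> x)"])
      (use assms nrm_diff_le in \<open>auto simp: converges_def\<close>)
  then show ?thesis by (simp add: LIM_zero_iff)
qed

lemma converges_add:
  assumes "\<And>n. s n \<in> carrier C" "x \<in> carrier C" "converges C s x"
    and "\<And>n. t n \<in> carrier C" "y \<in> carrier C" "converges C t y"
  shows "converges C (\<lambda>n. s n \<oplus> t n) (x \<oplus> y)"
  unfolding converges_def
  by (rule tendsto_sandwich[of "\<lambda>_. 0" _ _ "\<lambda>n. nrm C (s n \<ominus> x) + nrm C (t n \<ominus> y)"])
    (use assms nrm_plus_minus_plus nrm_nonneg tendsto_add[of _ 0 _ _ 0] in \<open>auto simp: converges_def\<close>)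

lemma converges_mult:
  assumes "\<And>n. s n \<in> carrier C" "x \<in> carrier C" "converges C s x"
    and "\<And>n. t n \<in> carrier C" "y \<in> carrier C" "converges C t y"
  shows "converges C (\<lambda>n. s n \<otimes> t n) (x \<otimes> y)"
proof -
  have "(\<lambda>n. nrm C (s n \<ominus> x) * nrm C (t n) + nrm C x * nrm C (t n \<ominus> y)) \<longlonglongrightarrow>
    0 * nrm C y + nrm C x * 0"
    using assms by (intro tendsto_intros converges_nrm) (auto simp: converges_def)
  then have *: "(\<lambda>n. nrm C (s n \<ominus> x) * nrm C (t n) + nrm C x * nrm C (t n \<ominus> y)) \<longlonglongrightarrow> 0" by simp
  show ?thesis unfolding converges_def
    by (rule tendsto_sandwich[OF _ _ _ *]) (use assms nrm_mult_minus_mult nrm_nonneg in auto)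
qed

lemma converges_scale:
  assumes "\<And>n. s n \<in> carrier C" "x \<in> carrier C" "converges C s x"
  shows "converges C (\<lambda>n. c \<odot> s n) (c \<odot> x)"
  using assms tendsto_mult_right_zero[of "\<lambda>n. nrm C (s n \<ominus> x)" sequentially "cmod c"]
  by (simp add: converges_def nrm_scale_minus_scale)

lemma converges_star:
  assumes "\<And>n. s n \<in> carrier C" "x \<in> carrier C" "converges C s x"
  shows "converges C (\<lambda>n. star C (s n)) (star C x)"
  using assms by (simp add: converges_def nrm_star_minus_star)

end

context cstar_algebra
begin

lemma converges_unique:
  assumes "\<And>n. s n \<in> carrier C" "x \<in> carrier C" "y \<in> carrier C" "converges C s x" "converges C s y"
  shows "x = y"
proof -
  have "(\<lambda>n. nrm C (s n \<ominus> x) + nrm C (s n \<ominus> y)) \<longlonglongrightarrow> 0"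
    using assms(4,5) tendsto_add[of _ 0 _ _ 0] by (auto simp: converges_def)
  moreover have "nrm C (x \<ominus> y) \<le> nrm C (s n \<ominus> x) + nrm C (s n \<ominus> y)" for n
    using nrm_minus_triangle[of x "s n" y] nrm_minus_commute[of x "s n"] assms by simp
  ultimately have "nrm C (x \<ominus> y) \<le> 0"
    by (intro tendsto_lowerbound[where f="\<lambda>n. nrm C (s n \<ominus> x) + nrm C (s n \<ominus> y)"]) auto
  then have "x \<ominus> y = \<zero>" using nrm_nonneg nrm_zero assms by (simp add: order_antisym)
  moreover have "x = (x \<ominus> y) \<oplus> y" using assms(2,3) by algebra
  ultimately show ?thesis using assms(3) by simp
qed

lemma geometric_convergent:
  assumes s: "\<And>n. s n \<in> carrier C" and r: "0 \<le> r" "r < 1"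
    and step: "\<And>n. nrm C (s (Suc n) \<ominus> s n) \<le> c * r ^ n"
  obtains x where "x \<in> carrier C" "converges C s x"
proof -
  have c: "0 \<le> c" using step[of 0] nrm_nonneg[of "s (Suc 0) \<ominus> s 0"] s by simp
  have dist: "nrm C (s (n + k) \<ominus> s n) \<le> c * r ^ n / (1 - r)" for n k
  proof -
    have "nrm C (s (n + k) \<ominus> s n) \<le> (\<Sum>i<k. c * r ^ (n + i))"
    proof (induction k)
      case (Suc k)
      have "nrm C (s (n + Suc k) \<ominus> s n) \<le> nrm C (s (Suc (n + k)) \<ominus> s (n + k)) + nrm C (s (n + k) \<ominus> s n)"
        using nrm_minus_triangle[of "s (n + Suc k)" "s (n + k)" "s n"] s by simp
      then show ?case using Suc step[of "n + k"] by simp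
    qed (simp add: s)
    also have "\<dots> = c * r ^ n * (\<Sum>i<k. r ^ i)"
      by (simp add: power_add sum_distrib_left mult.assoc)
    also have "\<dots> \<le> c * r ^ n * (1 / (1 - r))"
    proof (rule mult_left_mono)
      show "(\<Sum>i<k. r ^ i) \<le> 1 / (1 - r)"
        using r by (simp add: sum_gp_strict divide_right_mono)
    qed (use c r in simp)
    finally show ?thesis by simp
  qed
  have lim: "(\<lambda>n. c * r ^ n / (1 - r)) \<longlonglongrightarrow> 0"
    using r by (intro tendsto_divide_zero tendsto_mult_right_zero LIMSEQ_realpow_zero) auto
  have "s \<in> cauchy_seqs C"
    unfolding cauchy_seqs_def
  proof (clarify, intro conjI allI impI s)
    fix e :: real assume "e > 0"
    then obtain K where K: "c * r ^ n / (1 - r) < e" if "n \<ge> K" for n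
      using order_tendstoD(2)[OF lim] by (auto simp: eventually_sequentially)
    show "\<exists>K. \<forall>m\<ge>K. \<forall>n\<ge>K. nrm C (s m \<ominus> s n) < e"
    proof (intro exI[of _ K] allI impI)
      fix m n assume mn: "K \<le> m" "K \<le> n"
      show "nrm C (s m \<ominus> s n) < e"
      proof (cases "n \<le> m")
        case True
        then show ?thesis using dist[of n "m - n"] K[OF mn(2)] by simp
      next
        case False
        then show ?thesis
          using dist[of m "n - m"] K[OF mn(1)] nrm_minus_commute[OF s s, of m n] by simp
      qed
    qed
  qed
  then show ?thesis using complete that by blast
qed

text \<open>
  The square root of \<open>\<one> \<ominus> x\<close> is \<open>\<one> \<ominus> y\<close> where \<open>y\<close> solves \<open>y = (x + y\<^sup>2) / 2\<close>;
  for \<open>\<parallel>x\<parallel> < 1\<close> the iteration of this equation from \<open>0\<close> stays in a ball of radius \<open>< 1\<close>,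
  where its right-hand side is a contraction.
\<close>

lemma square_root_one_minus:
  assumes x: "x \<in> carrier C" "star C x = x" "nrm C x < 1"
  obtains y where "y \<in> carrier C" "star C y = y" "y \<otimes> y = \<one> \<ominus> x"
proof -
  define f where "f y = (1/2) \<odot> (x \<oplus> y \<otimes> y)" for y
  define s where "s n = (f ^^ n) \<zero>" for n
  have s_Suc: "s (Suc n) = (1/2) \<odot> (x \<oplus> s n \<otimes> s n)" for n by (simp add: s_def f_def)
  have s_0: "s 0 = \<zero>" by (simp add: s_def)
  have s: "s n \<in> carrier C" for n by (induction n) (simp_all add: s_0 s_Suc x)
  have s_star: "star C (s n) = s n" for n
    by (induction n) (simp_all add: s_0 s_Suc star_smult star_add star_mult s x star_closed)
  define r where "r = (1 + nrm C x) / 2"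
  have r: "0 \<le> r" "r < 1" "nrm C x \<le> r" using x nrm_nonneg[OF x(1)] by (auto simp: r_def)
  have bound: "nrm C (s n) \<le> r" for n
  proof (induction n)
    case (Suc n)
    have "nrm C (s (Suc n)) \<le> (nrm C x + nrm C (s n) * nrm C (s n)) / 2"
      using nrm_triangle[of x "s n \<otimes> s n"] nrm_mult[of "s n" "s n"] s x
      by (simp add: s_Suc nrm_smult)
    also have "nrm C (s n) * nrm C (s n) \<le> 1 * 1"
      using Suc r nrm_nonneg[OF s, of n] by (intro mult_mono) auto
    finally show ?case by (simp add: r_def)
  qed (simp add: s_0 r)
  have "nrm C (s (Suc n) \<ominus> s n) \<le> 1 * r ^ n" for n
  proof (induction n)
    case 0
    have "s (Suc 0) \<ominus> s 0 = (1/2) \<odot> x" using x by (simp add: s_Suc s_0 a_minus_def)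
    then show ?case using x nrm_nonneg[OF x(1)] by (simp add: nrm_smult)
  next
    case (Suc n)
    let ?a = "s (Suc n)" and ?b = "s n"
    have "s (Suc (Suc n)) \<ominus> ?a = (1/2) \<odot> ((x \<oplus> ?a \<otimes> ?a) \<ominus> (x \<oplus> ?b \<otimes> ?b))"
      unfolding arg_cong2[OF s_Suc[of "Suc n"] s_Suc[of n], of "a_minus C"]
      by (simp add: scale_minus_right s x)
    moreover have "(x \<oplus> ?a \<otimes> ?a) \<ominus> (x \<oplus> ?b \<otimes> ?b) = ?a \<otimes> ?a \<ominus> ?b \<otimes> ?b"
      using s[of n] s[of "Suc n"] x(1) by algebra
    ultimately have "nrm C (s (Suc (Suc n)) \<ominus> ?a) = nrm C (?a \<otimes> ?a \<ominus> ?b \<otimes> ?b) / 2"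
      using s by (simp add: nrm_smult)
    also have "nrm C (?a \<otimes> ?a \<ominus> ?b \<otimes> ?b) \<le> nrm C (?a \<ominus> ?b) * nrm C ?a + nrm C ?b * nrm C (?a \<ominus> ?b)"
      using s by (intro nrm_mult_minus_mult)
    also have "\<dots> \<le> nrm C (?a \<ominus> ?b) * r + r * nrm C (?a \<ominus> ?b)"
      using bound s nrm_nonneg by (intro add_mono mult_left_mono mult_right_mono) auto
    also have "(nrm C (?a \<ominus> ?b) * r + r * nrm C (?a \<ominus> ?b)) / 2 = r * nrm C (?a \<ominus> ?b)" by simp
    also have "\<dots> \<le> r * (1 * r ^ n)" using Suc r by (intro mult_left_mono) auto
    finally show ?case by simp
  qed
  then obtain y where y: "y \<in> carrier C" "converges C s y"
    using geometric_convergent[of s r 1] s r by auto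
  have "converges C (\<lambda>n. star C (s n)) (star C y)" using converges_star s y by blast
  then have y_star: "star C y = y" using s_star converges_unique[of s "star C y" y] s y star_closed by simp
  have "converges C (\<lambda>n. s (Suc n)) ((1/2) \<odot> (x \<oplus> y \<otimes> y))"
    unfolding s_Suc using s y x by (intro converges_scale converges_add converges_mult) auto
  moreover have "converges C (\<lambda>n. s (Suc n)) y"
    using y(2) unfolding converges_def by (rule LIMSEQ_Suc)
  ultimately have fixpoint: "y = (1/2) \<odot> (x \<oplus> y \<otimes> y)"
    by (intro converges_unique[of "\<lambda>n. s (Suc n)"]) (use s y x in auto)
  have "y \<oplus> y = (2 * (1/2)) \<odot> (x \<oplus> y \<otimes> y)"
    using arg_cong[OF fixpoint, of "\<lambda>z. 2 \<odot> z"] scale_add_left[of y 1 1] x y by (simp add: scale_scale)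
  then have "y \<oplus> y = x \<oplus> y \<otimes> y" using x y by simp
  then have "(\<one> \<ominus> y) \<otimes> (\<one> \<ominus> y) = \<one> \<ominus> x"
  proof -
    assume e: "y \<oplus> y = x \<oplus> y \<otimes> y"
    have "y \<otimes> \<one> = y" using y(1) by simp
    then have "(\<one> \<ominus> y) \<otimes> (\<one> \<ominus> y) = \<one> \<ominus> (y \<oplus> y) \<oplus> y \<otimes> y" using y(1) by algebra
    also have "\<dots> = \<one> \<ominus> x" unfolding e using x(1) y(1) by algebra
    finally show ?thesis .
  qed
  then show ?thesis using that[of "\<one> \<ominus> y"] y y_star by (simp add: star_minus)
qed

text \<open>
  For self-adjoint \<open>x\<close> of norm less than one, \<open>\<one> \<ominus> x\<close> and \<open>\<one> \<oplus> x\<close> are squares of self-adjoint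
  elements, so positivity bounds the state by one; the factor two comes from splitting an arbitrary
  element into its real and imaginary part.
\<close>

lemma state_bounded:
  assumes st: "state C \<phi>" and x: "x \<in> carrier C"
  shows "cmod (\<phi> x) \<le> 2 * nrm C x"
proof -
  have add: "\<phi> (a \<oplus> b) = \<phi> a + \<phi> b" if "a \<in> carrier C" "b \<in> carrier C" for a b
    using st that by (auto simp: state_def)
  have sc: "\<phi> (c \<odot> a) = c * \<phi> a" if "a \<in> carrier C" for a c
    using st that by (auto simp: state_def)
  have pos: "\<phi> (a \<otimes> a) \<in> \<real>\<^sub>\<ge>\<^sub>0" if "a \<in> carrier C" "star C a = a" for a
    using st that unfolding state_def by metis
  have one: "\<phi> \<one> = 1" using st by (auto simp: state_def)
  have sub: "\<phi> (a \<ominus> b) = \<phi> a - \<phi> b" if "a \<in> carrier C" "b \<in> carrier C" for a b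
    using that by (simp add: minus_scale add sc)
  have le1: "\<phi> a \<in> \<real> \<and> Re (\<phi> a) \<le> 1" if a: "a \<in> carrier C" "star C a = a" "nrm C a < 1" for a
  proof -
    obtain y where y: "y \<in> carrier C" "star C y = y" "y \<otimes> y = \<one> \<ominus> a"
      using square_root_one_minus[OF a] by blast
    have "1 - \<phi> a \<in> \<real>\<^sub>\<ge>\<^sub>0" using pos[OF y(1,2)] y(3) a by (simp add: sub one)
    then show ?thesis by (auto simp: complex_nonneg_Reals_iff complex_is_Real_iff)
  qed
  have sa: "cmod (\<phi> a) \<le> nrm C a" if a: "a \<in> carrier C" "star C a = a" for a
  proof (rule field_le_epsilon)
    fix e :: real assume e: "e > 0"
    define t where "t = 1 / (nrm C a + e)"
    have t: "t > 0" using e nrm_nonneg[OF a(1)] by (simp add: t_def)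
    have "nrm C a < nrm C a + e" using e by simp
    then have "nrm C a * t < 1" using e nrm_nonneg[OF a(1)] by (simp add: t_def)
    then have "\<phi> (of_real t \<odot> a) \<in> \<real> \<and> Re (\<phi> (of_real t \<odot> a)) \<le> 1"
      "\<phi> (of_real (-t) \<odot> a) \<in> \<real> \<and> Re (\<phi> (of_real (-t) \<odot> a)) \<le> 1"
      using a t by (intro le1; simp add: star_smult nrm_smult mult.commute)+
    then have "\<bar>Re (\<phi> a)\<bar> * t \<le> 1" "\<phi> a \<in> \<real>"
      using a t by (auto simp: sc abs_if complex_is_Real_iff mult.commute)
    then have "cmod (\<phi> a) * t \<le> 1" by (auto elim!: Reals_cases)
    then show "cmod (\<phi> a) \<le> nrm C a + e" using t e nrm_nonneg[OF a(1)] by (simp add: t_def field_simps)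
  qed
  let ?a = "(1/2) \<odot> (x \<oplus> star C x)" and ?b = "(-\<i>/2) \<odot> (x \<ominus> star C x)"
  have "cmod (\<phi> ?a) \<le> nrm C ?a"
    using x by (intro sa) (simp_all add: star_smult star_add star_star star_closed add_comm)
  also have "\<dots> \<le> nrm C x"
    using x nrm_triangle[of x "star C x"] by (simp add: nrm_smult star_closed)
  finally have A: "cmod (\<phi> ?a) \<le> nrm C x" .
  have "star C x \<ominus> x = (-1) \<odot> (x \<ominus> star C x)"
    using x star_closed[OF x] by (simp add: uminus_scale[symmetric]) algebra
  then have "star C ?b = ?b" using x
    by (simp add: star_smult star_minus star_star star_closed scale_scale)
  then have "cmod (\<phi> ?b) \<le> nrm C ?b" using x by (intro sa) (simp_all add: star_closed)
  also have "\<dots> \<le> nrm C x"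
    using x nrm_triangle[of x "\<ominus> star C x"] by (simp add: nrm_smult star_closed a_minus_def norm_divide)
  finally have B: "cmod (\<phi> ?b) \<le> nrm C x" .
  have "\<phi> x = \<phi> ?a + \<i> * \<phi> ?b"
    using x star_closed[OF x] by (simp add: sc add sub field_simps)
  also have "cmod \<dots> \<le> cmod (\<phi> ?a) + cmod (\<phi> ?b)"
    using norm_triangle_ineq[of "\<phi> ?a" "\<i> * \<phi> ?b"] by (simp add: norm_mult)
  finally show ?thesis using A B by simp
qed

end

text \<open>
  Introduction rule that needs no knowledge of the algebraic locales behind \<^locale>\<open>star_algebra\<close>; the
  negative of \<open>x\<close> is supplied as \<open>(-1) \<odot> x\<close>.
\<close>

lemma star_algebraI:
  fixes C (structure)
  assumes "\<zero> \<in> carrier C" "\<one> \<in> carrier C"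
    and "\<And>x y. x \<in> carrier C \<Longrightarrow> y \<in> carrier C \<Longrightarrow> x \<oplus> y \<in> carrier C"
    and "\<And>x y. x \<in> carrier C \<Longrightarrow> y \<in> carrier C \<Longrightarrow> x \<otimes> y \<in> carrier C"
    and sc: "\<And>c x. x \<in> carrier C \<Longrightarrow> c \<odot> x \<in> carrier C"
    and "\<And>x. x \<in> carrier C \<Longrightarrow> star C x \<in> carrier C"
    and "\<And>x y z. x \<in> carrier C \<Longrightarrow> y \<in> carrier C \<Longrightarrow> z \<in> carrier C \<Longrightarrow> (x \<oplus> y) \<oplus> z = x \<oplus> (y \<oplus> z)"
    and comm: "\<And>x y. x \<in> carrier C \<Longrightarrow> y \<in> carrier C \<Longrightarrow> x \<oplus> y = y \<oplus> x"
    and "\<And>x. x \<in> carrier C \<Longrightarrow> \<zero> \<oplus> x = x"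
    and neg: "\<And>x. x \<in> carrier C \<Longrightarrow> x \<oplus> (-1) \<odot> x = \<zero>"
    and "\<And>x y z. x \<in> carrier C \<Longrightarrow> y \<in> carrier C \<Longrightarrow> z \<in> carrier C \<Longrightarrow> (x \<otimes> y) \<otimes> z = x \<otimes> (y \<otimes> z)"
    and "\<And>x. x \<in> carrier C \<Longrightarrow> \<one> \<otimes> x = x"
    and "\<And>x. x \<in> carrier C \<Longrightarrow> x \<otimes> \<one> = x"
    and "\<And>x y z. x \<in> carrier C \<Longrightarrow> y \<in> carrier C \<Longrightarrow> z \<in> carrier C \<Longrightarrow> (x \<oplus> y) \<otimes> z = x \<otimes> z \<oplus> y \<otimes> z"
    and "\<And>x y z. x \<in> carrier C \<Longrightarrow> y \<in> carrier C \<Longrightarrow> z \<in> carrier C \<Longrightarrow> z \<otimes> (x \<oplus> y) = z \<otimes> x \<oplus> z \<otimes> y"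
    and "\<And>a b x. x \<in> carrier C \<Longrightarrow> (a + b) \<odot> x = a \<odot> x \<oplus> b \<odot> x"
    and "\<And>a x y. x \<in> carrier C \<Longrightarrow> y \<in> carrier C \<Longrightarrow> a \<odot> (x \<oplus> y) = a \<odot> x \<oplus> a \<odot> y"
    and "\<And>a b x. x \<in> carrier C \<Longrightarrow> (a * b) \<odot> x = a \<odot> (b \<odot> x)"
    and "\<And>x. x \<in> carrier C \<Longrightarrow> 1 \<odot> x = x"
    and "\<And>c x y. x \<in> carrier C \<Longrightarrow> y \<in> carrier C \<Longrightarrow> (c \<odot> x) \<otimes> y = c \<odot> (x \<otimes> y)"
    and "\<And>c x y. x \<in> carrier C \<Longrightarrow> y \<in> carrier C \<Longrightarrow> x \<otimes> (c \<odot> y) = c \<odot> (x \<otimes> y)"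
    and "\<And>x. x \<in> carrier C \<Longrightarrow> star C (star C x) = x"
    and "\<And>x y. x \<in> carrier C \<Longrightarrow> y \<in> carrier C \<Longrightarrow> star C (x \<oplus> y) = star C x \<oplus> star C y"
    and "\<And>c x. x \<in> carrier C \<Longrightarrow> star C (c \<odot> x) = cnj c \<odot> star C x"
    and "\<And>x y. x \<in> carrier C \<Longrightarrow> y \<in> carrier C \<Longrightarrow> star C (x \<otimes> y) = star C y \<otimes> star C x"
  shows "star_algebra C"
proof -
  have ab: "abelian_group C"
  proof (rule abelian_groupI)
    fix x assume "x \<in> carrier C"
    then show "\<exists>y\<in>carrier C. y \<oplus> x = \<zero>" using neg sc comm by metis
  qed (use assms in simp_all)
  have "monoid C" by (rule monoidI) (use assms in simp_all)
  then have "ring C" by (intro ringI ab) (use assms in simp_all)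
  moreover have "Module.module complex_ring C"
    by (rule moduleI) (use assms in \<open>simp_all add: ab cring_complex_ring\<close>)
  ultimately show ?thesis
    by (rule star_algebra.intro) (rule star_algebra_axioms.intro; use assms in simp)
qed

section \<open>The completion of a seminormed *-algebra\<close>

context seminormed_star_algebra
begin

abbreviation "cls \<equiv> cauchy_class C"
abbreviation "K \<equiv> completion C"

lemma cauchy_seqs_closed: "s \<in> cauchy_seqs C \<Longrightarrow> s n \<in> carrier C"
  by (auto simp: cauchy_seqs_def)

lemma cauchy_seqsI:
  assumes "\<And>n. s n \<in> carrier C"
    and "\<And>e. e > 0 \<Longrightarrow> \<exists>M. \<forall>m\<ge>M. \<forall>n\<ge>M. nrm C (s m \<ominus> s n) < e"
  shows "s \<in> cauchy_seqs C"
  using assms by (auto simp: cauchy_seqs_def)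

lemma cauchy_seqsD:
  assumes "s \<in> cauchy_seqs C" "e > 0"
  obtains M where "\<And>m n. m \<ge> M \<Longrightarrow> n \<ge> M \<Longrightarrow> nrm C (s m \<ominus> s n) < e"
  using assms unfolding cauchy_seqs_def by blast

lemma cauchy_seqs_dominated:
  assumes "\<And>n. s n \<in> carrier C" "t \<in> cauchy_seqs C"
    and "\<And>m n. nrm C (s m \<ominus> s n) \<le> c * nrm C (t m \<ominus> t n)"
  shows "s \<in> cauchy_seqs C"
proof (rule cauchy_seqsI)
  fix e :: real assume e: "e > 0"
  have "e / (\<bar>c\<bar> + 1) > 0" using e by simp
  then obtain M where M: "\<And>m n. m \<ge> M \<Longrightarrow> n \<ge> M \<Longrightarrow> nrm C (t m \<ominus> t n) < e / (\<bar>c\<bar> + 1)"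
    using cauchy_seqsD[OF assms(2)] by metis
  have "nrm C (s m \<ominus> s n) < e" if "m \<ge> M" "n \<ge> M" for m n
  proof -
    have nn: "0 \<le> nrm C (t m \<ominus> t n)" using assms(2) cauchy_seqs_closed nrm_nonneg by simp
    then have "c * nrm C (t m \<ominus> t n) \<le> (\<bar>c\<bar> + 1) * nrm C (t m \<ominus> t n)"
      by (intro mult_right_mono) auto
    also have "\<dots> < e" using M[OF that] by (simp add: field_simps)
    finally show ?thesis using assms(3)[of m n] by simp
  qed
  then show "\<exists>M. \<forall>m\<ge>M. \<forall>n\<ge>M. nrm C (s m \<ominus> s n) < e" by blast
qed (fact assms(1))

lemma cauchy_const [simp]: "x \<in> carrier C \<Longrightarrow> (\<lambda>n. x) \<in> cauchy_seqs C"
  by (rule cauchy_seqsI) simp_all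

lemma cauchy_scale: "s \<in> cauchy_seqs C \<Longrightarrow> (\<lambda>n. c \<odot> s n) \<in> cauchy_seqs C"
  by (rule cauchy_seqs_dominated[where c="cmod c"])
    (auto simp: cauchy_seqs_closed nrm_scale_minus_scale)

lemma cauchy_star: "s \<in> cauchy_seqs C \<Longrightarrow> (\<lambda>n. star C (s n)) \<in> cauchy_seqs C"
  by (rule cauchy_seqs_dominated[where c=1])
    (auto simp: cauchy_seqs_closed star_closed nrm_star_minus_star)

lemma cauchy_add:
  assumes "s \<in> cauchy_seqs C" "t \<in> cauchy_seqs C"
  shows "(\<lambda>n. s n \<oplus> t n) \<in> cauchy_seqs C"
proof (rule cauchy_seqsI)
  fix e :: real assume e: "e > 0"
  obtain M1 where M1: "\<And>m n. m \<ge> M1 \<Longrightarrow> n \<ge> M1 \<Longrightarrow> nrm C (s m \<ominus> s n) < e / 2"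
    using cauchy_seqsD[OF assms(1)] e by (metis half_gt_zero)
  obtain M2 where M2: "\<And>m n. m \<ge> M2 \<Longrightarrow> n \<ge> M2 \<Longrightarrow> nrm C (t m \<ominus> t n) < e / 2"
    using cauchy_seqsD[OF assms(2)] e by (metis half_gt_zero)
  have "nrm C ((s m \<oplus> t m) \<ominus> (s n \<oplus> t n)) < e" if "m \<ge> max M1 M2" "n \<ge> max M1 M2" for m n
    using nrm_plus_minus_plus[of "s m" "t m" "s n" "t n"] M1[of m n] M2[of m n] that assms cauchy_seqs_closed
    by force
  then show "\<exists>M. \<forall>m\<ge>M. \<forall>n\<ge>M. nrm C ((s m \<oplus> t m) \<ominus> (s n \<oplus> t n)) < e" by blast
qed (use assms cauchy_seqs_closed in simp)

lemma cauchy_nrm_convergent: assumes "s \<in> cauchy_seqs C" shows "convergent (\<lambda>n. nrm C (s n))"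
proof -
  have "Cauchy (\<lambda>n. nrm C (s n))"
  proof (rule CauchyI)
    fix e :: real assume "0 < e"
    then obtain M where M: "\<And>m n. m \<ge> M \<Longrightarrow> n \<ge> M \<Longrightarrow> nrm C (s m \<ominus> s n) < e"
      using cauchy_seqsD[OF assms] by metis
    have "norm (nrm C (s m) - nrm C (s n)) < e" if "m \<ge> M" "n \<ge> M" for m n
      using nrm_diff_le[of "s m" "s n"] cauchy_seqs_closed[OF assms] M[OF that] by simp
    then show "\<exists>M. \<forall>m\<ge>M. \<forall>n\<ge>M. norm (nrm C (s m) - nrm C (s n)) < e" by blast
  qed
  then show ?thesis by (simp add: Cauchy_convergent_iff)
qed

lemma cauchy_bounded:
  assumes "s \<in> cauchy_seqs C" obtains B where "B > 0" "\<And>n. nrm C (s n) \<le> B"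
proof -
  have "Bseq (\<lambda>n. nrm C (s n))" using cauchy_nrm_convergent[OF assms] by (rule Bseq_conv_Bfun[THEN iffD2, OF Bseq_conv_Bfun[THEN iffD1, OF convergent_imp_Bseq]])
  then show ?thesis using that unfolding Bseq_def by (metis abs_le_D1 real_norm_def)
qed

lemma cauchy_mult:
  assumes "s \<in> cauchy_seqs C" "t \<in> cauchy_seqs C"
  shows "(\<lambda>n. s n \<otimes> t n) \<in> cauchy_seqs C"
proof (rule cauchy_seqsI)
  fix e :: real assume e: "e > 0"
  obtain B1 where B1: "B1 > 0" "\<And>n. nrm C (s n) \<le> B1" using cauchy_bounded[OF assms(1)] by blast
  obtain B2 where B2: "B2 > 0" "\<And>n. nrm C (t n) \<le> B2" using cauchy_bounded[OF assms(2)] by blast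
  have "e / (2 * B2) > 0" "e / (2 * B1) > 0" using e B1 B2 by auto
  then obtain M1 M2 where M1: "\<And>m n. m \<ge> M1 \<Longrightarrow> n \<ge> M1 \<Longrightarrow> nrm C (s m \<ominus> s n) < e / (2 * B2)"
    and M2: "\<And>m n. m \<ge> M2 \<Longrightarrow> n \<ge> M2 \<Longrightarrow> nrm C (t m \<ominus> t n) < e / (2 * B1)"
    using cauchy_seqsD[OF assms(1)] cauchy_seqsD[OF assms(2)] by metis
  have "nrm C ((s m \<otimes> t m) \<ominus> (s n \<otimes> t n)) < e" if "m \<ge> max M1 M2" "n \<ge> max M1 M2" for m n
  proof -
    have c: "s m \<in> carrier C" "s n \<in> carrier C" "t m \<in> carrier C" "t n \<in> carrier C"
      using assms cauchy_seqs_closed by auto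
    have "nrm C ((s m \<otimes> t m) \<ominus> (s n \<otimes> t n)) \<le>
        nrm C (s m \<ominus> s n) * nrm C (t m) + nrm C (s n) * nrm C (t m \<ominus> t n)"
      using c by (intro nrm_mult_minus_mult)
    also have "\<dots> \<le> nrm C (s m \<ominus> s n) * B2 + B1 * nrm C (t m \<ominus> t n)"
      using B1 B2 c nrm_nonneg by (intro add_mono mult_left_mono mult_right_mono) auto
    also have "\<dots> < e / (2 * B2) * B2 + B1 * (e / (2 * B1))"
      using M1[of m n] M2[of m n] that B1 B2 by (intro add_strict_mono mult_strict_left_mono mult_strict_right_mono) auto
    also have "\<dots> = e" using B1 B2 by (simp add: field_simps)
    finally show ?thesis .
  qed
  then show "\<exists>M. \<forall>m\<ge>M. \<forall>n\<ge>M. nrm C ((s m \<otimes> t m) \<ominus> (s n \<otimes> t n)) < e" by blast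
qed (use assms cauchy_seqs_closed in simp)

lemma cls_eq_iff:
  assumes "s \<in> cauchy_seqs C" "t \<in> cauchy_seqs C"
  shows "cls s = cls t \<longleftrightarrow> (\<lambda>n. nrm C (s n \<ominus> t n)) \<longlonglongrightarrow> 0"
proof
  have "t \<in> cls t" using assms cauchy_seqs_closed by (simp add: cauchy_class_def)
  moreover assume "cls s = cls t"
  ultimately have "t \<in> cls s" by simp
  then show "(\<lambda>n. nrm C (s n \<ominus> t n)) \<longlonglongrightarrow> 0" by (simp add: cauchy_class_def)
next
  have *: "cls s \<subseteq> cls t" if "s \<in> cauchy_seqs C" "t \<in> cauchy_seqs C"
    "(\<lambda>n. nrm C (t n \<ominus> s n)) \<longlonglongrightarrow> 0" for s t
  proof (clarsimp simp: cauchy_class_def)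
    fix r assume r: "r \<in> cauchy_seqs C" "(\<lambda>n. nrm C (s n \<ominus> r n)) \<longlonglongrightarrow> 0"
    have "(\<lambda>n. nrm C (t n \<ominus> s n) + nrm C (s n \<ominus> r n)) \<longlonglongrightarrow> 0"
      using tendsto_add[OF that(3) r(2)] by simp
    then show "(\<lambda>n. nrm C (t n \<ominus> r n)) \<longlonglongrightarrow> 0"
      by (rule tendsto_sandwich[OF _ _ tendsto_const, rotated 2])
        (use that r cauchy_seqs_closed nrm_minus_triangle nrm_nonneg in auto)
  qed
  assume "(\<lambda>n. nrm C (s n \<ominus> t n)) \<longlonglongrightarrow> 0"
  moreover from this have "(\<lambda>n. nrm C (t n \<ominus> s n)) \<longlonglongrightarrow> 0"
    using assms cauchy_seqs_closed nrm_minus_commute by simp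
  ultimately show "cls s = cls t" using *[of s t] *[of t s] assms by blast
qed

lemma repr_cls:
  assumes "s \<in> cauchy_seqs C"
  shows "repr (cls s) \<in> cauchy_seqs C" "cls (repr (cls s)) = cls s"
    "(\<lambda>n. nrm C (s n \<ominus> repr (cls s) n)) \<longlonglongrightarrow> 0"
proof -
  have "s \<in> cls s" using assms cauchy_seqs_closed by (simp add: cauchy_class_def)
  then have "repr (cls s) \<in> cls s" unfolding repr_def by (rule someI[where P="\<lambda>r. r \<in> cls s"])
  then show *: "repr (cls s) \<in> cauchy_seqs C" "(\<lambda>n. nrm C (s n \<ominus> repr (cls s) n)) \<longlonglongrightarrow> 0"
    by (auto simp: cauchy_class_def)
  then show "cls (repr (cls s)) = cls s" using cls_eq_iff assms by metis
qed

lemma completion_carrier: "carrier K = cls ` cauchy_seqs C"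
  by (simp add: completion_def)

lemma cls_closed: "s \<in> cauchy_seqs C \<Longrightarrow> cls s \<in> carrier K"
  by (simp add: completion_carrier)

lemma repr_cauchy: "X \<in> carrier K \<Longrightarrow> repr X \<in> cauchy_seqs C"
  and cls_repr: "X \<in> carrier K \<Longrightarrow> cls (repr X) = X"
  using repr_cls by (auto simp: completion_carrier)

lemma cls_add:
  assumes "s \<in> cauchy_seqs C" "t \<in> cauchy_seqs C"
  shows "cls s \<oplus>\<^bsub>K\<^esub> cls t = cls (\<lambda>n. s n \<oplus> t n)"
proof -
  let ?s = "repr (cls s)" and ?t = "repr (cls t)"
  note c = assms repr_cls(1)[OF assms(1)] repr_cls(1)[OF assms(2)]
  have "(\<lambda>n. nrm C (s n \<ominus> ?s n) + nrm C (t n \<ominus> ?t n)) \<longlonglongrightarrow> 0"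
    using tendsto_add[OF repr_cls(3)[OF assms(1)] repr_cls(3)[OF assms(2)]] by simp
  then have "(\<lambda>n. nrm C ((s n \<oplus> t n) \<ominus> (?s n \<oplus> ?t n))) \<longlonglongrightarrow> 0"
    by (rule tendsto_sandwich[OF _ _ tendsto_const, rotated 2])
      (use c cauchy_seqs_closed nrm_plus_minus_plus nrm_nonneg in auto)
  then show ?thesis
    using c by (subst eq_commute) (simp add: completion_def cls_eq_iff cauchy_add)
qed

lemma cls_mult:
  assumes "s \<in> cauchy_seqs C" "t \<in> cauchy_seqs C"
  shows "cls s \<otimes>\<^bsub>K\<^esub> cls t = cls (\<lambda>n. s n \<otimes> t n)"
proof -
  let ?s = "repr (cls s)" and ?t = "repr (cls t)"
  note c = assms repr_cls(1)[OF assms(1)] repr_cls(1)[OF assms(2)]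
  obtain B1 where B1: "B1 > 0" "\<And>n. nrm C (?s n) \<le> B1" using cauchy_bounded[OF c(3)] by blast
  obtain B2 where B2: "B2 > 0" "\<And>n. nrm C (t n) \<le> B2" using cauchy_bounded[OF c(2)] by blast
  have "(\<lambda>n. nrm C (s n \<ominus> ?s n) * B2 + B1 * nrm C (t n \<ominus> ?t n)) \<longlonglongrightarrow> 0 * B2 + B1 * 0"
    using assms by (intro tendsto_intros repr_cls(3))
  then have *: "(\<lambda>n. nrm C (s n \<ominus> ?s n) * B2 + B1 * nrm C (t n \<ominus> ?t n)) \<longlonglongrightarrow> 0" by simp
  have "nrm C ((s n \<otimes> t n) \<ominus> (?s n \<otimes> ?t n)) \<le> nrm C (s n \<ominus> ?s n) * B2 + B1 * nrm C (t n \<ominus> ?t n)" for n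
  proof -
    have cc: "s n \<in> carrier C" "?s n \<in> carrier C" "t n \<in> carrier C" "?t n \<in> carrier C"
      using c cauchy_seqs_closed by auto
    have "nrm C ((s n \<otimes> t n) \<ominus> (?s n \<otimes> ?t n)) \<le>
        nrm C (s n \<ominus> ?s n) * nrm C (t n) + nrm C (?s n) * nrm C (t n \<ominus> ?t n)"
      using cc by (intro nrm_mult_minus_mult)
    also have "\<dots> \<le> nrm C (s n \<ominus> ?s n) * B2 + B1 * nrm C (t n \<ominus> ?t n)"
      using B1 B2 cc nrm_nonneg by (intro add_mono mult_left_mono mult_right_mono) auto
    finally show ?thesis .
  qed
  then have "(\<lambda>n. nrm C ((s n \<otimes> t n) \<ominus> (?s n \<otimes> ?t n))) \<longlonglongrightarrow> 0"
    by (intro tendsto_sandwich[OF _ _ tendsto_const *])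
      (use c cauchy_seqs_closed nrm_nonneg in auto)
  then show ?thesis
    using c by (subst eq_commute) (simp add: completion_def cls_eq_iff cauchy_mult)
qed

lemma cls_scale:
  assumes "s \<in> cauchy_seqs C"
  shows "c \<odot>\<^bsub>K\<^esub> cls s = cls (\<lambda>n. c \<odot> s n)"
proof -
  note c = assms repr_cls(1)[OF assms(1)]
  have "(\<lambda>n. nrm C (c \<odot> s n \<ominus> c \<odot> repr (cls s) n)) \<longlonglongrightarrow> 0"
    using c cauchy_seqs_closed tendsto_mult_right_zero[OF repr_cls(3)[OF assms]]
    by (simp add: nrm_scale_minus_scale)
  then show ?thesis
    using c by (subst eq_commute) (simp add: completion_def cls_eq_iff cauchy_scale)
qed

lemma cls_star:
  assumes "s \<in> cauchy_seqs C"
  shows "star K (cls s) = cls (\<lambda>n. star C (s n))"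
proof -
  note c = assms repr_cls(1)[OF assms(1)]
  have "(\<lambda>n. nrm C (star C (s n) \<ominus> star C (repr (cls s) n))) \<longlonglongrightarrow> 0"
    using c cauchy_seqs_closed repr_cls(3)[OF assms] by (simp add: nrm_star_minus_star)
  then show ?thesis
    using c by (subst eq_commute) (simp add: completion_def cls_eq_iff cauchy_star)
qed

lemma cls_nrm:
  assumes "s \<in> cauchy_seqs C"
  shows "(\<lambda>n. nrm C (s n)) \<longlonglongrightarrow> nrm K (cls s)"
proof -
  note c = assms repr_cls(1)[OF assms(1)]
  have "(\<lambda>n. nrm C (repr (cls s) n)) \<longlonglongrightarrow> nrm K (cls s)"
    using cauchy_nrm_convergent[OF c(2)] by (simp add: completion_def convergent_LIMSEQ_iff)
  moreover have "(\<lambda>n. nrm C (s n) - nrm C (repr (cls s) n)) \<longlonglongrightarrow> 0"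
    by (rule tendsto_rabs_zero_cancel, rule tendsto_sandwich[OF _ _ tendsto_const repr_cls(3)[OF assms]])
      (use c cauchy_seqs_closed nrm_diff_le in auto)
  ultimately show ?thesis using tendsto_add by fastforce
qed

lemma completion_star_algebra: "star_algebra K"
proof -
  have one: "\<one>\<^bsub>K\<^esub> = cls (\<lambda>n. \<one>)" and zero: "\<zero>\<^bsub>K\<^esub> = cls (\<lambda>n. \<zero>)"
    by (simp_all add: completion_def)
  have [simp]: "s n \<in> carrier C" if "s \<in> cauchy_seqs C" for s n
    using that by (rule cauchy_seqs_closed)
  note [simp] = star_closed
  have n: "x \<oplus> (-1) \<odot> x = \<zero>" if "x \<in> carrier C" for x
    using that by (simp add: uminus_scale[symmetric] minus_self)
  note s = completion_carrier one zero cls_add cls_mult cls_scale cls_star cauchy_add cauchy_mult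
    cauchy_scale cauchy_star
  show ?thesis
    by (rule star_algebraI; clarsimp simp: s; (intro imageI cauchy_add cauchy_mult cauchy_scale cauchy_star)?;
      (simp add: s add_comm; fail)?; (simp add: s add_assoc mult_assoc distrib_left distrib_right n scale_add_left
        scale_add_right scale_scale smult_mult_left smult_mult_right star_star star_add star_smult star_mult; fail)?)
qed

lemma cls_minus:
  assumes "s \<in> cauchy_seqs C" "t \<in> cauchy_seqs C"
  shows "cls s \<ominus>\<^bsub>K\<^esub> cls t = cls (\<lambda>n. s n \<ominus> t n)"
proof -
  interpret K: star_algebra K by (rule completion_star_algebra)
  show ?thesis using assms cauchy_seqs_closed
    by (simp add: K.minus_scale minus_scale cls_closed cls_scale cls_add cauchy_scale)
qed

lemma completion_seminormed: "seminormed_star_algebra K"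
proof -
  interpret K: star_algebra K by (rule completion_star_algebra)
  have [simp]: "s n \<in> carrier C" if "s \<in> cauchy_seqs C" for s n
    using that by (rule cauchy_seqs_closed)
  note [simp] = star_closed
  show ?thesis
  proof unfold_locales
    fix x assume "x \<in> carrier K"
    then obtain s where s: "s \<in> cauchy_seqs C" "x = cls s" by (auto simp: completion_carrier)
    show "0 \<le> nrm K x"
      unfolding s using s(1) by (intro tendsto_lowerbound[OF cls_nrm]) (auto simp: nrm_nonneg)
    fix c show "nrm K (c \<odot>\<^bsub>K\<^esub> x) = cmod c * nrm K x"
      unfolding s cls_scale[OF s(1)]
      using cls_nrm[OF cauchy_scale[OF s(1), of c]] tendsto_mult_left[OF cls_nrm[OF s(1)], of "cmod c"] s(1)
      by (simp add: nrm_smult LIMSEQ_unique)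
    have "(\<lambda>n. nrm C (star C (s n) \<otimes> s n)) \<longlonglongrightarrow> (nrm K x)\<^sup>2"
      using tendsto_power[OF cls_nrm[OF s(1)], of 2] s by (simp add: cstar_identity)
    then show "nrm K (star K x \<otimes>\<^bsub>K\<^esub> x) = (nrm K x)\<^sup>2"
      unfolding s cls_star[OF s(1)] cls_mult[OF cauchy_star[OF s(1)] s(1)]
      using cls_nrm[OF cauchy_mult[OF cauchy_star[OF s(1)] s(1)]] by (simp add: LIMSEQ_unique)
  next
    fix x y assume "x \<in> carrier K" "y \<in> carrier K"
    then obtain s t where s: "s \<in> cauchy_seqs C" "x = cls s" and t: "t \<in> cauchy_seqs C" "y = cls t"
      by (auto simp: completion_carrier)
    show "nrm K (x \<oplus>\<^bsub>K\<^esub> y) \<le> nrm K x + nrm K y"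
      unfolding s(2) t(2) cls_add[OF s(1) t(1)] using s(1) t(1)
      by (intro LIMSEQ_le[OF cls_nrm[OF cauchy_add[OF s(1) t(1)]] tendsto_add[OF cls_nrm[OF s(1)] cls_nrm[OF t(1)]]])
        (auto simp: nrm_triangle)
    show "nrm K (x \<otimes>\<^bsub>K\<^esub> y) \<le> nrm K x * nrm K y"
      unfolding s(2) t(2) cls_mult[OF s(1) t(1)] using s(1) t(1)
      by (intro LIMSEQ_le[OF cls_nrm[OF cauchy_mult[OF s(1) t(1)]] tendsto_mult[OF cls_nrm[OF s(1)] cls_nrm[OF t(1)]]])
        (auto simp: nrm_mult)
  qed
qed

lemma embed_closed: "x \<in> carrier C \<Longrightarrow> embed C x \<in> carrier K"
  by (simp add: embed_def cls_closed)

lemma embed_one: "embed C \<one> = \<one>\<^bsub>K\<^esub>" and embed_zero: "embed C \<zero> = \<zero>\<^bsub>K\<^esub>"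
  by (simp_all add: embed_def completion_def)

lemma embed_add:
  "x \<in> carrier C \<Longrightarrow> y \<in> carrier C \<Longrightarrow> embed C (x \<oplus> y) = embed C x \<oplus>\<^bsub>K\<^esub> embed C y"
  and embed_mult:
  "x \<in> carrier C \<Longrightarrow> y \<in> carrier C \<Longrightarrow> embed C (x \<otimes> y) = embed C x \<otimes>\<^bsub>K\<^esub> embed C y"
  and embed_minus:
  "x \<in> carrier C \<Longrightarrow> y \<in> carrier C \<Longrightarrow> embed C (x \<ominus> y) = embed C x \<ominus>\<^bsub>K\<^esub> embed C y"
  and embed_scale: "x \<in> carrier C \<Longrightarrow> embed C (c \<odot> x) = c \<odot>\<^bsub>K\<^esub> embed C x"
  and embed_star: "x \<in> carrier C \<Longrightarrow> embed C (star C x) = star K (embed C x)"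
  and embed_nrm: "x \<in> carrier C \<Longrightarrow> nrm K (embed C x) = nrm C x"
  using cls_nrm[OF cauchy_const, of x] LIMSEQ_unique
  by (auto simp: embed_def cls_add cls_mult cls_minus cls_scale cls_star)

lemma embed_eq_iff:
  "x \<in> carrier C \<Longrightarrow> y \<in> carrier C \<Longrightarrow> embed C x = embed C y \<longleftrightarrow> nrm C (x \<ominus> y) = 0"
  by (simp add: embed_def cls_eq_iff LIMSEQ_const_iff)

text \<open>
  The constant sequences approximate a class of Cauchy sequences along its members, which makes
  the completion a closure of the original algebra.
\<close>

lemma embed_dense:
  assumes "s \<in> cauchy_seqs C"
  shows "converges K (\<lambda>n. embed C (s n)) (cls s)"
  unfolding converges_def
proof (rule LIMSEQ_I)
  fix e :: real assume "e > 0"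
  then obtain M where M: "\<And>m n. m \<ge> M \<Longrightarrow> n \<ge> M \<Longrightarrow> nrm C (s m \<ominus> s n) < e / 2"
    using cauchy_seqsD[OF assms] by (metis half_gt_zero)
  interpret K: seminormed_star_algebra K by (rule completion_seminormed)
  have "norm (nrm K (embed C (s n) \<ominus>\<^bsub>K\<^esub> cls s) - 0) < e" if n: "n \<ge> M" for n
  proof -
    have c: "(\<lambda>m. s n \<ominus> s m) \<in> cauchy_seqs C"
      using assms cauchy_seqs_closed by (simp add: minus_scale cauchy_add cauchy_scale)
    have "(\<lambda>m. nrm C (s n \<ominus> s m)) \<longlonglongrightarrow> nrm K (embed C (s n) \<ominus>\<^bsub>K\<^esub> cls s)"
      using cls_nrm[OF c] assms cauchy_seqs_closed by (simp add: embed_def cls_minus)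
    then have "nrm K (embed C (s n) \<ominus>\<^bsub>K\<^esub> cls s) \<le> e / 2"
      by (rule tendsto_upperbound) (use M n in \<open>auto simp: eventually_sequentially intro!: exI[of _ M] less_imp_le\<close>)
    then show ?thesis
      using K.nrm_nonneg[of "embed C (s n) \<ominus>\<^bsub>K\<^esub> cls s"] \<open>e > 0\<close> assms
        embed_closed cauchy_seqs_closed cls_closed by simp
  qed
  then show "\<exists>M. \<forall>n\<ge>M. norm (nrm K (embed C (s n) \<ominus>\<^bsub>K\<^esub> cls s) - 0) < e" by blast
qed

text \<open>
  A Cauchy sequence of classes is shadowed by a Cauchy sequence in the original algebra, chosen within
  \<open>1 / (k + 1)\<close> of the \<open>k\<close>-th class; its own class is the limit.
\<close>

lemma completion_cstar: "cstar_algebra K"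
proof -
  interpret K: seminormed_star_algebra K by (rule completion_seminormed)
  show ?thesis
  proof unfold_locales
    fix x assume x: "x \<in> carrier K" "nrm K x = 0"
    then obtain s where s: "s \<in> cauchy_seqs C" "x = cls s" by (auto simp: completion_carrier)
    have "(\<lambda>n. nrm C (s n \<ominus> \<zero>)) \<longlonglongrightarrow> 0"
      using cls_nrm[OF s(1)] x(2) s cauchy_seqs_closed[OF s(1)] by (simp add: a_minus_def)
    then have "cls s = cls (\<lambda>n. \<zero>)" using s by (simp add: cls_eq_iff)
    then show "x = \<zero>\<^bsub>K\<^esub>" using s by (simp add: completion_def)
  next
    fix X assume X: "X \<in> cauchy_seqs K"
    then have Xc: "X k \<in> carrier K" for k by (rule K.cauchy_seqs_closed)
    have "\<exists>x\<in>carrier C. nrm K (embed C x \<ominus>\<^bsub>K\<^esub> X k) < 1 / Suc k" for k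
    proof -
      obtain s where s: "s \<in> cauchy_seqs C" "X k = cls s" using Xc by (auto simp: completion_carrier)
      have "\<forall>\<^sub>F n in sequentially. nrm K (embed C (s n) \<ominus>\<^bsub>K\<^esub> X k) < 1 / Suc k"
        using embed_dense[OF s(1)] order_tendstoD(2)[of _ 0 sequentially "1 / Suc k"]
        by (simp add: converges_def s(2))
      then obtain n where "nrm K (embed C (s n) \<ominus>\<^bsub>K\<^esub> X k) < 1 / Suc k"
        by (auto simp: eventually_sequentially)
      then show ?thesis using cauchy_seqs_closed[OF s(1)] by blast
    qed
    then obtain x where x: "\<And>k. x k \<in> carrier C"
      and xX: "\<And>k. nrm K (embed C (x k) \<ominus>\<^bsub>K\<^esub> X k) < 1 / Suc k" by metis
    have lim: "(\<lambda>k. nrm K (embed C (x k) \<ominus>\<^bsub>K\<^esub> X k)) \<longlonglongrightarrow> 0"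
      by (rule tendsto_sandwich[OF _ _ tendsto_const LIMSEQ_inverse_real_of_nat])
        (use xX x Xc embed_closed K.nrm_nonneg in \<open>auto simp: inverse_eq_divide intro!: always_eventually less_imp_le\<close>)
    have "x \<in> cauchy_seqs C"
    proof (rule cauchy_seqsI)
      fix e :: real assume e: "e > 0"
      obtain M1 where M1: "\<And>m n. m \<ge> M1 \<Longrightarrow> n \<ge> M1 \<Longrightarrow> nrm K (X m \<ominus>\<^bsub>K\<^esub> X n) < e / 3"
        using K.cauchy_seqsD[OF X] e by (metis divide_pos_pos zero_less_numeral)
      obtain M2 where M2: "\<And>k. k \<ge> M2 \<Longrightarrow> nrm K (embed C (x k) \<ominus>\<^bsub>K\<^esub> X k) < e / 3"
        using order_tendstoD(2)[OF lim, of "e / 3"] e by (auto simp: eventually_sequentially)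
      have "nrm C (x m \<ominus> x n) < e" if "m \<ge> max M1 M2" "n \<ge> max M1 M2" for m n
      proof -
        have "nrm C (x m \<ominus> x n) = nrm K (embed C (x m) \<ominus>\<^bsub>K\<^esub> embed C (x n))"
          using x by (simp add: embed_minus[symmetric] embed_nrm)
        also have "\<dots> \<le> nrm K (embed C (x m) \<ominus>\<^bsub>K\<^esub> X m) + nrm K (X m \<ominus>\<^bsub>K\<^esub> embed C (x n))"
          using x Xc embed_closed by (intro K.nrm_minus_triangle) auto
        also have "nrm K (X m \<ominus>\<^bsub>K\<^esub> embed C (x n)) \<le>
            nrm K (X m \<ominus>\<^bsub>K\<^esub> X n) + nrm K (X n \<ominus>\<^bsub>K\<^esub> embed C (x n))"
          using x Xc embed_closed by (intro K.nrm_minus_triangle) auto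
        also have "nrm K (X n \<ominus>\<^bsub>K\<^esub> embed C (x n)) = nrm K (embed C (x n) \<ominus>\<^bsub>K\<^esub> X n)"
          using x Xc embed_closed by (intro K.nrm_minus_commute) auto
        finally show ?thesis using M1[of m n] M2[of m] M2[of n] that by simp
      qed
      then show "\<exists>M. \<forall>m\<ge>M. \<forall>n\<ge>M. nrm C (x m \<ominus> x n) < e" by blast
    qed (fact x)
    note xc = this
    have "(\<lambda>k. nrm K (embed C (x k) \<ominus>\<^bsub>K\<^esub> X k) + nrm K (embed C (x k) \<ominus>\<^bsub>K\<^esub> cls x)) \<longlonglongrightarrow> 0"
      using tendsto_add[OF lim embed_dense[OF xc, unfolded converges_def]] by simp
    then have "converges K X (cls x)" unfolding converges_def
    proof (rule tendsto_sandwich[OF _ _ tendsto_const, rotated 2])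
      have "nrm K (X k \<ominus>\<^bsub>K\<^esub> cls x) \<le>
        nrm K (embed C (x k) \<ominus>\<^bsub>K\<^esub> X k) + nrm K (embed C (x k) \<ominus>\<^bsub>K\<^esub> cls x)" for k
        using K.nrm_minus_triangle[of "X k" "embed C (x k)" "cls x"]
          K.nrm_minus_commute[of "X k" "embed C (x k)"] x Xc embed_closed cls_closed[OF xc] by simp
      then show "\<forall>\<^sub>F k in sequentially. nrm K (X k \<ominus>\<^bsub>K\<^esub> cls x) \<le>
        nrm K (embed C (x k) \<ominus>\<^bsub>K\<^esub> X k) + nrm K (embed C (x k) \<ominus>\<^bsub>K\<^esub> cls x)" by simp
    qed (use Xc cls_closed[OF xc] K.nrm_nonneg in auto)
    then show "\<exists>x\<in>carrier K. converges K X x" using cls_closed[OF xc] by blast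
  qed
qed

lemma completion_induct:
  assumes X: "X \<in> carrier K"
    and emb: "\<And>x. x \<in> carrier C \<Longrightarrow> P (embed C x)"
    and lim: "\<And>s Y. (\<And>n. s n \<in> carrier K) \<Longrightarrow> (\<And>n. P (s n)) \<Longrightarrow> Y \<in> carrier K \<Longrightarrow>
      converges K s Y \<Longrightarrow> P Y"
  shows "P X"
proof -
  obtain s where s: "s \<in> cauchy_seqs C" "X = cls s" using X by (auto simp: completion_carrier)
  show ?thesis
    by (rule lim[of "\<lambda>n. embed C (s n)"])
      (use s X cauchy_seqs_closed embed_closed embed_dense emb in auto)
qed

definition extend :: "('a \<Rightarrow> complex) \<Rightarrow> (nat \<Rightarrow> 'a) set \<Rightarrow> complex" where
  "extend \<omega> X = lim (\<lambda>n. \<omega> (repr X n))"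

context
  fixes \<omega> :: "'a \<Rightarrow> complex"
  assumes om_add: "\<And>x y. x \<in> carrier C \<Longrightarrow> y \<in> carrier C \<Longrightarrow> \<omega> (x \<oplus> y) = \<omega> x + \<omega> y"
    and om_scale: "\<And>c x. x \<in> carrier C \<Longrightarrow> \<omega> (c \<odot> x) = c * \<omega> x"
    and om_bound: "\<And>x. x \<in> carrier C \<Longrightarrow> cmod (\<omega> x) \<le> nrm C x"
begin

lemma om_minus: "x \<in> carrier C \<Longrightarrow> y \<in> carrier C \<Longrightarrow> \<omega> (x \<ominus> y) = \<omega> x - \<omega> y"
  by (simp add: minus_scale om_add om_scale)

lemma extend_cls:
  assumes s: "s \<in> cauchy_seqs C"
  shows "(\<lambda>n. \<omega> (s n)) \<longlonglongrightarrow> extend \<omega> (cls s)"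
proof -
  have "Cauchy (\<lambda>n. \<omega> (t n))" if t: "t \<in> cauchy_seqs C" for t
  proof (rule CauchyI)
    fix e :: real assume "0 < e"
    then obtain M where M: "\<And>m n. m \<ge> M \<Longrightarrow> n \<ge> M \<Longrightarrow> nrm C (t m \<ominus> t n) < e"
      using cauchy_seqsD[OF t] by metis
    have "norm (\<omega> (t m) - \<omega> (t n)) < e" if "m \<ge> M" "n \<ge> M" for m n
      using om_bound[of "t m \<ominus> t n"] om_minus[of "t m" "t n"] cauchy_seqs_closed[OF t] M[OF that]
      by simp
    then show "\<exists>M. \<forall>m\<ge>M. \<forall>n\<ge>M. norm (\<omega> (t m) - \<omega> (t n)) < e" by blast
  qed
  then have "(\<lambda>n. \<omega> (repr (cls s) n)) \<longlonglongrightarrow> extend \<omega> (cls s)"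
    using repr_cls(1)[OF s] by (simp add: extend_def Cauchy_convergent_iff convergent_LIMSEQ_iff)
  moreover have "(\<lambda>n. \<omega> (s n) - \<omega> (repr (cls s) n)) \<longlonglongrightarrow> 0"
    by (rule tendsto_norm_zero_cancel, rule tendsto_sandwich[OF _ _ tendsto_const repr_cls(3)[OF s]])
      (use s repr_cls(1)[OF s] cauchy_seqs_closed om_bound[of "s _ \<ominus> repr (cls s) _"] in \<open>auto simp: om_minus\<close>)
  ultimately show ?thesis using tendsto_add by fastforce
qed

lemma extend_embed: "x \<in> carrier C \<Longrightarrow> extend \<omega> (embed C x) = \<omega> x"
  unfolding embed_def using LIMSEQ_unique[OF extend_cls[OF cauchy_const] tendsto_const] by simp

lemma extend_add:
  assumes "X \<in> carrier K" "Y \<in> carrier K"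
  shows "extend \<omega> (X \<oplus>\<^bsub>K\<^esub> Y) = extend \<omega> X + extend \<omega> Y"
proof -
  obtain s t where s: "s \<in> cauchy_seqs C" "X = cls s" and t: "t \<in> cauchy_seqs C" "Y = cls t"
    using assms by (auto simp: completion_carrier)
  have "(\<lambda>n. \<omega> (s n) + \<omega> (t n)) \<longlonglongrightarrow> extend \<omega> (X \<oplus>\<^bsub>K\<^esub> Y)"
    using extend_cls[OF cauchy_add[OF s(1) t(1)]] s t cauchy_seqs_closed by (simp add: cls_add om_add)
  then show ?thesis
    using LIMSEQ_unique[OF _ tendsto_add[OF extend_cls[OF s(1)] extend_cls[OF t(1)]]] s(2) t(2) by simp
qed

lemma extend_scale:
  assumes "X \<in> carrier K"
  shows "extend \<omega> (c \<odot>\<^bsub>K\<^esub> X) = c * extend \<omega> X"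
proof -
  obtain s where s: "s \<in> cauchy_seqs C" "X = cls s"
    using assms by (auto simp: completion_carrier)
  have "(\<lambda>n. c * \<omega> (s n)) \<longlonglongrightarrow> extend \<omega> (c \<odot>\<^bsub>K\<^esub> X)"
    using extend_cls[OF cauchy_scale[OF s(1)]] s cauchy_seqs_closed by (simp add: cls_scale om_scale)
  then show ?thesis
    using LIMSEQ_unique[OF _ tendsto_mult_left[OF extend_cls[OF s(1)], of c]] s(2) by simp
qed

lemma extend_bound:
  assumes "X \<in> carrier K"
  shows "cmod (extend \<omega> X) \<le> nrm K X"
proof -
  obtain s where s: "s \<in> cauchy_seqs C" "X = cls s"
    using assms by (auto simp: completion_carrier)
  show ?thesis unfolding s(2)
    by (rule LIMSEQ_le[OF tendsto_norm[OF extend_cls[OF s(1)]] cls_nrm[OF s(1)]])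
      (use om_bound cauchy_seqs_closed[OF s(1)] in auto)
qed

lemma extend_positive:
  assumes pos: "\<And>x. x \<in> carrier C \<Longrightarrow> \<omega> (star C x \<otimes> x) \<in> \<real>\<^sub>\<ge>\<^sub>0" and "X \<in> carrier K"
  shows "extend \<omega> (star K X \<otimes>\<^bsub>K\<^esub> X) \<in> \<real>\<^sub>\<ge>\<^sub>0"
proof -
  obtain s where s: "s \<in> cauchy_seqs C" "X = cls s"
    using assms by (auto simp: completion_carrier)
  have "(\<lambda>n. \<omega> (star C (s n) \<otimes> s n)) \<longlonglongrightarrow> extend \<omega> (star K X \<otimes>\<^bsub>K\<^esub> X)"
    using extend_cls[OF cauchy_mult[OF cauchy_star[OF s(1)] s(1)]]
    by (simp add: s(2) cls_star[OF s(1)] cls_mult[OF cauchy_star[OF s(1)] s(1)])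
  then show ?thesis
    using pos cauchy_seqs_closed[OF s(1)]
    by (intro Lim_in_closed_set[OF closed_nonneg_Reals_complex _ trivial_limit_sequentially,
      where f="\<lambda>n. \<omega> (star C (s n) \<otimes> s n)"]) auto
qed

end

end

section \<open>The free *-algebra and its representations\<close>

abbreviation "lookup \<equiv> Poly_Mapping.lookup"
abbreviation "keys \<equiv> Poly_Mapping.keys"
abbreviation "single \<equiv> Poly_Mapping.single"

definition words :: "'g set \<Rightarrow> 'g nc_poly set" where
  "words G = {x. \<forall>w\<in>keys x. fst ` set (letters w) \<subseteq> G}"

text \<open>
  The involution of \<^const>\<open>free_star_algebra\<close>.
\<close>

definition nc_star :: "'g nc_poly \<Rightarrow> 'g nc_poly" where
  "nc_star x = (\<Sum>w\<in>keys x. single (star_word w) (cnj (lookup x w)))"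

lemma free_star_algebra_simps [simp]:
  "carrier (free_star_algebra G p) = words G"
  "x \<otimes>\<^bsub>free_star_algebra G p\<^esub> y = x * y"
  "\<one>\<^bsub>free_star_algebra G p\<^esub> = 1"
  "\<zero>\<^bsub>free_star_algebra G p\<^esub> = 0"
  "x \<oplus>\<^bsub>free_star_algebra G p\<^esub> y = x + y"
  "c \<odot>\<^bsub>free_star_algebra G p\<^esub> x = single 0 c * x"
  "star (free_star_algebra G p) x = nc_star x"
  "nrm (free_star_algebra G p) = p"
  by (simp_all add: free_star_algebra_def words_def nc_star_def)

lemma single_mult_commute: "single 0 c * x = x * single 0 (c :: complex)" for x :: "'g nc_poly"
proof -
  have *: "single 0 c * single w d = single w d * single 0 c" for w and d :: complex
    by (simp add: mult_single mult.commute)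
  have x: "x = (\<Sum>w\<in>keys x. single w (lookup x w))"
    by (rule poly_mapping_eqI) (simp add: lookup_sum lookup_single when_def in_keys_iff)
  show ?thesis by (subst (1 2) x) (simp add: sum_distrib_left sum_distrib_right *)
qed

lemma lookup_single_mult: "lookup (single 0 c * x) w = c * lookup x w" for x :: "'g nc_poly"
  by (simp add: mult_map_scale_conv_mult[symmetric] Poly_Mapping.map.rep_eq when_def)

lemma nc_poly_expand: "x = (\<Sum>w\<in>keys x. single w (lookup x w))" for x :: "'g nc_poly"
  by (rule poly_mapping_eqI) (simp add: lookup_sum lookup_single when_def in_keys_iff)

lemma words_zero: "0 \<in> words G" and words_one: "1 \<in> words G"
  and words_add: "x \<in> words G \<Longrightarrow> y \<in> words G \<Longrightarrow> x + y \<in> words G"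
  and words_mult: "x \<in> words G \<Longrightarrow> y \<in> words G \<Longrightarrow> x * y \<in> words G"
  and words_single: "fst ` set (letters w) \<subseteq> G \<Longrightarrow> single w c \<in> words G"
proof -
  show "1 \<in> words G" by (simp add: words_def zero_word_def)
  show "x + y \<in> words G" if "x \<in> words G" "y \<in> words G"
    using that Poly_Mapping.keys_add[of x y] by (auto simp: words_def)
  show "x * y \<in> words G" if "x \<in> words G" "y \<in> words G"
    using that keys_mult[of x y] by (fastforce simp: words_def plus_word_def)
qed (auto simp: words_def)

lemma words_induct [consumes 1, case_names zero single add]:
  assumes "x \<in> words G" "P 0"
    and single: "\<And>w c. fst ` set (letters w) \<subseteq> G \<Longrightarrow> P (single w c)"
    and add: "\<And>x y. x \<in> words G \<Longrightarrow> y \<in> words G \<Longrightarrow> P x \<Longrightarrow> P y \<Longrightarrow> P (x + y)"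
  shows "P x"
proof -
  have "P (\<Sum>w\<in>S. single w (lookup x w)) \<and> (\<Sum>w\<in>S. single w (lookup x w)) \<in> words G"
    if "S \<subseteq> keys x" for S
    using finite_subset[OF that finite_keys] that
  proof induction
    case (insert w F)
    have "fst ` set (letters w) \<subseteq> G" using insert assms(1) by (auto simp: words_def)
    then show ?case using insert single add words_add[of "single w (lookup x w)" G] words_single[of w G]
      by simp
  qed (use assms words_zero in auto)
  then show ?thesis using nc_poly_expand[of x] by (metis order_refl)
qed

lemma nc_poly_induct [case_names zero single add]:
  assumes "P 0" "\<And>w c. P (single w c)" "\<And>x y. P x \<Longrightarrow> P y \<Longrightarrow> P (x + y)"
  shows "P (x :: 'g nc_poly)"
  by (rule words_induct[of x UNIV]) (use assms in \<open>auto simp: words_def\<close>)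

lemma star_word_star_word [simp]: "star_word (star_word w) = w"
  by (simp add: star_word_def rev_map[symmetric] o_def case_prod_beta)

lemma star_word_plus: "star_word (v + w) = star_word w + star_word v"
  by (simp add: star_word_def plus_word_def)

lemma star_word_zero [simp]: "star_word 0 = 0"
  by (simp add: star_word_def zero_word_def)

lemma letters_star_word: "fst ` set (letters (star_word w)) = fst ` set (letters w)"
  by (force simp: star_word_def image_image case_prod_beta)

lemma lookup_nc_star: "lookup (nc_star x) w = cnj (lookup x (star_word w))"
proof -
  have *: "(star_word v = w) = (v = star_word w)" for v by auto
  show ?thesis
    by (simp add: nc_star_def lookup_sum lookup_single when_def * in_keys_iff)
qed

lemma nc_star_add: "nc_star (x + y) = nc_star x + nc_star y"
  by (rule poly_mapping_eqI) (simp add: lookup_nc_star lookup_add)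

lemma nc_star_single: "nc_star (single w c) = single (star_word w) (cnj c)"
  by (rule poly_mapping_eqI) (auto simp: lookup_nc_star lookup_single when_def)

lemma nc_star_zero [simp]: "nc_star 0 = 0"
  by (rule poly_mapping_eqI) (simp add: lookup_nc_star)

lemma nc_star_mult: "nc_star (x * y) = nc_star y * nc_star x"
proof (induction x rule: nc_poly_induct)
  case (single v a)
  show ?case
    by (induction y rule: nc_poly_induct)
      (simp_all add: mult_single nc_star_single star_word_plus mult.commute nc_star_add algebra_simps)
qed (simp_all add: nc_star_add algebra_simps)

lemma words_scale: "x \<in> words G \<Longrightarrow> single 0 c * x \<in> words G"
  by (intro words_mult words_single) (auto simp: zero_word_def)

lemma words_star: "x \<in> words G \<Longrightarrow> nc_star x \<in> words G"
  by (induction x rule: words_induct)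
    (simp_all add: words_zero nc_star_single letters_star_word nc_star_add words_add words_single)

lemma words_gen: "g \<in> G \<Longrightarrow> gen g \<in> words G"
  by (simp add: gen_def words_single)

lemma star_algebra_free: "star_algebra (free_star_algebra G p)"
proof (rule star_algebraI, simp_all add: words_zero words_one words_add words_mult words_scale words_star
    algebra_simps nc_star_add nc_star_mult)
  fix x :: "'a nc_poly"
  show "x + single 0 (- 1) * x = 0" by (rule poly_mapping_eqI) (simp add: lookup_add lookup_single_mult)
  fix c show "nc_star x * nc_star (single 0 c) = single 0 (cnj c) * nc_star x"
    by (simp add: nc_star_single single_mult_commute)
  show "x * (single 0 c * y) = single 0 c * (x * y)" for y
    by (metis mult.assoc single_mult_commute)
  show "nc_star (nc_star x) = x" by (rule poly_mapping_eqI) (simp add: lookup_nc_star)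
  fix a b
  show "single 0 (a + b) * x = single 0 a * x + single 0 b * x"
    by (simp add: single_add algebra_simps)
  show "single 0 (a * b) * x = single 0 a * (single 0 b * x)"
    by (simp add: mult.assoc[symmetric] mult_single)
qed

lemma free_minus: "x \<in> words G \<Longrightarrow> y \<in> words G \<Longrightarrow> x \<ominus>\<^bsub>free_star_algebra G p\<^esub> y = x - y"
proof -
  interpret star_algebra "free_star_algebra G p" by (rule star_algebra_free)
  assume "x \<in> words G" "y \<in> words G"
  then have "x \<ominus>\<^bsub>free_star_algebra G p\<^esub> y = x + single 0 (-1) * y" by (simp add: minus_scale)
  also have "\<dots> = x - y" by (rule poly_mapping_eqI) (simp add: lookup_add lookup_single_mult lookup_minus)
  finally show ?thesis .
qed

lemma words_minus: "x \<in> words G \<Longrightarrow> y \<in> words G \<Longrightarrow> x - y \<in> words G"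
  using free_minus[of x G y "\<lambda>_. 0"] star_algebra.axioms(1)[OF star_algebra_free[of G "\<lambda>_. 0"]]
  by (metis free_star_algebra_simps(1) abelian_group.minus_closed ring.is_abelian_group)

subsection \<open>Finitely supported functions as a pre-Hilbert space\<close>

definition supp :: "('i \<Rightarrow> complex) \<Rightarrow> 'i set" where
  "supp \<xi> = {i. \<xi> i \<noteq> 0}"

definition ip :: "('i \<Rightarrow> complex) \<Rightarrow> ('i \<Rightarrow> complex) \<Rightarrow> complex" where
  "ip \<xi> \<eta> = (\<Sum>i\<in>supp \<xi>. cnj (\<xi> i) * \<eta> i)"

definition l2 :: "('i \<Rightarrow> complex) \<Rightarrow> real" where
  "l2 \<xi> = L2_set (\<lambda>i. cmod (\<xi> i)) (supp \<xi>)"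

lemma ip_superset: "finite S \<Longrightarrow> supp \<xi> \<subseteq> S \<Longrightarrow> ip \<xi> \<eta> = (\<Sum>i\<in>S. cnj (\<xi> i) * \<eta> i)"
  unfolding ip_def by (rule sum.mono_neutral_left) (auto simp: supp_def)

lemma l2_superset: "finite S \<Longrightarrow> supp \<xi> \<subseteq> S \<Longrightarrow> l2 \<xi> = L2_set (\<lambda>i. cmod (\<xi> i)) S"
  unfolding l2_def L2_set_def by (rule arg_cong[of _ _ sqrt], rule sum.mono_neutral_left) (auto simp: supp_def)

lemma l2_nonneg [simp]: "0 \<le> l2 \<xi>" by (simp add: l2_def L2_set_nonneg)

lemma ip_self: "ip \<xi> \<xi> = of_real ((l2 \<xi>)\<^sup>2)"
  by (simp add: ip_def l2_def L2_set_def sum_nonneg complex_norm_square[unfolded of_real_power] mult.commute)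

lemma supp_add: "supp (\<lambda>i. \<xi> i + \<eta> i) \<subseteq> supp \<xi> \<union> supp \<eta>"
  and supp_scale: "supp (\<lambda>i. c * \<xi> i) \<subseteq> supp \<xi>"
  by (auto simp: supp_def)

lemma finite_supp_add:
  "finite (supp \<xi>) \<Longrightarrow> finite (supp \<eta>) \<Longrightarrow> finite (supp (\<lambda>i. \<xi> i + \<eta> i))"
  and finite_supp_scale: "finite (supp \<xi>) \<Longrightarrow> finite (supp (\<lambda>i. c * \<xi> i))"
  using supp_add[of \<xi> \<eta>] supp_scale[of c \<xi>] by (auto intro: finite_subset)

lemma ip_le: assumes "finite (supp \<xi>)" "finite (supp \<eta>)" shows "cmod (ip \<xi> \<eta>) \<le> l2 \<xi> * l2 \<eta>"
proof -
  let ?S = "supp \<xi> \<union> supp \<eta>"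
  have "cmod (ip \<xi> \<eta>) \<le> (\<Sum>i\<in>?S. \<bar>cmod (\<xi> i)\<bar> * \<bar>cmod (\<eta> i)\<bar>)"
    using assms by (subst ip_superset[of ?S]) (auto intro!: sum_norm_le simp: norm_mult)
  also have "\<dots> \<le> L2_set (\<lambda>i. cmod (\<xi> i)) ?S * L2_set (\<lambda>i. cmod (\<eta> i)) ?S"
    by (rule L2_set_mult_ineq)
  also have "\<dots> = l2 \<xi> * l2 \<eta>" using assms by (simp add: l2_superset[of ?S])
  finally show ?thesis .
qed

lemma l2_add:
  assumes "finite (supp \<xi>)" "finite (supp \<eta>)"
  shows "l2 (\<lambda>i. \<xi> i + \<eta> i) \<le> l2 \<xi> + l2 \<eta>"
proof -
  let ?S = "supp \<xi> \<union> supp \<eta>"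
  have "l2 (\<lambda>i. \<xi> i + \<eta> i) = L2_set (\<lambda>i. cmod (\<xi> i + \<eta> i)) ?S"
    using assms supp_add[of \<xi> \<eta>] by (intro l2_superset) auto
  also have "\<dots> \<le> L2_set (\<lambda>i. cmod (\<xi> i) + cmod (\<eta> i)) ?S"
    by (intro L2_set_mono norm_triangle_ineq) auto
  also have "\<dots> \<le> L2_set (\<lambda>i. cmod (\<xi> i)) ?S + L2_set (\<lambda>i. cmod (\<eta> i)) ?S"
    by (rule L2_set_triangle_ineq)
  also have "\<dots> = l2 \<xi> + l2 \<eta>" using assms by (simp add: l2_superset[of ?S])
  finally show ?thesis .
qed

lemma l2_scale:
  assumes "finite (supp \<xi>)"
  shows "l2 (\<lambda>i. c * \<xi> i) = cmod c * l2 \<xi>"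
  using assms supp_scale[of c \<xi>]
  by (simp add: l2_superset[of "supp \<xi>"] norm_mult L2_set_right_distrib)

lemma supp_zero [simp]: "supp (\<lambda>i. 0) = {}" by (simp add: supp_def)

lemma l2_zero [simp]: "l2 (\<lambda>i. 0) = 0" by (simp add: l2_def)

lemma ip_add_right: "ip \<xi> (\<lambda>i. \<eta> i + \<zeta> i) = ip \<xi> \<eta> + ip \<xi> \<zeta>"
  and ip_scale_right: "ip \<xi> (\<lambda>i. c * \<eta> i) = c * ip \<xi> \<eta>"
  by (simp_all add: ip_def sum.distrib algebra_simps sum_distrib_left)

lemma ip_commute: "finite (supp \<xi>) \<Longrightarrow> finite (supp \<eta>) \<Longrightarrow> ip \<xi> \<eta> = cnj (ip \<eta> \<xi>)"
  by (simp add: ip_superset[of "supp \<xi> \<union> supp \<eta>"] mult.commute)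

text \<open>
  An adjoint for every operator gives the C*-identity for the operator norm, by way of
  \<open>\<parallel>T \<xi>\<parallel>\<^sup>2 = \<langle>\<xi>, T* T \<xi>\<rangle>\<close>.
\<close>

locale bounded_star_rep =
  fixes G :: "'g set" and op :: "'g \<times> bool \<Rightarrow> ('i \<Rightarrow> complex) \<Rightarrow> 'i \<Rightarrow> complex"
  assumes op_add: "op l (\<lambda>i. \<xi> i + \<eta> i) = (\<lambda>i. op l \<xi> i + op l \<eta> i)"
    and op_scale: "op l (\<lambda>i. c * \<xi> i) = (\<lambda>i. c * op l \<xi> i)"
    and op_supp: "g \<in> G \<Longrightarrow> finite (supp \<xi>) \<Longrightarrow> finite (supp (op (g, b) \<xi>))"
    and op_adjoint: "g \<in> G \<Longrightarrow> finite (supp \<xi>) \<Longrightarrow> finite (supp \<eta>) \<Longrightarrow>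
      ip (op (g, False) \<xi>) \<eta> = ip \<xi> (op (g, True) \<eta>)"
    and op_bound: "g \<in> G \<Longrightarrow> \<exists>c\<ge>0. \<forall>\<xi>. finite (supp \<xi>) \<longrightarrow> l2 (op (g, False) \<xi>) \<le> c * l2 \<xi>"
begin

definition rep :: "'g nc_poly \<Rightarrow> ('i \<Rightarrow> complex) \<Rightarrow> 'i \<Rightarrow> complex" where
  "rep x \<xi> i = (\<Sum>w\<in>keys x. lookup x w * foldr op (letters w) \<xi> i)"

lemma foldr_add: "foldr op ls (\<lambda>i. \<xi> i + \<eta> i) = (\<lambda>i. foldr op ls \<xi> i + foldr op ls \<eta> i)"
  and foldr_scale: "foldr op ls (\<lambda>i. c * \<xi> i) = (\<lambda>i. c * foldr op ls \<xi> i)"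
  by (induction ls) (simp_all add: op_add op_scale)

lemma rep_superset:
  "finite S \<Longrightarrow> keys x \<subseteq> S \<Longrightarrow> rep x \<xi> i = (\<Sum>w\<in>S. lookup x w * foldr op (letters w) \<xi> i)"
  unfolding rep_def by (rule sum.mono_neutral_left) (auto simp: in_keys_iff)

lemma rep_add: "rep (x + y) \<xi> = (\<lambda>i. rep x \<xi> i + rep y \<xi> i)"
proof
  fix i
  have "keys (x + y) \<subseteq> keys x \<union> keys y" by (rule Poly_Mapping.keys_add)
  then show "rep (x + y) \<xi> i = rep x \<xi> i + rep y \<xi> i"
    by (simp add: rep_superset[of "keys x \<union> keys y"] lookup_add sum.distrib algebra_simps)
qed

lemma rep_single: "rep (single w c) \<xi> = (\<lambda>i. c * foldr op (letters w) \<xi> i)"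
  by (rule ext) (simp add: rep_def)

lemma rep_zero [simp]: "rep 0 \<xi> = (\<lambda>i. 0)"
  by (rule ext) (simp add: rep_def)

lemma rep_vector_add: "rep x (\<lambda>i. \<xi> i + \<eta> i) = (\<lambda>i. rep x \<xi> i + rep x \<eta> i)"
  and rep_vector_scale: "rep x (\<lambda>i. c * \<xi> i) = (\<lambda>i. c * rep x \<xi> i)"
  by (auto simp: rep_def foldr_add foldr_scale sum.distrib algebra_simps sum_distrib_left)

lemma rep_vector_zero: "rep x (\<lambda>i. 0) = (\<lambda>i. 0)"
  using rep_vector_scale[of x 0 "\<lambda>i. 0"] by simp

lemma rep_mult: "rep (x * y) \<xi> = rep x (rep y \<xi>)"
proof (induction x rule: nc_poly_induct)
  case (single v a)
  show ?case
    by (induction y rule: nc_poly_induct)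
      (simp_all add: mult_single rep_single plus_word_def foldr_scale mult.assoc rep_add distrib_left
        rep_vector_add rep_vector_zero)
qed (simp_all add: rep_add distrib_right)

lemma rep_one: "rep 1 \<xi> = \<xi>"
  using rep_single[of 0 1 \<xi>] by (simp add: zero_word_def del: single_one flip: single_one)

lemma rep_scale: "rep (single 0 c * x) \<xi> = (\<lambda>i. c * rep x \<xi> i)"
  by (simp add: rep_mult rep_single zero_word_def)

lemma rep_gen: "rep (gen g) \<xi> = op (g, False) \<xi>"
  by (simp add: gen_def rep_single)

lemma rep_star_gen: "rep (nc_star (gen g)) \<xi> = op (g, True) \<xi>"
  by (simp add: gen_def rep_single nc_star_single star_word_def)

lemma rep_minus: "rep (x - y) \<xi> = (\<lambda>i. rep x \<xi> i - rep y \<xi> i)"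
  using rep_add[of "x - y" y \<xi>] by (auto simp: fun_eq_iff)

lemma rep_supp: "x \<in> words G \<Longrightarrow> finite (supp \<xi>) \<Longrightarrow> finite (supp (rep x \<xi>))"
proof (induction x rule: words_induct)
  case (single w c)
  then have "finite (supp (foldr op ls \<xi>))" if "fst ` set ls \<subseteq> G" for ls
    using that by (induction ls) (auto intro: op_supp)
  then show ?case using single by (simp add: rep_single finite_supp_scale)
qed (simp_all add: rep_add finite_supp_add)

lemma op_adjoint': 
  assumes "g \<in> G" "finite (supp \<xi>)" "finite (supp \<eta>)"
  shows "ip (op (g, b) \<xi>) \<eta> = ip \<xi> (op (g, \<not> b) \<eta>)"
proof (cases b)
  case True
  have "ip (op (g, True) \<xi>) \<eta> = cnj (ip \<eta> (op (g, True) \<xi>))"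
    using assms op_supp by (intro ip_commute) auto
  also have "\<dots> = ip \<xi> (op (g, False) \<eta>)"
    using assms op_supp op_adjoint[of g \<eta> \<xi>] ip_commute[of \<xi> "op (g, False) \<eta>"] by simp
  finally show ?thesis using True by simp
qed (use assms op_adjoint in simp)

lemma rep_adjoint:
  assumes "x \<in> words G" "finite (supp \<xi>)" "finite (supp \<eta>)"
  shows "ip (rep x \<xi>) \<eta> = ip \<xi> (rep (nc_star x) \<eta>)"
  using assms(1)
proof (induction x rule: words_induct)
  case zero then show ?case by (simp add: ip_def)
next
  case (single w c)
  have sw: "finite (supp (foldr op ls \<zeta>))" if "fst ` set ls \<subseteq> G" "finite (supp \<zeta>)" for ls \<zeta>
    using that by (induction ls) (auto intro: op_supp)
  have w: "ip (foldr op ls \<xi>) \<eta> = ip \<xi> (foldr op (rev (map (\<lambda>(g, b). (g, \<not> b)) ls)) \<eta>)"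
    if "fst ` set ls \<subseteq> G" for ls
    using that assms(3)
  proof (induction ls arbitrary: \<eta>)
    case (Cons l ls)
    obtain g b where l: "l = (g, b)" by force
    have "ip (foldr op (l # ls) \<xi>) \<eta> = ip (foldr op ls \<xi>) (op (g, \<not> b) \<eta>)"
      using Cons.prems assms sw by (simp add: l op_adjoint')
    also have "\<dots> = ip \<xi> (foldr op (rev (map (\<lambda>(g, b). (g, \<not> b)) ls)) (op (g, \<not> b) \<eta>))"
      using Cons.prems l op_supp by (intro Cons.IH) auto
    finally show ?case by (simp add: l)
  qed simp
  have "ip (\<lambda>i. c * foldr op (letters w) \<xi> i) \<eta> = cnj c * ip (foldr op (letters w) \<xi>) \<eta>"
    using ip_superset[OF sw[OF single assms(2)] supp_scale, of c] 
    by (simp add: ip_def sum_distrib_left mult.assoc)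
  then show ?case using w[OF single] by (simp add: rep_single nc_star_single star_word_def ip_scale_right)
next
  case (add x y)
  have "ip (\<lambda>i. \<zeta> i + \<zeta>' i) \<eta> = ip \<zeta> \<eta> + ip \<zeta>' \<eta>" if "finite (supp \<zeta>)" "finite (supp \<zeta>')" for \<zeta> \<zeta>'
    using that supp_add[of \<zeta> \<zeta>']
    by (simp add: ip_superset[of "supp \<zeta> \<union> supp \<zeta>'"] sum.distrib algebra_simps)
  then show ?case using add rep_supp assms by (simp add: rep_add nc_star_add ip_add_right)
qed

text \<open>
  A word is bounded because each of its letters is, and the adjoint of a bounded operator obeys the
  same bound: \<open>\<parallel>T* \<xi>\<parallel>\<^sup>2 = \<langle>T T* \<xi>, \<xi>\<rangle> \<le> c \<parallel>T* \<xi>\<parallel> \<parallel>\<xi>\<parallel>\<close>.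
\<close>

lemma rep_bounded:
  assumes "x \<in> words G"
  obtains c where "c \<ge> 0" "\<And>\<xi>. finite (supp \<xi>) \<Longrightarrow> l2 (rep x \<xi>) \<le> c * l2 \<xi>"
proof -
  have op_b: "\<exists>c\<ge>0. \<forall>\<xi>. finite (supp \<xi>) \<longrightarrow> l2 (op (g, b) \<xi>) \<le> c * l2 \<xi>" if g: "g \<in> G" for g b
  proof -
    obtain c where c: "c \<ge> 0" "\<And>\<xi>. finite (supp \<xi>) \<Longrightarrow> l2 (op (g, False) \<xi>) \<le> c * l2 \<xi>"
      using op_bound[OF g] by blast
    have "l2 (op (g, True) \<xi>) \<le> c * l2 \<xi>" if \<xi>: "finite (supp \<xi>)" for \<xi>
    proof -
      let ?\<eta> = "op (g, True) \<xi>"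
      have fin: "finite (supp ?\<eta>)" using g \<xi> by (rule op_supp)
      have "l2 ?\<eta> * l2 ?\<eta> = cmod (ip ?\<eta> ?\<eta>)" by (simp add: ip_self power2_eq_square norm_mult)
      also have "ip ?\<eta> ?\<eta> = ip (op (g, False) ?\<eta>) \<xi>" using op_adjoint[OF g fin \<xi>] by simp
      also have "cmod \<dots> \<le> l2 (op (g, False) ?\<eta>) * l2 \<xi>" using g fin \<xi> by (intro ip_le op_supp)
      also have "\<dots> \<le> c * l2 ?\<eta> * l2 \<xi>" using c(2)[OF fin] by (intro mult_right_mono) auto
      finally have *: "l2 ?\<eta> * l2 ?\<eta> \<le> (c * l2 \<xi>) * l2 ?\<eta>" by (simp add: mult_ac)
      show ?thesis
      proof (cases "l2 ?\<eta> = 0")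
        case False
        then have "l2 ?\<eta> > 0" using l2_nonneg[of ?\<eta>] by linarith
        then show ?thesis using * by simp
      qed (use c in simp)
    qed
    then show ?thesis using c by (cases b) auto
  qed
  have "\<exists>c\<ge>0. \<forall>\<xi>. finite (supp \<xi>) \<longrightarrow> l2 (rep x \<xi>) \<le> c * l2 \<xi>"
    using assms
  proof (induction x rule: words_induct)
    case zero then show ?case by (auto intro: exI[of _ 0])
  next
    case (single w a)
    have "\<exists>c\<ge>0. \<forall>\<xi>. finite (supp \<xi>) \<longrightarrow> finite (supp (foldr op ls \<xi>)) \<and> l2 (foldr op ls \<xi>) \<le> c * l2 \<xi>"
      if "fst ` set ls \<subseteq> G" for ls
      using that
    proof (induction ls)
      case Nil then show ?case by (auto intro: exI[of _ 1])
    next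
      case (Cons l ls)
      obtain g b where l: "l = (g, b)" "g \<in> G" using Cons.prems by (cases l) auto
      obtain c where c: "c \<ge> 0" "\<And>\<xi>. finite (supp \<xi>) \<Longrightarrow> finite (supp (foldr op ls \<xi>)) \<and> l2 (foldr op ls \<xi>) \<le> c * l2 \<xi>"
        using Cons by auto
      obtain d where d: "d \<ge> 0" "\<And>\<xi>. finite (supp \<xi>) \<Longrightarrow> l2 (op l \<xi>) \<le> d * l2 \<xi>"
        using op_b[OF l(2), of b] l by blast
      show ?case
      proof (intro exI[of _ "d * c"] conjI allI impI)
        fix \<xi> :: "'i \<Rightarrow> complex" assume \<xi>: "finite (supp \<xi>)"
        show "finite (supp (foldr op (l # ls) \<xi>))" using c(2)[OF \<xi>] l op_supp by simp
        have "l2 (foldr op (l # ls) \<xi>) \<le> d * l2 (foldr op ls \<xi>)" using c(2)[OF \<xi>] d by simp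
        also have "\<dots> \<le> d * (c * l2 \<xi>)" using c(2)[OF \<xi>] d by (intro mult_left_mono) auto
        finally show "l2 (foldr op (l # ls) \<xi>) \<le> d * c * l2 \<xi>" by (simp add: mult.assoc)
      qed (use c d in simp)
    qed
    then obtain c where c: "c \<ge> 0" "\<And>\<xi>. finite (supp \<xi>) \<Longrightarrow>
        finite (supp (foldr op (letters w) \<xi>)) \<and> l2 (foldr op (letters w) \<xi>) \<le> c * l2 \<xi>"
      using single by blast
    show ?case
      by (rule exI[of _ "cmod a * c"])
        (use c in \<open>auto simp: rep_single l2_scale mult.assoc intro!: mult_left_mono\<close>)
  next
    case (add x y)
    then obtain c d where c: "c \<ge> 0" "\<And>\<xi>. finite (supp \<xi>) \<Longrightarrow> l2 (rep x \<xi>) \<le> c * l2 \<xi>"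
      and d: "d \<ge> 0" "\<And>\<xi>. finite (supp \<xi>) \<Longrightarrow> l2 (rep y \<xi>) \<le> d * l2 \<xi>" by blast
    show ?case
    proof (intro exI[of _ "c + d"] conjI allI impI)
      fix \<xi> :: "'i \<Rightarrow> complex" assume \<xi>: "finite (supp \<xi>)"
      show "l2 (rep (x + y) \<xi>) \<le> (c + d) * l2 \<xi>"
        using l2_add[of "rep x \<xi>" "rep y \<xi>"] rep_supp add \<xi> c(2)[OF \<xi>] d(2)[OF \<xi>]
        by (force simp: rep_add algebra_simps)
    qed (use c d in simp)
  qed
  then show ?thesis using that by blast
qed

definition opnorm :: "'g nc_poly \<Rightarrow> real" where
  "opnorm x = Inf {c. c \<ge> 0 \<and> (\<forall>\<xi>. finite (supp \<xi>) \<longrightarrow> l2 (rep x \<xi>) \<le> c * l2 \<xi>)}"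

lemma opnorm_le:
  assumes "c \<ge> 0" "\<And>\<xi>. finite (supp \<xi>) \<Longrightarrow> l2 (rep x \<xi>) \<le> c * l2 \<xi>"
  shows "opnorm x \<le> c"
  unfolding opnorm_def by (rule cInf_lower) (use assms in \<open>auto intro: bdd_belowI[of _ 0]\<close>)

lemma opnorm_nonneg: "x \<in> words G \<Longrightarrow> opnorm x \<ge> 0"
  unfolding opnorm_def by (rule cInf_greatest) (use rep_bounded[of x] in blast)+

lemma rep_le_opnorm:
  assumes "x \<in> words G" "finite (supp \<xi>)"
  shows "l2 (rep x \<xi>) \<le> opnorm x * l2 \<xi>"
proof (cases "l2 \<xi> = 0")
  case True
  then show ?thesis using rep_bounded[OF assms(1)] assms(2) by (metis mult_zero_right)
next
  case False
  then have pos: "l2 \<xi> > 0" using l2_nonneg[of \<xi>] by linarith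
  have "l2 (rep x \<xi>) / l2 \<xi> \<le> opnorm x"
    unfolding opnorm_def
  proof (rule cInf_greatest)
    show "{c. 0 \<le> c \<and> (\<forall>\<xi>. finite (supp \<xi>) \<longrightarrow> l2 (rep x \<xi>) \<le> c * l2 \<xi>)} \<noteq> {}"
      using rep_bounded[OF assms(1)] by blast
  qed (use assms pos in \<open>auto simp: field_simps\<close>)
  then show ?thesis using pos by (simp add: field_simps)
qed

lemma opnorm_mult:
  assumes "x \<in> words G" "y \<in> words G"
  shows "opnorm (x * y) \<le> opnorm x * opnorm y"
proof (rule opnorm_le)
  fix \<xi> :: "'i \<Rightarrow> complex" assume \<xi>: "finite (supp \<xi>)"
  have "l2 (rep (x * y) \<xi>) \<le> opnorm x * l2 (rep y \<xi>)"
    unfolding rep_mult using assms \<xi> by (intro rep_le_opnorm rep_supp)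
  also have "\<dots> \<le> opnorm x * (opnorm y * l2 \<xi>)"
    using assms \<xi> by (intro mult_left_mono rep_le_opnorm opnorm_nonneg)
  finally show "l2 (rep (x * y) \<xi>) \<le> opnorm x * opnorm y * l2 \<xi>" by (simp add: mult.assoc)
qed (use assms opnorm_nonneg in simp)

lemma opnorm_cstar:
  assumes x: "x \<in> words G"
  shows "opnorm (nc_star x * x) = (opnorm x)\<^sup>2"
proof -
  have sq: "(l2 (rep x \<xi>))\<^sup>2 \<le> opnorm (nc_star x * x) * (l2 \<xi>)\<^sup>2" if \<xi>: "finite (supp \<xi>)" for \<xi>
  proof -
    have "(l2 (rep x \<xi>))\<^sup>2 = cmod (ip (rep x \<xi>) (rep x \<xi>))" by (simp add: ip_self norm_power)
    also have "\<dots> = cmod (ip \<xi> (rep (nc_star x * x) \<xi>))"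
      using x \<xi> rep_supp by (simp add: rep_adjoint rep_mult)
    also have "\<dots> \<le> l2 \<xi> * l2 (rep (nc_star x * x) \<xi>)"
      using x \<xi> by (intro ip_le rep_supp words_mult words_star)
    also have "\<dots> \<le> l2 \<xi> * (opnorm (nc_star x * x) * l2 \<xi>)"
      using x \<xi> by (intro mult_left_mono rep_le_opnorm words_mult words_star) auto
    finally show ?thesis by (simp add: power2_eq_square mult_ac)
  qed
  have nn: "opnorm (nc_star x * x) \<ge> 0" using x by (intro opnorm_nonneg words_mult words_star)
  have "opnorm x \<le> sqrt (opnorm (nc_star x * x))"
  proof (rule opnorm_le)
    fix \<xi> :: "'i \<Rightarrow> complex" assume "finite (supp \<xi>)"
    then show "l2 (rep x \<xi>) \<le> sqrt (opnorm (nc_star x * x)) * l2 \<xi>"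
      using real_sqrt_le_mono[OF sq[of \<xi>]] by (simp add: real_sqrt_mult)
  qed (use nn in simp)
  then have 1: "(opnorm x)\<^sup>2 \<le> opnorm (nc_star x * x)"
    using nn opnorm_nonneg[OF x] by (metis power_mono real_sqrt_pow2)
  have "opnorm (nc_star x) \<le> opnorm x"
  proof (rule opnorm_le[OF opnorm_nonneg[OF x]])
    fix \<xi> :: "'i \<Rightarrow> complex" assume \<xi>: "finite (supp \<xi>)"
    let ?\<eta> = "rep (nc_star x) \<xi>"
    have fin: "finite (supp ?\<eta>)" using x \<xi> by (intro rep_supp words_star)
    have "l2 ?\<eta> * l2 ?\<eta> = cmod (ip ?\<eta> ?\<eta>)" by (simp add: ip_self power2_eq_square norm_mult)
    also have "ip ?\<eta> ?\<eta> = ip (rep x ?\<eta>) \<xi>" by (rule rep_adjoint[OF x fin \<xi>, symmetric])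
    also have "cmod \<dots> \<le> l2 (rep x ?\<eta>) * l2 \<xi>" by (intro ip_le rep_supp[OF x fin] \<xi>)
    also have "\<dots> \<le> opnorm x * l2 ?\<eta> * l2 \<xi>" using rep_le_opnorm[OF x fin] by (intro mult_right_mono) auto
    finally have *: "l2 ?\<eta> * l2 ?\<eta> \<le> (opnorm x * l2 \<xi>) * l2 ?\<eta>" by (simp add: mult_ac)
    show "l2 ?\<eta> \<le> opnorm x * l2 \<xi>"
    proof (cases "l2 ?\<eta> = 0")
      case False
      then have "l2 ?\<eta> > 0" using l2_nonneg[of ?\<eta>] by linarith
      then show ?thesis using * by simp
    qed (use opnorm_nonneg[OF x] in simp)
  qed
  then have "opnorm (nc_star x * x) \<le> opnorm x * opnorm x"
    using opnorm_mult[OF words_star[OF x] x] opnorm_nonneg[OF x] mult_right_mono by fastforce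
  then show ?thesis using 1 by (simp add: power2_eq_square)
qed

lemma opnorm_seminorm: "seminormed_star_algebra (free_star_algebra G opnorm)"
proof -
  have add: "opnorm (x + y) \<le> opnorm x + opnorm y" if "x \<in> words G" "y \<in> words G" for x y
  proof (rule opnorm_le)
    fix \<xi> :: "'i \<Rightarrow> complex" assume \<xi>: "finite (supp \<xi>)"
    show "l2 (rep (x + y) \<xi>) \<le> (opnorm x + opnorm y) * l2 \<xi>"
      using l2_add[of "rep x \<xi>" "rep y \<xi>"] that \<xi> rep_supp rep_le_opnorm[of x \<xi>] rep_le_opnorm[of y \<xi>]
      by (simp add: rep_add algebra_simps)
  qed (use that opnorm_nonneg in simp)
  have scale: "opnorm (single 0 c * x) \<le> cmod c * opnorm x" if "x \<in> words G" for x c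
  proof (rule opnorm_le)
    fix \<xi> :: "'i \<Rightarrow> complex" assume \<xi>: "finite (supp \<xi>)"
    show "l2 (rep (single 0 c * x) \<xi>) \<le> cmod c * opnorm x * l2 \<xi>"
      using that \<xi> rep_supp rep_le_opnorm[of x \<xi>]
      by (simp add: rep_scale l2_scale mult.assoc mult_left_mono)
  qed (use that opnorm_nonneg in simp)
  have scale': "opnorm (single 0 c * x) = cmod c * opnorm x" if x: "x \<in> words G" for x c
  proof (cases "c = 0")
    case True
    then show ?thesis using scale[OF x, of c] opnorm_nonneg[OF words_scale[OF x, of c]] by simp
  next
    case False
    have "single 0 (1 / c) * (single 0 c * x) = x"
      using False by (simp add: mult.assoc[symmetric] mult_single)
    then have "opnorm x \<le> cmod (1 / c) * opnorm (single 0 c * x)"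
      using scale[OF words_scale[OF x, of c], of "1 / c"] by simp
    then have "cmod c * opnorm x \<le> opnorm (single 0 c * x)"
      using False by (simp add: norm_divide field_simps)
    then show ?thesis using scale[OF x, of c] by simp
  qed
  show ?thesis
    by (intro seminormed_star_algebra.intro star_algebra_free seminormed_star_algebra_axioms.intro)
      (simp_all add: opnorm_nonneg add scale' opnorm_mult opnorm_cstar)
qed

lemma opnorm_eq_0:
  assumes "x \<in> words G" "y \<in> words G" "\<And>\<xi>. finite (supp \<xi>) \<Longrightarrow> rep x \<xi> = rep y \<xi>"
  shows "opnorm (x - y) = 0"
proof (rule antisym)
  show "opnorm (x - y) \<le> 0" by (rule opnorm_le) (simp_all add: rep_minus assms)
  show "0 \<le> opnorm (x - y)" using assms by (intro opnorm_nonneg words_minus)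
qed

end

section \<open>Fibres of the covering maps of the torus\<close>

lemma coords_norm [simp]: "cmod (coords z $ i) = 1"
  using coords[of z] by simp

lemma coords_nonzero [simp]: "coords z $ i \<noteq> 0"
  using coords_norm[of z i] by fastforce

lemma coords_Torus: "(\<And>i. cmod (z $ i) = 1) \<Longrightarrow> coords (Torus z) = z"
  by (rule Torus_inverse) simp

lemma torus_eqI: "(\<And>i. coords z $ i = coords w $ i) \<Longrightarrow> z = w"
  by (metis coords_inject vec_eq_iff)

lemma norm_character [simp]: "cmod (character m z) = 1"
  by (simp add: character_def prod_norm[symmetric] norm_power_int)

lemma character_nonzero [simp]: "character m z \<noteq> 0"
  using norm_character[of m z] by fastforce

lemma character_0 [simp]: "character 0 z = 1"
  by (simp add: character_def)

lemma character_add: "character (m + n) z = character m z * character n z"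
  by (simp add: character_def power_int_add prod.distrib)

lemma cnj_coords: "cnj (coords z $ i) * coords z $ i = 1" "coords z $ i * cnj (coords z $ i) = 1"
  using complex_norm_square[of "coords z $ i"] by (simp_all add: mult.commute)

lemma character_cnj: "cnj (character m z) = character (- m) z"
proof -
  have c: "cnj (coords z $ i) = inverse (coords z $ i)" for i
    using cnj_coords(1)[of z i] by (simp add: field_simps)
  have "cnj (coords z $ i powi k) = coords z $ i powi (- k)" for i k
    by (cases "k \<ge> 0") (simp_all add: power_int_def c power_inverse)
  then show ?thesis by (simp add: character_def)
qed

lemma character_diff: "character (m - n) z = character m z * cnj (character n z)"
  using character_add[of m "- n" z] by (simp add: character_cnj)

lemma coords_torus_map: "coords (torus_map A z) $ i = character (A $ i) z"
  unfolding torus_map_def by (subst coords_Torus) auto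

lemma character_torus_map: "character n (torus_map A z) = character (transpose A *v n) z"
proof -
  have powi_sum: "(coords z $ j) powi (\<Sum>i\<in>I. k i) = (\<Prod>i\<in>I. coords z $ j powi (k i))" if "finite I" for j I and k :: "'a \<Rightarrow> int"
    using that by induction (auto simp: power_int_add)
  have powi_prod: "(\<Prod>j\<in>J. f j) powi k = (\<Prod>j\<in>J. f j powi k)" if "finite J" for J :: "'a set" and f :: "'a \<Rightarrow> complex" and k
    using that by induction (auto simp: power_int_mult_distrib)
  have "character (transpose A *v n) z = (\<Prod>j\<in>UNIV. \<Prod>i\<in>UNIV. coords z $ j powi (A $ i $ j * n $ i))"
    by (simp add: character_def matrix_vector_mult_def transpose_def powi_sum)
  also have "\<dots> = (\<Prod>i\<in>UNIV. \<Prod>j\<in>UNIV. coords z $ j powi (A $ i $ j * n $ i))"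
    by (rule prod.swap)
  also have "\<dots> = character n (torus_map A z)"
    unfolding character_def[of n] coords_torus_map character_def
    by (simp add: power_int_mult powi_prod)
  finally show ?thesis by simp
qed

definition vint :: "int ^ 'd \<Rightarrow> real ^ 'd" where
  "vint n = (\<chi> i. of_int (n $ i))"

lemma coords_torus_exp: "coords (torus_exp x) $ i = cis (2 * pi * x $ i)"
  unfolding torus_exp_def by (subst coords_Torus) auto

lemma torus_exp_eq_iff: "torus_exp x = torus_exp y \<longleftrightarrow> (\<exists>n. x = y + vint n)"
proof
  assume "torus_exp x = torus_exp y"
  then have "cis (2 * pi * x $ i) = cis (2 * pi * y $ i)" for i
    by (metis coords_torus_exp)
  then have "\<exists>n::int. x $ i = y $ i + n" for i
  proof -
    have "\<exists>n. 2 * pi * x $ i = 2 * pi * y $ i + 2 * pi * real_of_int n"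
      using \<open>cis (2 * pi * x $ i) = cis (2 * pi * y $ i)\<close>
        sin_cos_eq_iff[of "2 * pi * x $ i" "2 * pi * y $ i"]
      by (auto simp: complex_eq_iff mult_ac)
    then show ?thesis by (metis distrib_left mult_cancel_left pi_neq_zero mult_eq_0_iff zero_neq_numeral)
  qed
  then obtain n where "\<And>i. x $ i = y $ i + of_int (n i)" by metis
  then have "x = y + vint (\<chi> i. n i)" by (simp add: vec_eq_iff vint_def)
  then show "\<exists>n. x = y + vint n" ..
next
  assume "\<exists>n. x = y + vint n"
  then obtain n where n: "x = y + vint n" ..
  have "cis (2 * pi * x $ i) = cis (2 * pi * y $ i)" for i
  proof -
    have "2 * pi * x $ i = 2 * pi * y $ i + 2 * pi * of_int (n $ i)" by (simp add: n vint_def algebra_simps)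
    then show ?thesis by (simp add: cis_mult[symmetric] cis_multiple_2pi)
  qed
  then show "torus_exp x = torus_exp y" by (intro torus_eqI) (simp add: coords_torus_exp)
qed

text \<open>
  Elementary maps: a stretch scales the volume by the product of its factors, a transposition of
  coordinates permutes the sides of a box, and a shear of a box is, after a translation, a shear
  of a box in the half space where volume preservation is known.
\<close>

lemma volume_linear_image:
  fixes f :: "real ^ 'n \<Rightarrow> real ^ ('n :: finite)"
  assumes "linear f" "S \<in> lmeasurable"
  shows "f ` S \<in> lmeasurable \<and> measure lebesgue (f ` S) = \<bar>det (matrix f)\<bar> * measure lebesgue S"
proof -
  define P where "P f \<longleftrightarrow> (\<forall>S\<in>lmeasurable. f ` S \<in> lmeasurable \<and>
    measure lebesgue (f ` S) = \<bar>det (matrix f)\<bar> * measure lebesgue S)" for f :: "real ^ 'n \<Rightarrow> real ^ 'n"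
  have boxes: "P h" if "linear h" "\<bar>det (matrix h)\<bar> = 1"
    "\<And>a b. cbox a b \<noteq> {} \<Longrightarrow> measure lebesgue (h ` cbox a b) = measure lebesgue (cbox a b)" for h
  proof -
    have "measure lebesgue (h ` cbox a b) = 1 * measure lebesgue (cbox a b)" for a b
      using that(3)[of a b] by (cases "cbox a b = {}") auto
    note * = measure_linear_sufficient[OF that(1) _ this]
    show ?thesis unfolding P_def
    proof
      fix S :: "(real ^ 'n) set" assume "S \<in> lmeasurable"
      from *[OF this] show "h ` S \<in> lmeasurable \<and> measure lebesgue (h ` S) = \<bar>det (matrix h)\<bar> * measure lebesgue S"
        using that(2) by simp
    qed
  qed
  have "P f"
  proof (rule induct_linear_elementary[OF assms(1)])
    fix f g :: "real ^ 'n \<Rightarrow> real ^ 'n" assume "linear f" "linear g" "P f" "P g"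
    moreover have "(f \<circ> g) ` S = f ` g ` S" for S by (rule image_comp[symmetric])
    ultimately show "P (f \<circ> g)" unfolding P_def by (simp only: matrix_compose det_mul abs_mult) simp
  next
    fix f :: "real ^ 'n \<Rightarrow> real ^ 'n" and i assume f: "linear f" "\<And>x. f x $ i = 0"
    have "\<not> surj f"
    proof
      assume "surj f"
      then obtain x where "f x = (\<chi> j. 1)" by (metis surjD)
      then show False using f(2)[of x] by simp
    qed
    then have "\<not> inj f" using linear_injective_imp_surjective[OF f(1)] by blast
    then have "det (matrix f) = 0" "negligible (f ` S)" for S
      using det_nz_iff_inj[OF f(1)] negligible_linear_singular_image[OF f(1)] by blast+
    then show "P f"
      by (simp add: P_def negligible_iff_measure)
  next
    fix c :: "'n \<Rightarrow> real"
    have "det (matrix (\<lambda>x :: real ^ 'n. \<chi> i. c i * x $ i)) = prod c UNIV"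
      by (subst det_diagonal) (auto simp: matrix_def axis_def)
    then show "P (\<lambda>x. \<chi> i. c i * x $ i)"
      by (simp add: P_def measurable_stretch measure_stretch)
  next
    fix m n :: 'n assume "m \<noteq> n"
    let ?t = "Transposition.transpose m n" and ?h = "\<lambda>x :: real ^ 'n. \<chi> i. x $ Transposition.transpose m n i"
    have perm: "?t permutes UNIV" by (rule permutes_swap_id) auto
    have "matrix ?h = (\<chi> i. (mat 1 :: real ^ 'n ^ 'n) $ ?t i)"
      by (auto simp: matrix_def mat_def axis_def vec_eq_iff)
    then have "\<bar>det (matrix ?h)\<bar> = 1"
      using det_permute_rows[OF perm, of "mat 1 :: real ^ 'n ^ 'n"] by (simp add: sign_def)
    moreover have "measure lebesgue (?h ` cbox a b) = measure lebesgue (cbox a b)" if ne: "cbox a b \<noteq> {}" for a b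
    proof -
      have "?h ` cbox a b = cbox (?h a) (?h b)"
      proof
        show "cbox (?h a) (?h b) \<subseteq> ?h ` cbox a b"
        proof
          fix x assume x: "x \<in> cbox (?h a) (?h b)"
          have "a $ i \<le> ?h x $ i \<and> ?h x $ i \<le> b $ i" for i
            using x[unfolded mem_box_cart, rule_format, of "?t i"] by simp
          then have "?h x \<in> cbox a b" by (simp add: mem_box_cart)
          moreover have "x = ?h (?h x)" by (simp add: vec_eq_iff)
          ultimately show "x \<in> ?h ` cbox a b" by blast
        qed
      qed (auto simp: mem_box_cart)
      moreover from this have "cbox (?h a) (?h b) \<noteq> {}" using ne by blast
      ultimately show ?thesis
        using ne prod.permute[OF perm, of "\<lambda>i. b $ i - a $ i"] by (simp add: content_cbox_cart o_def)
    qed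
    ultimately show "P ?h" by (intro boxes) (auto intro!: linearI simp: vec_eq_iff)
  next
    fix m n :: 'n assume mn: "m \<noteq> n"
    let ?h = "\<lambda>x :: real ^ 'n. \<chi> i. if i = m then x $ m + x $ n else x $ i"
    have lin: "linear ?h" by (auto intro!: linearI simp: vec_eq_iff algebra_simps)
    have "matrix ?h = (\<chi> k. if k = m then row m (mat 1) + 1 *s row n (mat 1) else row k (mat 1))"
      by (auto simp: matrix_def mat_def axis_def row_def vec_eq_iff)
    then have "det (matrix ?h) = 1" using det_row_operation[OF mn, where A="mat 1" and c="1::real"] by simp
    moreover have "measure lebesgue (?h ` cbox a b) = measure lebesgue (cbox a b)" if ne: "cbox a b \<noteq> {}" for a b
    proof -
      define t where "t = (\<chi> i. if i = n then - a $ n else 0)"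
      have shift: "(+) t ` cbox a b = cbox (t + a) (t + b)" by (rule cbox_translation[symmetric])
      have "?h ` (+) t ` cbox a b = (+) (?h t) ` ?h ` cbox a b"
        by (auto simp: image_image linear_add[OF lin])
      then have "measure lebesgue (?h ` cbox a b) = measure lebesgue (?h ` cbox (t + a) (t + b))"
        by (simp add: measure_translation flip: shift)
      also have "\<dots> = measure lebesgue (cbox (t + a) (t + b))"
        using mn ne shift by (intro measure_shear_interval) (auto simp: t_def)
      also have "\<dots> = measure lebesgue (cbox a b)" using measure_translation[of t "cbox a b"] shift by simp
      finally show ?thesis .
    qed
    ultimately show "P ?h" by (intro boxes lin) auto
  qed
  then show ?thesis using assms(2) by (simp add: P_def)
qed

definition unit_cell :: "(real ^ 'd) set" where
  "unit_cell = {x. \<forall>i. 0 \<le> x $ i \<and> x $ i < 1}"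

lemma unit_cell_decomposition: obtains p n where "p \<in> unit_cell" "x = p + vint n"
  by (rule that[of "\<chi> i. frac (x $ i)" "\<chi> i. \<lfloor>x $ i\<rfloor>"])
    (auto simp: unit_cell_def vint_def vec_eq_iff frac_def frac_lt_1[unfolded frac_def])

lemma unit_cell_unique:
  assumes "p \<in> unit_cell" "q \<in> unit_cell" "p + vint m = q + vint n"
  shows "p = q \<and> m = n"
proof -
  have "p $ i = q $ i \<and> m $ i = n $ i" for i
  proof -
    have "p $ i + of_int (m $ i) = q $ i + of_int (n $ i)"
      using assms(3) by (simp add: vec_eq_iff vint_def)
    moreover have "0 \<le> p $ i" "p $ i < 1" "0 \<le> q $ i" "q $ i < 1" using assms by (auto simp: unit_cell_def)
    ultimately have "m $ i = n $ i" by linarith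
    then show ?thesis using \<open>p $ i + of_int (m $ i) = q $ i + of_int (n $ i)\<close> by simp
  qed
  then show ?thesis by (simp add: vec_eq_iff)
qed

lemma torus_exp_surj: obtains x where "x \<in> unit_cell" "z = torus_exp x"
proof -
  define y where "y = (\<chi> i. Arg (coords z $ i) / (2 * pi))"
  have "cis (Arg (coords z $ i)) = coords z $ i" for i
    by (simp add: cis_Arg sgn_eq)
  then have z: "z = torus_exp y" by (intro torus_eqI) (simp add: coords_torus_exp y_def)
  obtain p n where "p \<in> unit_cell" "y = p + vint n" by (rule unit_cell_decomposition)
  then show ?thesis using that z torus_exp_eq_iff by blast
qed

lemma unit_cell_measure: "(unit_cell :: (real ^ 'd) set) \<in> lmeasurable" "measure lebesgue (unit_cell :: (real ^ 'd) set) = 1"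
proof -
  let ?P = "unit_cell :: (real ^ 'd) set"
  have sub: "box 0 (\<chi> i. 1) \<subseteq> ?P" "?P \<subseteq> cbox 0 (\<chi> i. 1)"
    by (auto simp: unit_cell_def mem_box_cart less_imp_le)
  have "convex ?P" unfolding convex_def unit_cell_def
    by (auto intro!: convex_bound_lt)
  moreover have "bounded ?P" using bounded_subset[OF bounded_cbox sub(2)] .
  ultimately show m: "?P \<in> lmeasurable" by (rule measurable_convex)
  have one: "measure lebesgue (cbox 0 (\<chi> i. 1) :: (real ^ 'd) set) = 1"
    by (simp add: content_cbox_if_cart interval_eq_empty_cart)
  have "measure lebesgue (box 0 (\<chi> i. 1) :: (real ^ 'd) set) = measure lebesgue (cbox 0 (\<chi> i. 1) :: (real ^ 'd) set)"
    by (simp add: measure_lborel_box_eq measure_lborel_cbox_eq)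
  moreover have "measure lebesgue (box 0 (\<chi> i. 1) :: (real ^ 'd) set) \<le> measure lebesgue ?P"
    by (intro measure_mono_fmeasurable sub m) auto
  moreover have "measure lebesgue ?P \<le> measure lebesgue (cbox 0 (\<chi> i. 1) :: (real ^ 'd) set)"
    using m by (intro measure_mono_fmeasurable sub) auto
  ultimately show "measure lebesgue ?P = 1" using one by simp
qed

lemma finite_int_box: "finite {n :: int ^ 'd. \<forall>i. \<bar>n $ i\<bar> \<le> M}"
proof -
  have "{n :: int ^ 'd. \<forall>i. \<bar>n $ i\<bar> \<le> M} \<subseteq> vec_lambda ` (PiE UNIV (\<lambda>_. {-M..M}))"
  proof
    fix n :: "int ^ 'd" assume "n \<in> {n. \<forall>i. \<bar>n $ i\<bar> \<le> M}"
    then have "vec_nth n \<in> PiE UNIV (\<lambda>_. {-M..M})" by (auto simp: abs_le_iff minus_le_iff)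
    then show "n \<in> vec_lambda ` (PiE UNIV (\<lambda>_. {-M..M}))" by (metis image_eqI vec_nth_inverse)
  qed
  then show ?thesis by (rule finite_subset) (simp add: finite_PiE)
qed

definition torus_mult :: "'d torus \<Rightarrow> 'd torus \<Rightarrow> ('d :: finite) torus" where
  "torus_mult z w = Torus (\<chi> i. coords z $ i * coords w $ i)"

definition torus_inv :: "'d torus \<Rightarrow> ('d :: finite) torus" where
  "torus_inv z = Torus (\<chi> i. cnj (coords z $ i))"

lemma coords_torus_mult: "coords (torus_mult z w) $ i = coords z $ i * coords w $ i"
  unfolding torus_mult_def by (subst coords_Torus) (auto simp: norm_mult)

lemma coords_torus_inv: "coords (torus_inv z) $ i = cnj (coords z $ i)"
  unfolding torus_inv_def by (subst coords_Torus) auto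

lemma torus_mult_inv: "torus_mult (torus_mult z (torus_inv w)) w = z"
  and torus_inv_mult: "torus_mult (torus_mult z w) (torus_inv w) = z"
  by (rule torus_eqI; simp add: coords_torus_mult coords_torus_inv mult.assoc cnj_coords)+

lemma character_torus_mult: "character m (torus_mult z w) = character m z * character m w"
  by (simp add: character_def coords_torus_mult power_int_mult_distrib prod.distrib)

lemma character_torus_inv: "character m (torus_inv z) = cnj (character m z)"
  by (simp add: character_def coords_torus_inv)

lemma torus_map_mult: "torus_map A (torus_mult z w) = torus_mult (torus_map A z) (torus_map A w)"
  by (rule torus_eqI) (simp add: coords_torus_map coords_torus_mult character_torus_mult)

lemma torus_map_inv: "torus_map A (torus_inv z) = torus_inv (torus_map A z)"
  by (rule torus_eqI) (simp add: coords_torus_map coords_torus_inv character_torus_inv)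

definition fibre :: "int ^ 'd ^ 'd \<Rightarrow> 'd torus \<Rightarrow> ('d :: finite) torus set" where
  "fibre A z = {w. torus_map A w = z}"

text \<open>
  Any two fibres are translates of each other, as \<open>\<sigma>\<^sub>A\<close> is a group homomorphism.
\<close>

lemma bij_betw_fibre:
  assumes "torus_map A w = z"
  shows "bij_betw (\<lambda>k. torus_mult k w) (fibre A (torus_mult z' (torus_inv z))) (fibre A z')"
  by (rule bij_betw_byWitness[where f'="\<lambda>k. torus_mult k (torus_inv w)"])
    (auto simp: fibre_def torus_mult_inv torus_inv_mult torus_map_mult torus_map_inv assms)

definition real_matrix :: "int ^ 'd ^ 'd \<Rightarrow> real ^ 'd ^ 'd" where
  "real_matrix A = (\<chi> i j. of_int (A $ i $ j))"

lemma det_real_matrix: "det (real_matrix A) = of_int (det A)"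
  by (simp add: det_def real_matrix_def)

lemma torus_map_exp: "torus_map A (torus_exp x) = torus_exp (real_matrix A *v x)"
  by (simp add: torus_map_torus_exp real_matrix_def)

locale nonsingular =
  fixes A :: "int ^ 'd ^ ('d :: finite)" and N :: nat
  assumes N: "N = nat \<bar>det A\<bar>" and N_nonzero: "N \<noteq> 0"
begin

lemma real_N: "real N = \<bar>of_int (det A)\<bar>"
  by (simp add: N)

lemma det_nonzero: "det A \<noteq> 0"
  using N N_nonzero by auto

lemma real_inverse: "\<exists>M. (\<forall>x. M *v (real_matrix A *v x) = x) \<and> (\<forall>x. real_matrix A *v (M *v x) = x)"
proof -
  have "invertible (real_matrix A)" using det_nonzero by (simp add: invertible_det_nz det_real_matrix)
  then obtain M where "real_matrix A ** M = mat 1" "M ** real_matrix A = mat 1"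
    unfolding invertible_def by blast
  then have "M *v (real_matrix A *v x) = x" "real_matrix A *v (M *v x) = x" for x
    by (simp_all add: matrix_vector_mul_assoc)
  then show ?thesis by blast
qed

lemma torus_map_surj: obtains w where "torus_map A w = z"
proof -
  obtain M where "\<And>x. M *v (real_matrix A *v x) = x" "\<And>x. real_matrix A *v (M *v x) = x"
    using real_inverse by blast
  moreover obtain x where "z = torus_exp x" by (rule torus_exp_surj) blast
  ultimately show ?thesis using that[of "torus_exp (M *v x)"] by (simp add: torus_map_exp)
qed

lemma card_fibre_const: "card (fibre A z) = card (fibre A z')" "finite (fibre A z) \<longleftrightarrow> finite (fibre A z')"
proof -
  obtain w where "torus_map A w = torus_mult z (torus_inv z')" by (rule torus_map_surj)
  moreover have "torus_mult z (torus_inv (torus_mult z (torus_inv z'))) = z'"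
    by (rule torus_eqI) (simp add: coords_torus_mult coords_torus_inv mult.assoc[symmetric] cnj_coords)
  ultimately have "bij_betw (\<lambda>k. torus_mult k w) (fibre A z') (fibre A z)"
    using bij_betw_fibre[of A w "torus_mult z (torus_inv z')" z] by simp
  then show "card (fibre A z) = card (fibre A z')" "finite (fibre A z) \<longleftrightarrow> finite (fibre A z')"
    by (auto simp: bij_betw_same_card bij_betw_finite)
qed

text \<open>
  The image of the unit cell under \<open>A\<close> has volume \<open>\<bar>det A\<bar>\<close>; reduced modulo \<open>\<int>\<^sup>d\<close> it covers every point
  of the unit cell as often as the fibre above that point has elements.
\<close>

lemma fibre_finite: "finite (fibre A z)" and card_fibre: "card (fibre A z) = N"
proof -
  let ?R = "real_matrix A"
  let ?P = "unit_cell :: (real ^ 'd) set"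
  define E where "E = (*v) ?R ` ?P"
  define En where "En n = {y \<in> ?P. y + vint n \<in> E}" for n
  obtain M where M: "\<And>x. M *v (?R *v x) = x" "\<And>x. ?R *v (M *v x) = x" using real_inverse by blast
  have E_meas: "E \<in> lmeasurable" and "measure lebesgue E = \<bar>det (matrix ((*v) ?R))\<bar> * measure lebesgue ?P"
    unfolding E_def using volume_linear_image[OF matrix_vector_mul_linear unit_cell_measure(1), of ?R] by simp_all
  then have E_vol: "measure lebesgue E = N"
    by (simp add: unit_cell_measure(2) det_real_matrix real_N)
  have "bounded E" unfolding E_def
    using bounded_linear_image[of ?P "(*v) ?R"] bounded_subset[OF bounded_cbox, of ?P 0 "\<chi> i. 1"]
    by (force simp: unit_cell_def mem_box_cart less_imp_le matrix_vector_mul_bounded_linear)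
  then obtain b where b: "\<And>x. x \<in> E \<Longrightarrow> norm x \<le> b" unfolding bounded_iff by blast
  define F where "F = {n :: int ^ 'd. \<forall>i. \<bar>n $ i\<bar> \<le> \<lceil>b\<rceil> + 1}"
  have F: "finite F" unfolding F_def by (rule finite_int_box)
  have inF: "n \<in> F" if "y \<in> En n" for y n
  proof -
    have "real_of_int \<bar>n $ i\<bar> \<le> real_of_int (\<lceil>b\<rceil> + 1)" for i
    proof -
      have "\<bar>y $ i + of_int (n $ i)\<bar> \<le> b"
        using that b[of "y + vint n"] component_le_norm_cart[of "y + vint n" i] by (simp add: En_def vint_def)
      moreover have "0 \<le> y $ i" "y $ i < 1" using that by (simp_all add: En_def unit_cell_def)
      moreover have "b \<le> of_int \<lceil>b\<rceil>" by simp
      ultimately show ?thesis unfolding of_int_abs of_int_add of_int_1 by linarith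
    qed
    then have "\<bar>n $ i\<bar> \<le> \<lceil>b\<rceil> + 1" for i by (simp only: of_int_le_iff)
    then show ?thesis by (simp add: F_def)
  qed
  \<comment> \<open>The fibre above \<open>exp (2 \<pi> i y)\<close> consists of the points \<open>A\<^sup>-\<^sup>1 (y + n)\<close> that lie in the unit cell.\<close>
  have fib: "bij_betw (\<lambda>n. torus_exp (M *v (y + vint n))) {n. y \<in> En n} (fibre A (torus_exp y))"
    if y: "y \<in> ?P" for y
    unfolding bij_betw_def
  proof
    have Mc: "M *v (y + vint n) \<in> ?P" if "y \<in> En n" for n
      using that M(1) by (auto simp: En_def E_def)
    show "inj_on (\<lambda>n. torus_exp (M *v (y + vint n))) {n. y \<in> En n}"
    proof (rule inj_onI, clarify)
      fix m n assume mn: "y \<in> En m" "y \<in> En n"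
        "torus_exp (M *v (y + vint m)) = torus_exp (M *v (y + vint n))"
      then obtain k where "M *v (y + vint m) = M *v (y + vint n) + vint k" by (auto simp: torus_exp_eq_iff)
      moreover have "vint 0 = (0 :: real ^ 'd)" by (simp add: vint_def vec_eq_iff)
      ultimately have "M *v (y + vint m) = M *v (y + vint n)"
        using unit_cell_unique[OF Mc[OF mn(1)] Mc[OF mn(2)], of 0 k] by simp
      then have "y + vint m = y + vint n" by (metis M(2))
      then show "m = n" by (simp add: vint_def vec_eq_iff)
    qed
    have "w \<in> (\<lambda>n. torus_exp (M *v (y + vint n))) ` {n. y \<in> En n}" if w: "w \<in> fibre A (torus_exp y)" for w
    proof -
      obtain x where x: "x \<in> ?P" "w = torus_exp x" by (rule torus_exp_surj)
      then have "torus_exp (?R *v x) = torus_exp y" using w by (simp add: fibre_def torus_map_exp)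
      then obtain n where n: "?R *v x = y + vint n" by (auto simp: torus_exp_eq_iff)
      then have "y + vint n \<in> E" unfolding E_def using x(1) by (metis image_eqI)
      then have "y \<in> En n" "w = torus_exp (M *v (y + vint n))"
        using x y n[symmetric] by (auto simp: En_def M)
      then show ?thesis by blast
    qed
    moreover have "torus_exp (M *v (y + vint n)) \<in> fibre A (torus_exp y)" for n
      by (auto simp: fibre_def torus_map_exp M torus_exp_eq_iff)
    ultimately show "(\<lambda>n. torus_exp (M *v (y + vint n))) ` {n. y \<in> En n} = fibre A (torus_exp y)" by blast
  qed
  have fin: "finite {n. y \<in> En n}" for y using inF by (intro finite_subset[OF _ F]) blast
  obtain x0 where x0: "x0 \<in> ?P" "z = torus_exp x0" by (rule torus_exp_surj)
  show finz: "finite (fibre A z)"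
    unfolding x0(2) using bij_betw_finite[OF fib[OF x0(1)]] fin[of x0] by simp
  have count: "card {n \<in> F. y \<in> En n} = card (fibre A z)" if y: "y \<in> ?P" for y
  proof -
    have "{n \<in> F. y \<in> En n} = {n. y \<in> En n}" using inF by blast
    then show ?thesis using bij_betw_same_card[OF fib[OF y]] card_fibre_const(1)[of "torus_exp y" z] by simp
  qed
  have En_meas: "En n \<in> lmeasurable" for n
  proof -
    have "y \<in> (\<lambda>x. x - vint n) ` E \<longleftrightarrow> y + vint n \<in> E" for y
      by (auto intro: image_eqI[of _ _ "y + vint n"])
    then have "En n = ?P \<inter> (\<lambda>x. x - vint n) ` E" by (auto simp: En_def)
    then show ?thesis
      using fmeasurable_Int_fmeasurable[OF unit_cell_measure(1) fmeasurableD[OF measurable_translation_subtract[OF E_meas]]]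
      by simp
  qed
  have union: "E = (\<Union>n\<in>F. (+) (vint n) ` En n)"
  proof
    show "E \<subseteq> (\<Union>n\<in>F. (+) (vint n) ` En n)"
    proof
      fix x assume x: "x \<in> E"
      obtain p n where p: "p \<in> ?P" "x = p + vint n" by (rule unit_cell_decomposition)
      then have "p \<in> En n" using x by (simp add: En_def)
      then show "x \<in> (\<Union>n\<in>F. (+) (vint n) ` En n)"
        using inF[of p n] p(2) by (auto simp: add.commute intro!: bexI[of _ n] image_eqI[of _ _ p])
    qed
  qed (auto simp: En_def add.commute)
  have disj: "disjoint_family_on (\<lambda>n. (+) (vint n) ` En n) F"
    unfolding disjoint_family_on_def
  proof (intro ballI impI equals0I)
    fix m n x assume "m \<noteq> n" "x \<in> (+) (vint m) ` En m \<inter> (+) (vint n) ` En n"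
    then obtain p q where "p \<in> ?P" "q \<in> ?P" "x = p + vint m" "x = q + vint n"
      by (auto simp: En_def add.commute)
    then show False using unit_cell_unique[of p q m n] \<open>m \<noteq> n\<close> by simp
  qed
  have sub: "(\<lambda>n. (+) (vint n) ` En n) ` F \<subseteq> sets lebesgue"
    using fmeasurableD[OF measurable_translation[OF En_meas]] by blast
  have fin_meas: "emeasure lebesgue ((+) (vint n) ` En n) \<noteq> \<infinity>" for n
    using fmeasurableD2[OF measurable_translation[OF En_meas]] unfolding infinity_ennreal_def .
  have "measure lebesgue E = (\<Sum>n\<in>F. measure lebesgue ((+) (vint n) ` En n))"
    unfolding union by (rule measure_finite_Union[OF F sub disj fin_meas])
  also have "\<dots> = (\<Sum>n\<in>F. measure lebesgue (En n))" by (simp add: measure_translation)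
  also have "\<dots> = (\<Sum>n\<in>F. integral\<^sup>L lebesgue (indicator (En n)))"
    using En_meas by simp
  also have "\<dots> = integral\<^sup>L lebesgue (\<lambda>y. \<Sum>n\<in>F. indicator (En n) y)"
    using En_meas by (intro Bochner_Integration.integral_sum[symmetric]) (simp add: lmeasurable_iff_integrable)
  also have "(\<lambda>y. \<Sum>n\<in>F. indicator (En n) y) = (\<lambda>y. real (card (fibre A z)) * indicator ?P y)"
  proof
    fix y show "(\<Sum>n\<in>F. indicator (En n) y) = real (card (fibre A z)) * indicator ?P y"
    proof (cases "y \<in> ?P")
      case True
      then show ?thesis using count[OF True] F by (simp add: indicator_def sum.If_cases Int_def)
    qed (simp add: En_def indicator_def)
  qed
  also have "integral\<^sup>L lebesgue \<dots> = real (card (fibre A z))"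
    by (simp add: unit_cell_measure(2))
  finally show "card (fibre A z) = N" using E_vol by simp
qed

end

text \<open>The matrix \<open>B\<close> enters as \<^term>\<open>transpose A\<close>; the simplifier is to leave its applications in this form.\<close>

declare transpose_matrix_vector [simp del]

section \<open>Characters of the torus and the transfer operator\<close>

definition torus_one :: "('d :: finite) torus" where
  "torus_one = Torus (\<chi> i. 1)"

lemma coords_torus_one [simp]: "coords torus_one $ i = 1"
  unfolding torus_one_def by (subst coords_Torus) auto

lemma torus_mult_inv_one [simp]: "torus_mult z (torus_inv torus_one) = z"
  by (rule torus_eqI) (simp add: coords_torus_mult coords_torus_inv)

lemma inner_vint: "vint m \<bullet> x = (\<Sum>i\<in>UNIV. of_int (m $ i) * x $ i)"
  by (simp add: inner_vec_def vint_def)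

lemma inner_vint_real_matrix: "vint m \<bullet> (real_matrix A *v x) = vint (transpose A *v m) \<bullet> x"
proof -
  have "vint m \<bullet> (real_matrix A *v x) = (\<Sum>i\<in>UNIV. \<Sum>j\<in>UNIV. of_int (m $ i) * (of_int (A $ i $ j) * x $ j))"
    by (simp add: inner_vint matrix_vector_mult_def real_matrix_def sum_distrib_left)
  also have "\<dots> = (\<Sum>j\<in>UNIV. \<Sum>i\<in>UNIV. of_int (m $ i) * (of_int (A $ i $ j) * x $ j))"
    by (rule sum.swap)
  also have "\<dots> = vint (transpose A *v m) \<bullet> x"
    by (auto simp: inner_vint matrix_vector_mult_def transpose_def sum_distrib_right intro!: sum.cong)
  finally show ?thesis .
qed

lemma cis_2pi_eq_1: "cis (2 * pi * r) = 1 \<longleftrightarrow> r \<in> \<int>"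
proof
  assume "cis (2 * pi * r) = 1"
  then have "sin (2 * pi * r) = sin 0 \<and> cos (2 * pi * r) = cos 0" by (simp add: complex_eq_iff)
  then obtain n :: int where "2 * pi * r = 0 + 2 * pi * of_int n" unfolding sin_cos_eq_iff by (auto simp: mult_ac)
  then show "r \<in> \<int>" by simp
qed (auto elim!: Ints_cases simp: cis_multiple_2pi)

context nonsingular
begin

abbreviation "B n \<equiv> transpose A *v n"

lemma B_inj: assumes "B m = B n" shows "m = n"
proof -
  obtain M where M: "\<And>x. real_matrix A *v (M *v x) = x" using real_inverse by blast
  have "vint m \<bullet> x = vint n \<bullet> x" for x
    using inner_vint_real_matrix[of m A "M *v x"] inner_vint_real_matrix[of n A "M *v x"] assms by (simp add: M)
  from this[of "axis i 1" for i] show ?thesis by (simp add: inner_axis vint_def vec_eq_iff)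
qed

lemma B_inj_iff: "B m = B n \<longleftrightarrow> m = n"
  using B_inj by blast

text \<open>
  Lagrange's theorem for the kernel of \<open>\<sigma>\<^sub>A\<close>: multiplication by \<open>k\<close> permutes the kernel, hence does not
  change the product of the \<open>i\<close>-th coordinates over it.
\<close>

lemma kernel_power:
  assumes "k \<in> fibre A torus_one"
  shows "coords k $ i ^ N = 1"
proof -
  have "bij_betw (\<lambda>w. torus_mult w k) (fibre A torus_one) (fibre A torus_one)"
    using bij_betw_fibre[of A k torus_one torus_one] assms by (simp add: fibre_def)
  then have "(\<Prod>w\<in>fibre A torus_one. coords w $ i) = (\<Prod>w\<in>fibre A torus_one. coords (torus_mult w k) $ i)"
    by (rule prod.reindex_bij_betw[symmetric])
  also have "\<dots> = (\<Prod>w\<in>fibre A torus_one. coords w $ i) * coords k $ i ^ N"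
    by (simp add: coords_torus_mult prod.distrib card_fibre)
  finally show ?thesis using fibre_finite by simp
qed

text \<open>
  Duality between the kernel and \<open>\<int>\<^sup>d / B \<int>\<^sup>d\<close>: the kernel contains the points with coordinates given by
  the columns of \<open>A\<^sup>-\<^sup>1\<close>, and triviality there says that \<open>B\<^sup>-\<^sup>1 m\<close> is an integer vector.
\<close>

lemma character_kernel_trivial:
  assumes "\<And>k. k \<in> fibre A torus_one \<Longrightarrow> character m k = 1"
  obtains n where "m = B n"
proof -
  obtain M where M: "\<And>x. M *v (real_matrix A *v x) = x" "\<And>x. real_matrix A *v (M *v x) = x"
    using real_inverse by blast
  have "(\<Sum>i\<in>UNIV. of_int (m $ i) * M $ i $ j) \<in> \<int>" for j
  proof -
    have "torus_map A (torus_exp (M *v axis j 1)) = torus_exp (axis j 1)" by (simp add: torus_map_exp M)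
    also have "\<dots> = torus_one"
      by (rule torus_eqI) (simp add: coords_torus_exp axis_def cis_multiple_2pi[of 1, simplified])
    finally have "cis (2 * pi * (\<Sum>i\<in>UNIV. of_int (m $ i) * (M *v axis j 1) $ i)) = 1"
      using assms by (simp add: fibre_def flip: character_torus_exp)
    then show ?thesis by (simp add: cis_2pi_eq_1 matrix_vector_mult_def axis_def if_distrib[of "(*) _"] cong: if_cong)
  qed
  then have "\<forall>j. \<exists>n::int. (\<Sum>i\<in>UNIV. of_int (m $ i) * M $ i $ j) = of_int n" by (auto elim!: Ints_cases)
  then obtain n where n: "\<And>j. (\<Sum>i\<in>UNIV. of_int (m $ i) * M $ i $ j) = real_of_int (n j)" by metis
  let ?n = "\<chi> j. n j"
  have "vint (B ?n) \<bullet> x = vint m \<bullet> x" for x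
  proof -
    let ?y = "real_matrix A *v x"
    have "vint (B ?n) \<bullet> x = (\<Sum>j\<in>UNIV. (\<Sum>i\<in>UNIV. of_int (m $ i) * M $ i $ j) * ?y $ j)"
      unfolding inner_vint_real_matrix[symmetric] by (simp add: inner_vint n)
    also have "\<dots> = (\<Sum>i\<in>UNIV. \<Sum>j\<in>UNIV. of_int (m $ i) * M $ i $ j * ?y $ j)"
      unfolding sum_distrib_right by (rule sum.swap)
    also have "\<dots> = vint m \<bullet> (M *v ?y)"
      by (simp add: inner_vint matrix_vector_mult_def[of M] sum_distrib_left mult.assoc)
    finally show ?thesis by (simp add: M)
  qed
  from this[of "axis i 1" for i] have "B ?n = m" by (simp add: inner_axis vint_def vec_eq_iff)
  then show ?thesis using that by metis
qed

text \<open>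
  A character that is nontrivial on the kernel sums to zero over each coset of the kernel.
\<close>

lemma sum_fibre_character:
  "(\<Sum>w\<in>fibre A z. character m w) = (if \<exists>n. m = B n then N * character (THE n. m = B n) z else 0)"
proof (cases "\<exists>n. m = B n")
  case True
  then obtain n where n: "m = B n" ..
  then have "(THE n. m = B n) = n" using B_inj by blast
  moreover have "character m w = character n z" if "w \<in> fibre A z" for w
    using that character_torus_map[of n A w] by (simp add: fibre_def n)
  ultimately show ?thesis using True by (simp add: card_fibre)
next
  case False
  then obtain k where k: "k \<in> fibre A torus_one" "character m k \<noteq> 1"
    using character_kernel_trivial by blast
  have "bij_betw (\<lambda>w. torus_mult w k) (fibre A z) (fibre A z)"
    using bij_betw_fibre[of A k torus_one z] k by (simp add: fibre_def)
  then have "(\<Sum>w\<in>fibre A z. character m w) = (\<Sum>w\<in>fibre A z. character m (torus_mult w k))"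
    by (rule sum.reindex_bij_betw[symmetric])
  also have "\<dots> = character m k * (\<Sum>w\<in>fibre A z. character m w)"
    by (simp add: character_torus_mult sum_distrib_left mult.commute)
  finally have "(1 - character m k) * (\<Sum>w\<in>fibre A z. character m w) = 0"
    by (simp add: algebra_simps)
  then show ?thesis using k False by simp
qed

lemma transfer_fibre: "transfer A f z = (\<Sum>w\<in>fibre A z. f w) / N"
  by (simp add: transfer_def fibre_def N)

lemma transfer_B: "transfer A (character (B n)) = character n"
  using N_nonzero B_inj by (auto simp: transfer_fibre sum_fibre_character fun_eq_iff intro!: arg_cong[of _ _ "\<lambda>m. character m _"])

lemma transfer_not_B: "\<nexists>n. m = B n \<Longrightarrow> transfer A (character m) = (\<lambda>z. 0)"
  by (auto simp: transfer_fibre sum_fibre_character fun_eq_iff)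

lemma transfer_one: "transfer A (\<lambda>z. 1) = (\<lambda>z. 1)"
  using N_nonzero by (simp add: transfer_fibre card_fibre fun_eq_iff)

text \<open>
  The box \<open>{0..<N}\<^sup>d\<close> meets every coset of \<open>B\<int>\<^sup>d\<close> in the same number of points, so it serves as a
  multiple of a set of coset representatives.  Its character sums split into geometric sums.
\<close>

definition frame_box :: "(int ^ 'd) set" where
  "frame_box = (\<lambda>g. \<chi> i. int (g i)) ` PiE UNIV (\<lambda>_. {..<N})"

lemma frame_box_inj: "inj_on (\<lambda>g. \<chi> i. int (g i)) (PiE (UNIV :: 'd set) (\<lambda>_. {..<N}))"
  by (rule inj_onI) (auto simp: vec_eq_iff)

lemma finite_frame_box: "finite frame_box"
  unfolding frame_box_def by (intro finite_imageI finite_PiE) auto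

lemma card_frame_box: "card frame_box = N ^ CARD('d)"
  unfolding frame_box_def card_image[OF frame_box_inj] by (simp add: card_PiE)

text \<open>
  The quotient \<open>k\<close> of the two points lies in the kernel, so its coordinates are \<open>N\<close>-th roots of unity
  and each factor of the character sum is a full geometric sum.
\<close>

lemma frame_sum:
  assumes "torus_map A w = torus_map A w'"
  shows "(\<Sum>s\<in>frame_box. character s w * cnj (character s w')) = (if w = w' then N ^ CARD('d) else 0)"
proof -
  define k where "k = torus_mult w (torus_inv w')"
  have "torus_map A k = torus_one"
    by (rule torus_eqI) (simp add: k_def torus_map_mult torus_map_inv coords_torus_mult coords_torus_inv assms cnj_coords)
  then have k: "coords k $ i ^ N = 1" for i by (intro kernel_power) (simp add: fibre_def)
  have "(\<Sum>s\<in>frame_box. character s w * cnj (character s w')) = (\<Sum>s\<in>frame_box. character s k)"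
    by (simp add: k_def character_torus_mult character_torus_inv)
  also have "\<dots> = (\<Sum>g\<in>PiE UNIV (\<lambda>_. {..<N}). \<Prod>i\<in>UNIV. coords k $ i ^ g i)"
    unfolding frame_box_def sum.reindex[OF frame_box_inj] by (simp add: character_def)
  also have "\<dots> = (\<Prod>i\<in>UNIV. \<Sum>j<N. coords k $ i ^ j)"
    by (rule prod_sum_PiE[symmetric]) auto
  also have "\<dots> = (if w = w' then N ^ CARD('d) else 0)"
  proof (cases "w = w'")
    case True
    then have "coords k $ i = 1" for i by (simp add: k_def coords_torus_mult coords_torus_inv cnj_coords)
    then show ?thesis using True by simp
  next
    case False
    then obtain i where i: "coords w $ i \<noteq> coords w' $ i" using torus_eqI by blast
    have "coords k $ i \<noteq> 1"
    proof
      assume "coords k $ i = 1"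
      then have "coords w $ i * cnj (coords w' $ i) * coords w' $ i = coords w' $ i"
        by (simp add: k_def coords_torus_mult coords_torus_inv)
      then show False using i by (simp add: mult.assoc cnj_coords)
    qed
    then have "(\<Sum>j<N. coords k $ i ^ j) = 0" using k[of i] by (simp add: geometric_sum)
    then show ?thesis using False by (simp add: prod_zero_iff) blast
  qed
  finally show ?thesis .
qed

end

subsection \<open>Trigonometric polynomials\<close>

lemma continuous_coords: "continuous_on UNIV (\<lambda>z. coords z $ i)"
proof -
  have "continuous_on UNIV (coords :: 'a torus \<Rightarrow> _)"
    unfolding continuous_on_iff by (auto simp: dist_torus_def)
  then show ?thesis by (intro continuous_intros)
qed

lemma continuous_character: "continuous_on UNIV (character m)"
  unfolding character_def[abs_def]
  by (intro continuous_intros continuous_coords ballI) simp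

lemma continuous_into_torus:
  fixes f :: "'b :: metric_space \<Rightarrow> ('d :: finite) torus"
  assumes "\<And>i. continuous_on S (\<lambda>x. coords (f x) $ i)"
  shows "continuous_on S f"
proof -
  have "continuous_on S (\<lambda>x. coords (f x))"
    using continuous_on_vec_lambda[of S "\<lambda>i x. coords (f x) $ i"] assms by simp
  then show ?thesis by (simp add: continuous_on_iff dist_torus_def)
qed

lemma continuous_torus_map: "continuous_on UNIV (torus_map A)"
  by (rule continuous_into_torus) (simp add: coords_torus_map continuous_character)

lemma compact_torus: "compact (UNIV :: ('d :: finite) torus set)"
proof -
  have "continuous_on UNIV (torus_exp :: real ^ 'd \<Rightarrow> 'd torus)"
    by (rule continuous_into_torus) (auto simp: coords_torus_exp cis_conv_exp intro!: continuous_intros)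
  then have "compact (torus_exp ` (cbox 0 (\<chi> i. 1) :: (real ^ 'd) set))"
    by (intro compact_continuous_image) (auto intro: continuous_on_subset)
  moreover have "z \<in> torus_exp ` cbox 0 (\<chi> i. 1)" for z :: "'d torus"
    by (rule torus_exp_surj[of z]) (auto simp: unit_cell_def mem_box_cart less_imp_le intro!: image_eqI)
  then have "torus_exp ` (cbox 0 (\<chi> i. 1) :: (real ^ 'd) set) = UNIV" by blast
  ultimately show ?thesis by simp
qed

inductive_set trig_polys :: "(('d :: finite) torus \<Rightarrow> complex) set" where
  scale: "(\<lambda>z. c * character m z) \<in> trig_polys"
| add: "f \<in> trig_polys \<Longrightarrow> g \<in> trig_polys \<Longrightarrow> (\<lambda>z. f z + g z) \<in> trig_polys"

lemma trig_polys_mult: "f \<in> trig_polys \<Longrightarrow> g \<in> trig_polys \<Longrightarrow> (\<lambda>z. f z * g z) \<in> trig_polys"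
proof (induction rule: trig_polys.induct)
  case (scale c m)
  from scale.prems show ?case
  proof (induction rule: trig_polys.induct)
    case (scale d n)
    have "(\<lambda>z. c * character m z * (d * character n z)) = (\<lambda>z. (c * d) * character (m + n) z)"
      by (auto simp: character_add)
    then show ?case by (simp only: trig_polys.scale)
  qed (simp add: distrib_left trig_polys.add)
qed (simp add: distrib_right trig_polys.add)

lemma trig_polys_const: "(\<lambda>z. c) \<in> trig_polys"
  using trig_polys.scale[of c 0] by simp

lemma trig_polys_CT: "f \<in> trig_polys \<Longrightarrow> f \<in> CT"
  by (induction rule: trig_polys.induct) (auto simp: CT_def intro!: continuous_intros continuous_character)

lemma trig_polys_dense:
  fixes f :: "('d :: finite) torus \<Rightarrow> complex"
  assumes "f \<in> CT" "e > 0"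
  obtains g where "g \<in> trig_polys" "\<And>z. cmod (f z - g z) < e"
proof -
  define P where "P f \<longleftrightarrow> (\<lambda>z. complex_of_real (f z)) \<in> trig_polys" for f :: "'d torus \<Rightarrow> real"
  have approx: "\<exists>g. P g \<and> (\<forall>z\<in>UNIV. \<bar>f z - g z\<bar> < e)" if fe: "continuous_on UNIV f" "e > 0" for f e
  proof (rule Stone_Weierstrass_HOL[of UNIV P f e, OF compact_torus _ _ _ _ _ fe])
    show "P (\<lambda>x. c)" for c by (simp add: P_def trig_polys_const)
    show "P (\<lambda>x. f x + g x)" if "P f \<and> P g" for f g using that by (auto simp: P_def trig_polys.add)
    show "P (\<lambda>x. f x * g x)" if "P f \<and> P g" for f g using that by (auto simp: P_def trig_polys_mult)
    show "continuous_on UNIV f" if "P f" for f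
      using trig_polys_CT[OF that[unfolded P_def]] continuous_on_Re[of UNIV "\<lambda>z. complex_of_real (f z)"]
      by (simp add: CT_def)
    fix z w :: "'d torus" assume "z \<in> UNIV \<and> w \<in> UNIV \<and> z \<noteq> w"
    then obtain i where i: "coords z $ i \<noteq> coords w $ i" using torus_eqI by blast
    have ax: "character (axis i 1) z = coords z $ i" for z :: "'d torus"
    proof -
      have "character (axis i 1) z = (\<Prod>j\<in>UNIV. if j = i then coords z $ j else 1)"
        unfolding character_def by (intro prod.cong) (auto simp: axis_def)
      then show ?thesis by simp
    qed
    have ax': "character (- axis i 1) z = cnj (coords z $ i)" for z :: "'d torus"
      using character_cnj[of "axis i 1" z] ax by simp
    have "complex_of_real (Re (coords z $ i)) = (1/2) * character (axis i 1) z + (1/2) * character (- axis i 1) z"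
      "complex_of_real (Im (coords z $ i)) = (-\<i>/2) * character (axis i 1) z + (\<i>/2) * character (- axis i 1) z"
      for z :: "'d torus"
      by (simp_all add: ax ax' complex_eq_iff)
    then have "P (\<lambda>z. Re (coords z $ i))" "P (\<lambda>z. Im (coords z $ i))"
      unfolding P_def by (simp_all only: trig_polys.add trig_polys.scale)
    moreover have "Re (coords z $ i) \<noteq> Re (coords w $ i) \<or> Im (coords z $ i) \<noteq> Im (coords w $ i)"
      using i by (simp add: complex_eq_iff)
    ultimately show "\<exists>f. P f \<and> f z \<noteq> f w" by metis
  qed
  have "continuous_on UNIV (\<lambda>z. Re (f z))" "continuous_on UNIV (\<lambda>z. Im (f z))"
    using assms(1) by (auto simp: CT_def intro!: continuous_intros)
  then obtain g h where g: "P g" "\<And>z. \<bar>Re (f z) - g z\<bar> < e / 2" and h: "P h" "\<And>z. \<bar>Im (f z) - h z\<bar> < e / 2"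
    using approx[of "\<lambda>z. Re (f z)" "e / 2"] approx[of "\<lambda>z. Im (f z)" "e / 2"] assms(2) by auto
  show ?thesis
  proof (rule that[of "\<lambda>z. of_real (g z) + \<i> * of_real (h z)"])
    show "(\<lambda>z. of_real (g z) + \<i> * of_real (h z)) \<in> trig_polys"
      using g(1) h(1) by (intro trig_polys.add trig_polys_mult trig_polys_const) (simp_all add: P_def)
    show "cmod (f z - (of_real (g z) + \<i> * of_real (h z))) < e" for z
      using cmod_le[of "f z - (of_real (g z) + \<i> * of_real (h z))"] g(2)[of z] h(2)[of z] by simp
  qed
qed

definition sup_norm :: "(('d :: finite) torus \<Rightarrow> complex) \<Rightarrow> real" where
  "sup_norm f = (SUP z. cmod (f z))"

lemma sup_norm_upper: assumes "f \<in> CT" shows "cmod (f z) \<le> sup_norm f"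
proof -
  have "compact (range f)" using assms compact_torus by (auto simp: CT_def intro: compact_continuous_image)
  then obtain b where "\<And>z. cmod (f z) \<le> b" using compact_imp_bounded bounded_iff by (metis rangeI)
  then show ?thesis unfolding sup_norm_def by (intro cSUP_upper) (auto intro!: bdd_aboveI)
qed

lemma sup_norm_least: "(\<And>z. cmod (f z) \<le> b) \<Longrightarrow> sup_norm f \<le> b"
  unfolding sup_norm_def by (rule cSUP_least) auto

lemma sup_norm_nonneg: "f \<in> CT \<Longrightarrow> 0 \<le> sup_norm f"
  using sup_norm_upper[of f torus_one] norm_ge_zero order_trans by blast

lemma CT_intros:
  "(\<lambda>z. c) \<in> CT"
  "f \<in> CT \<Longrightarrow> g \<in> CT \<Longrightarrow> (\<lambda>z. f z + g z) \<in> CT"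
  "f \<in> CT \<Longrightarrow> g \<in> CT \<Longrightarrow> (\<lambda>z. f z - g z) \<in> CT"
  "f \<in> CT \<Longrightarrow> g \<in> CT \<Longrightarrow> (\<lambda>z. f z * g z) \<in> CT"
  "f \<in> CT \<Longrightarrow> (\<lambda>z. cnj (f z)) \<in> CT"
  "character m \<in> CT"
  "f \<in> CT \<Longrightarrow> alpha A f \<in> CT"
  by (auto simp: CT_def alpha_def intro!: continuous_intros continuous_character
      continuous_on_compose[OF continuous_torus_map, unfolded o_def] elim: continuous_on_subset)

lemma left_act_CT: "f \<in> CT \<Longrightarrow> m \<in> CT \<Longrightarrow> left_act f m \<in> CT"
  and right_act_CT: "m \<in> CT \<Longrightarrow> g \<in> CT \<Longrightarrow> right_act A m g \<in> CT"
  by (simp_all add: left_act_def right_act_def CT_intros)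

context nonsingular
begin

lemma transfer_add: "transfer A (\<lambda>z. f z + g z) = (\<lambda>z. transfer A f z + transfer A g z)"
  and transfer_scale: "transfer A (\<lambda>z. c * f z) = (\<lambda>z. c * transfer A f z)"
  and transfer_diff: "transfer A (\<lambda>z. f z - g z) = (\<lambda>z. transfer A f z - transfer A g z)"
  by (simp_all add: fun_eq_iff transfer_fibre sum.distrib add_divide_distrib sum_distrib_left[symmetric] sum_subtractf diff_divide_distrib)

lemma transfer_le: assumes "\<And>z. cmod (f z) \<le> b" shows "cmod (transfer A f z) \<le> b"
proof -
  have "cmod (\<Sum>w\<in>fibre A z. f w) \<le> N * b"
    using sum_norm_le[of "fibre A z" f "\<lambda>_. b"] assms by (simp add: card_fibre)
  then show ?thesis using N_nonzero by (simp add: transfer_fibre norm_divide field_simps)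
qed

lemma transfer_trig_polys: "f \<in> trig_polys \<Longrightarrow> transfer A f \<in> trig_polys"
proof (induction rule: trig_polys.induct)
  case (scale c m)
  show ?case
  proof (cases "\<exists>n. m = B n")
    case True
    then show ?thesis by (auto simp: transfer_scale transfer_B trig_polys.scale)
  qed (simp add: transfer_scale transfer_not_B trig_polys_const)
qed (simp add: transfer_add trig_polys.add)

text \<open>
  The transfer operator maps trigonometric polynomials to trigonometric polynomials and does not
  increase the supremum norm, so it preserves uniform limits of trigonometric polynomials.
\<close>

lemma transfer_CT: assumes "f \<in> CT" shows "transfer A f \<in> CT"
proof -
  have "\<exists>g. g \<in> trig_polys \<and> (\<forall>z. cmod (f z - g z) < 1 / Suc n)" for n
    using trig_polys_dense[OF assms, of "1 / Suc n"] by (metis of_nat_0_less_iff zero_less_Suc zero_less_divide_1_iff)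
  then obtain g where g: "\<And>n. g n \<in> trig_polys" "\<And>n z. cmod (f z - g n z) < 1 / Suc n" by metis
  have le: "cmod (transfer A f z - transfer A (g n) z) \<le> 1 / Suc n" for n z
    using transfer_le[of "\<lambda>z. f z - g n z" "1 / Suc n" z] g(2) by (simp add: transfer_diff less_imp_le)
  have "uniform_limit UNIV (\<lambda>n. transfer A (g n)) (transfer A f) sequentially"
  proof (rule uniform_limitI)
    fix e :: real assume "e > 0"
    then have "\<forall>\<^sub>F n in sequentially. 1 / Suc n < e"
      using order_tendstoD(2)[OF LIMSEQ_inverse_real_of_nat, of e] by (simp add: inverse_eq_divide)
    then show "\<forall>\<^sub>F n in sequentially. \<forall>z\<in>UNIV. dist (transfer A (g n) z) (transfer A f z) < e"
      by (rule eventually_mono) (use order_le_less_trans[OF le] in \<open>simp add: dist_norm norm_minus_commute\<close>)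
  qed
  then have "continuous_on UNIV (transfer A f)"
    by (rule uniform_limit_theorem[rotated])
      (use trig_polys_CT[OF transfer_trig_polys[OF g(1)]] in \<open>auto simp: CT_def\<close>)
  then show ?thesis by (simp add: CT_def)
qed

lemma inner_ML_CT: "m \<in> CT \<Longrightarrow> n \<in> CT \<Longrightarrow> inner_ML A m n \<in> CT"
  unfolding inner_ML_def by (intro transfer_CT CT_intros)

end

section \<open>Closed linear spans\<close>

context seminormed_star_algebra
begin

definition closed_subspace :: "'a set \<Rightarrow> bool" where
  "closed_subspace S \<longleftrightarrow> S \<subseteq> carrier C \<and> \<zero> \<in> S \<and>
     (\<forall>x\<in>S. \<forall>y\<in>S. x \<oplus> y \<in> S) \<and> (\<forall>c. \<forall>x\<in>S. c \<odot> x \<in> S) \<and>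
     (\<forall>s x. (\<forall>n. s n \<in> S) \<longrightarrow> x \<in> carrier C \<longrightarrow> converges C s x \<longrightarrow> x \<in> S)"

text \<open>
  Intersections of closed subspaces suit the only use made of spans: a property that is
  preserved by linear combinations and limits holds on the span once it holds on the generators.
\<close>

definition closed_span :: "'a set \<Rightarrow> 'a set" where
  "closed_span M = \<Inter>{S. closed_subspace S \<and> M \<subseteq> S}"

lemma closed_subspace_carrier: "closed_subspace (carrier C)"
  by (auto simp: closed_subspace_def)

lemma closed_subspace_span: assumes "M \<subseteq> carrier C" shows "closed_subspace (closed_span M)"
proof -
  have "closed_span M \<subseteq> carrier C" using assms closed_subspace_carrier by (auto simp: closed_span_def)
  then show ?thesis unfolding closed_subspace_def
    by (intro conjI; (simp add: closed_span_def closed_subspace_def; fail | unfold closed_span_def closed_subspace_def; blast))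
qed

lemma closed_subspace_limit:
  "closed_subspace S \<Longrightarrow> (\<And>n. s n \<in> S) \<Longrightarrow> x \<in> carrier C \<Longrightarrow> converges C s x \<Longrightarrow> x \<in> S"
  unfolding closed_subspace_def by blast

lemma closed_span_superset: "M \<subseteq> closed_span M"
  by (auto simp: closed_span_def)

lemma closed_span_least: "closed_subspace S \<Longrightarrow> M \<subseteq> S \<Longrightarrow> closed_span M \<subseteq> S"
  by (auto simp: closed_span_def)

lemma converges_mult_left:
  assumes "a \<in> carrier C" "\<And>n. s n \<in> carrier C" "x \<in> carrier C" "converges C s x"
  shows "converges C (\<lambda>n. a \<otimes> s n) (a \<otimes> x)"
  using converges_mult[of "\<lambda>n. a" a s x] assms by simp

lemma converges_mult_right:
  assumes "a \<in> carrier C" "\<And>n. s n \<in> carrier C" "x \<in> carrier C" "converges C s x"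
  shows "converges C (\<lambda>n. s n \<otimes> a) (x \<otimes> a)"
  using converges_mult[of s x "\<lambda>n. a" a] assms by simp

lemma closed_span_left_mult:
  assumes a: "a \<in> carrier C" and M: "M \<subseteq> carrier C" "\<And>x. x \<in> M \<Longrightarrow> a \<otimes> x \<in> closed_span M"
    and x: "x \<in> closed_span M"
  shows "a \<otimes> x \<in> closed_span M"
proof -
  let ?S = "{x \<in> carrier C. a \<otimes> x \<in> closed_span M}"
  have cs: "closed_subspace (closed_span M)" using M(1) by (rule closed_subspace_span)
  have "closed_subspace ?S"
    unfolding closed_subspace_def
  proof (intro conjI ballI allI impI)
    fix s x assume s: "\<forall>n. s n \<in> ?S" and x: "x \<in> carrier C" "converges C s x"
    have "converges C (\<lambda>n. a \<otimes> s n) (a \<otimes> x)" using converges_mult_left[OF a _ x] s by simp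
    then have "a \<otimes> x \<in> closed_span M"
      by (rule closed_subspace_limit[OF cs, rotated 2]) (use s x a in simp_all)
    then show "x \<in> ?S" using x by simp
  qed (use cs a in \<open>auto simp: closed_subspace_def distrib_left smult_mult_right\<close>)
  then have "closed_span M \<subseteq> ?S" by (rule closed_span_least) (use M in auto)
  then show ?thesis using x by auto
qed

lemma rank_image_closed:
  "\<forall>(x, y)\<in>set xs. \<psi> x \<in> carrier C \<and> \<psi> y \<in> carrier C \<Longrightarrow> rank_image C \<psi> xs \<in> carrier C"
  by (induction xs) (auto simp: rank_image_def star_closed)

lemma nrm_rank_image:
  "\<forall>(x, y)\<in>set xs. \<psi> x \<in> carrier C \<and> \<psi> y \<in> carrier C \<Longrightarrow>
    nrm C (rank_image C \<psi> xs) \<le> (\<Sum>(x, y)\<leftarrow>xs. nrm C (\<psi> x) * nrm C (\<psi> y))"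
proof (induction xs)
  case (Cons p xs)
  obtain x y where p: "p = (x, y)" by force
  have c: "\<psi> x \<in> carrier C" "\<psi> y \<in> carrier C" using Cons.prems p by auto
  have r: "rank_image C \<psi> xs \<in> carrier C" using Cons.prems by (intro rank_image_closed) auto
  have "nrm C (rank_image C \<psi> (p # xs)) \<le> nrm C (\<psi> x \<otimes> star C (\<psi> y)) + nrm C (rank_image C \<psi> xs)"
    using c r nrm_triangle[of "\<psi> x \<otimes> star C (\<psi> y)" "rank_image C \<psi> xs"]
    by (simp add: rank_image_def p star_closed)
  also have "nrm C (\<psi> x \<otimes> star C (\<psi> y)) \<le> nrm C (\<psi> x) * nrm C (\<psi> y)"
    using c nrm_mult[of "\<psi> x" "star C (\<psi> y)"] by (simp add: star_closed)
  finally show ?case using Cons by (simp add: p)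
qed (simp add: rank_image_def)

end

section \<open>Covariant representations in terms of a frame\<close>

context nonsingular
begin

definition frame_list :: "(int ^ 'd) list" where
  "frame_list = (SOME l. set l = frame_box \<and> distinct l)"

lemma frame_list: "set frame_list = frame_box" "distinct frame_list"
  using someI_ex[OF finite_distinct_list[OF finite_frame_box]] by (auto simp: frame_list_def)

definition frame_const :: complex where
  "frame_const = N / N ^ CARD('d)"

text \<open>
  The scaling by \<^term>\<open>frame_const\<close> compensates for the box containing \<open>N\<^sup>d\<^sup>-\<^sup>1\<close> points of each coset.
\<close>

definition frame_pairs :: "'d rank_list" where
  "frame_pairs = map (\<lambda>s. (character s, \<lambda>z. frame_const * character s z)) frame_list"

lemma frame_pairs_CT: "set frame_pairs \<subseteq> CT \<times> CT"
  by (auto simp: frame_pairs_def CT_intros)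

text \<open>
  The inner products spread \<open>m\<close> over the fibre through \<open>z\<close>, and the orthogonality of the frame on that
  fibre picks out the value at \<open>z\<close>.
\<close>

lemma finite_rank_frame: "finite_rank A frame_pairs m = m"
proof
  fix z
  have "finite_rank A frame_pairs m z =
      (\<Sum>s\<in>frame_box. character s z * transfer A (\<lambda>w. cnj (frame_const * character s w) * m w) (torus_map A z))"
    by (simp add: finite_rank_def frame_pairs_def right_act_def inner_ML_def alpha_def frame_list
      sum_list_distinct_conv_sum_set o_def)
  also have "\<dots> = (\<Sum>s\<in>frame_box. \<Sum>w\<in>fibre A (torus_map A z).
      frame_const / N * m w * (character s z * cnj (character s w)))"
    by (simp add: transfer_fibre sum_distrib_left sum_divide_distrib frame_const_def mult_ac)
  also have "\<dots> = (\<Sum>w\<in>fibre A (torus_map A z). frame_const / N * m w *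
      (\<Sum>s\<in>frame_box. character s z * cnj (character s w)))"
    unfolding sum_distrib_left by (rule sum.swap)
  also have "\<dots> = (\<Sum>w\<in>fibre A (torus_map A z). if z = w then m w else 0)"
    using N_nonzero by (intro sum.cong refl) (simp add: frame_sum fibre_def frame_const_def)
  also have "\<dots> = m z" using fibre_finite by (simp add: fibre_def)
  finally show "finite_rank A frame_pairs m z = m z" .
qed

lemma left_act_one: "left_act (\<lambda>z. 1) = (\<lambda>m. m)"
  by (simp add: left_act_def fun_eq_iff)

lemma norm_ML_eq: "norm_ML A m = sqrt (sup_norm (inner_ML A m m))"
  by (simp add: norm_ML_def sup_norm_def)

lemma norm_ML_nonneg: "m \<in> CT \<Longrightarrow> norm_ML A m \<ge> 0"
  by (simp add: norm_ML_eq sup_norm_nonneg inner_ML_CT)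

lemma frame_tendsto: "finite_rank_tendsto A (\<lambda>k. frame_pairs) (left_act (\<lambda>z. 1))"
proof -
  have "transfer A (\<lambda>z. 0) = (\<lambda>z. 0)" by (simp add: transfer_fibre fun_eq_iff)
  then have "norm_ML A (\<lambda>z. 0) = 0" by (simp add: norm_ML_def inner_ML_def)
  then show ?thesis
    using frame_pairs_CT by (auto simp: finite_rank_tendsto_def left_act_one finite_rank_frame norm_ML_nonneg)
qed

lemma finite_rank_CT: "set xs \<subseteq> CT \<times> CT \<Longrightarrow> m \<in> CT \<Longrightarrow> finite_rank A xs m \<in> CT"
proof (induction xs)
  case (Cons p xs)
  then show ?case
    using CT_intros(2)[OF right_act_CT[OF _ inner_ML_CT] Cons.IH, of "fst p" "snd p"]
    by (auto simp: finite_rank_def case_prod_beta)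
qed (simp add: finite_rank_def CT_intros)

lemma alpha_character: "alpha A (character n) = character (B n)"
  by (simp add: alpha_def fun_eq_iff character_torus_map)

end

text \<open>
  Representations described by equations alone: the single relation \<open>frame\<close> replaces the
  covariance condition, which quantifies over approximations by finite-rank operators.  The two
  notions coincide, by the lemmas \<open>torus_rep\<close> and \<open>covariant_rep\<close> below.
\<close>

locale torus_rep = nonsingular A N + cstar_algebra C
  for A :: "int ^ 'd ^ ('d :: finite)" and N :: nat
    and C :: "('c, 'm) cstar_scheme" (structure)
    and \<psi> :: "('d torus \<Rightarrow> complex) \<Rightarrow> 'c"
    and \<pi> :: "('d torus \<Rightarrow> complex) \<Rightarrow> 'c" +
  assumes psi_closed: "m \<in> CT \<Longrightarrow> \<psi> m \<in> carrier C"
    and psi_add: "m \<in> CT \<Longrightarrow> n \<in> CT \<Longrightarrow> \<psi> (\<lambda>z. m z + n z) = \<psi> m \<oplus> \<psi> n"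
    and psi_scale: "m \<in> CT \<Longrightarrow> \<psi> (\<lambda>z. c * m z) = c \<odot> \<psi> m"
    and pi_closed: "f \<in> CT \<Longrightarrow> \<pi> f \<in> carrier C"
    and pi_add: "f \<in> CT \<Longrightarrow> g \<in> CT \<Longrightarrow> \<pi> (\<lambda>z. f z + g z) = \<pi> f \<oplus> \<pi> g"
    and pi_scale: "f \<in> CT \<Longrightarrow> \<pi> (\<lambda>z. c * f z) = c \<odot> \<pi> f"
    and pi_mult: "f \<in> CT \<Longrightarrow> g \<in> CT \<Longrightarrow> \<pi> (\<lambda>z. f z * g z) = \<pi> f \<otimes> \<pi> g"
    and pi_star: "f \<in> CT \<Longrightarrow> \<pi> (\<lambda>z. cnj (f z)) = star C (\<pi> f)"
    and pi_one: "\<pi> (\<lambda>z. 1) = \<one>"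
    and psi_left: "f \<in> CT \<Longrightarrow> m \<in> CT \<Longrightarrow> \<psi> (left_act f m) = \<pi> f \<otimes> \<psi> m"
    and psi_right: "m \<in> CT \<Longrightarrow> g \<in> CT \<Longrightarrow> \<psi> (right_act A m g) = \<psi> m \<otimes> \<pi> g"
    and psi_inner: "m \<in> CT \<Longrightarrow> n \<in> CT \<Longrightarrow> star C (\<psi> m) \<otimes> \<psi> n = \<pi> (inner_ML A m n)"
    and frame: "rank_image C \<psi> frame_pairs = \<one>"

lemma (in covariant_rep) torus_rep: assumes "nonsingular A N" shows "torus_rep A N C \<psi> \<pi>"
proof -
  interpret nonsingular A N by (rule assms)
  have "rank_image C \<psi> frame_pairs \<in> carrier C"
    using frame_pairs_CT psi_closed by (intro rank_image_closed) auto
  moreover have "converges C (\<lambda>k. rank_image C \<psi> frame_pairs) \<one>"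
    using covariant[OF CT_intros(1) frame_tendsto] pi_one by simp
  ultimately have "rank_image C \<psi> frame_pairs = \<one>"
    by (intro converges_unique[of "\<lambda>k. rank_image C \<psi> frame_pairs"]) simp_all
  then show ?thesis
    by unfold_locales
      (simp_all add: psi_closed psi_add psi_scale pi_closed pi_add pi_scale pi_mult pi_star pi_one
        psi_left psi_right psi_inner)
qed

context torus_rep
begin

lemma nrm_pi: assumes f: "f \<in> CT" shows "nrm C (\<pi> f) \<le> sup_norm f"
proof -
  \<comment> \<open>A real function of norm at most 1 is the average of two unitaries.\<close>
  have real1: "nrm C (\<pi> (\<lambda>z. of_real (g z))) \<le> 1" if g: "continuous_on UNIV g" "\<And>z. \<bar>g z\<bar> \<le> 1" for g
  proof -
    define w where "w z = Complex (g z) (sqrt (1 - (g z)\<^sup>2))" for z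
    have w: "w \<in> CT" unfolding CT_def w_def
      by (auto simp: Complex_eq intro!: continuous_intros g(1))
    have "cnj (w z) * w z = 1" for z
    proof -
      have "(g z)\<^sup>2 \<le> 1" using g(2)[of z] by (simp add: abs_square_le_1)
      then show ?thesis by (simp add: w_def complex_eq_iff power2_eq_square[symmetric])
    qed
    then have "star C (\<pi> w) \<otimes> \<pi> w = \<one>"
      using pi_mult[OF CT_intros(5)[OF w] w] pi_star[OF w] pi_one by simp
    then have "(nrm C (\<pi> w))\<^sup>2 \<le> 1"
      using cstar_identity[OF pi_closed[OF w]] nrm_one_le by simp
    then have 1: "nrm C (\<pi> w) \<le> 1" using power2_le_imp_le[of "nrm C (\<pi> w)" 1] by simp
    have half: "(\<lambda>z. complex_of_real (g z)) = (\<lambda>z. (1/2) * (w z + cnj (w z)))"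
      by (simp add: w_def complex_eq_iff fun_eq_iff)
    have "\<pi> (\<lambda>z. of_real (g z)) = (1/2) \<odot> (\<pi> w \<oplus> star C (\<pi> w))"
      unfolding half by (simp only: pi_scale pi_add pi_star CT_intros w)
    then show ?thesis
      using nrm_triangle[of "\<pi> w" "star C (\<pi> w)"] pi_closed[OF w] 1 by (simp add: nrm_smult star_closed)
  qed
  show ?thesis
  proof (rule field_le_epsilon)
    fix e :: real assume e: "e > 0"
    define b where "b = sup_norm f + e"
    have b: "b > 0" using e sup_norm_nonneg[OF f] by (simp add: b_def)
    define g where "g z = (cmod (f z))\<^sup>2 / b\<^sup>2" for z
    have "cmod (f z) \<le> b" for z using sup_norm_upper[OF f, of z] e by (simp add: b_def)
    then have g1: "\<bar>g z\<bar> \<le> 1" for z using b by (simp add: g_def power_mono)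
    have gc: "continuous_on UNIV g" using f b unfolding g_def CT_def by (auto intro!: continuous_intros)
    have gCT: "(\<lambda>z. complex_of_real (g z)) \<in> CT" using gc by (auto simp: CT_def intro!: continuous_intros)
    have "(\<lambda>z. cnj (f z) * f z) = (\<lambda>z. of_real (b\<^sup>2) * of_real (g z))"
      using b by (auto simp: g_def complex_norm_square mult.commute simp flip: of_real_mult of_real_power)
    then have "star C (\<pi> f) \<otimes> \<pi> f = of_real (b\<^sup>2) \<odot> \<pi> (\<lambda>z. of_real (g z))"
      using pi_mult[OF CT_intros(5)[OF f] f] pi_star[OF f] pi_scale[OF gCT, of "of_real (b\<^sup>2)"] by simp
    then have "(nrm C (\<pi> f))\<^sup>2 = b\<^sup>2 * nrm C (\<pi> (\<lambda>z. of_real (g z)))"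
      using cstar_identity[OF pi_closed[OF f]] pi_closed[OF gCT] by (simp add: nrm_smult norm_power)
    also have "\<dots> \<le> b\<^sup>2 * 1" using real1[OF gc g1] by (intro mult_left_mono) auto
    finally show "nrm C (\<pi> f) \<le> sup_norm f + e"
      using b power2_le_imp_le[of "nrm C (\<pi> f)" b] by (simp add: b_def[symmetric])
  qed
qed

lemma nrm_psi: assumes "m \<in> CT" shows "nrm C (\<psi> m) \<le> norm_ML A m"
proof -
  have "(nrm C (\<psi> m))\<^sup>2 = nrm C (\<pi> (inner_ML A m m))"
    using cstar_identity[OF psi_closed[OF assms]] psi_inner[OF assms assms] by simp
  also have "\<dots> \<le> sup_norm (inner_ML A m m)" using assms by (intro nrm_pi inner_ML_CT)
  finally show ?thesis unfolding norm_ML_eq by (rule real_le_rsqrt)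
qed

lemma psi_diff: "m \<in> CT \<Longrightarrow> n \<in> CT \<Longrightarrow> \<psi> (\<lambda>z. m z - n z) = \<psi> m \<ominus> \<psi> n"
  using psi_add[of m "\<lambda>z. -1 * n z"] psi_scale[of n "-1"] CT_intros(4)[OF CT_intros(1)[of "-1"], of n]
  by (simp add: minus_scale psi_closed)

lemma rank_image_psi:
  assumes "set xs \<subseteq> CT \<times> CT" "m \<in> CT"
  shows "rank_image C \<psi> xs \<otimes> \<psi> m = \<psi> (finite_rank A xs m)"
  using assms(1)
proof (induction xs)
  case Nil
  have "\<psi> (\<lambda>z. 0) = \<zero>" using psi_scale[OF assms(2), of 0] assms(2) psi_closed by simp
  then show ?case using assms(2) psi_closed by (simp add: rank_image_def finite_rank_def)
next
  case (Cons p xs)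
  obtain x y where p: "p = (x, y)" "x \<in> CT" "y \<in> CT" using Cons.prems by (cases p) auto
  have r: "rank_image C \<psi> xs \<in> carrier C"
    using Cons.prems psi_closed by (intro rank_image_closed) auto
  have "finite_rank A (p # xs) m = (\<lambda>z. right_act A x (inner_ML A y m) z + finite_rank A xs m z)"
    by (simp add: finite_rank_def p)
  then have "\<psi> (finite_rank A (p # xs) m) = \<psi> x \<otimes> (star C (\<psi> y) \<otimes> \<psi> m) \<oplus> rank_image C \<psi> xs \<otimes> \<psi> m"
    using Cons p assms(2) by (simp add: psi_add psi_right psi_inner right_act_CT inner_ML_CT finite_rank_CT)
  also have "\<dots> = rank_image C \<psi> (p # xs) \<otimes> \<psi> m"
    using p assms(2) r psi_closed by (simp add: rank_image_def distrib_right mult_assoc star_closed)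
  finally show ?case ..
qed

lemma rank_image_left_mult:
  assumes "a \<in> carrier C" "set xs \<subseteq> CT \<times> CT" "\<And>x. x \<in> CT \<Longrightarrow> h x \<in> CT" "\<And>x. x \<in> CT \<Longrightarrow> a \<otimes> \<psi> x = \<psi> (h x)"
  shows "a \<otimes> rank_image C \<psi> xs = rank_image C \<psi> (map (map_prod h id) xs)"
  using assms(2)
proof (induction xs)
  case Nil
  then show ?case using assms(1) by (simp add: rank_image_def)
next
  case (Cons p xs)
  obtain x y where p: "p = (x, y)" "x \<in> CT" "y \<in> CT" using Cons.prems by (cases p) auto
  have r: "rank_image C \<psi> xs \<in> carrier C"
    using Cons.prems psi_closed by (intro rank_image_closed) auto
  have "a \<otimes> rank_image C \<psi> (p # xs) = (a \<otimes> \<psi> x) \<otimes> star C (\<psi> y) \<oplus> a \<otimes> rank_image C \<psi> xs"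
    using p r assms(1) psi_closed by (simp add: rank_image_def distrib_left mult_assoc star_closed)
  then show ?case using Cons p assms by (simp add: rank_image_def)
qed

text \<open>
  Multiplying by the frame decomposition of the unit reduces the norm of an operator to its values at
  the finitely many elements of the frame.
\<close>

lemma covariant_rep: "covariant_rep A C \<psi> \<pi>"
proof -
  have "converges C (\<lambda>k. rank_image C \<psi> (Ts k)) (\<pi> a)"
    if a: "a \<in> CT" and T: "finite_rank_tendsto A Ts (left_act a)" for a Ts
  proof -
    have Ts: "set (Ts k) \<subseteq> CT \<times> CT" for k using T by (auto simp: finite_rank_tendsto_def)
    have R: "rank_image C \<psi> (Ts k) \<in> carrier C" for k
      using Ts psi_closed by (intro rank_image_closed) auto
    define h where "h k m = (\<lambda>z. finite_rank A (Ts k) m z - left_act a m z)" for k m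
    have h: "h k m \<in> CT" if "m \<in> CT" for k m
      unfolding h_def using that a Ts by (intro CT_intros finite_rank_CT left_act_CT)
    have hpsi: "(rank_image C \<psi> (Ts k) \<ominus> \<pi> a) \<otimes> \<psi> m = \<psi> (h k m)" if m: "m \<in> CT" for k m
    proof -
      have "(rank_image C \<psi> (Ts k) \<ominus> \<pi> a) \<otimes> \<psi> m = rank_image C \<psi> (Ts k) \<otimes> \<psi> m \<ominus> \<pi> a \<otimes> \<psi> m"
        using R[of k] pi_closed[OF a] psi_closed[OF m] by algebra
      then show ?thesis unfolding h_def
        using m a Ts by (simp add: psi_diff rank_image_psi psi_left finite_rank_CT left_act_CT)
    qed
    define K where "K = (\<Sum>(x, y)\<leftarrow>frame_pairs. norm_ML A x * nrm C (\<psi> y))"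
    have fp: "x \<in> CT" "y \<in> CT" if "(x, y) \<in> set frame_pairs" for x y using frame_pairs_CT that by auto
    have K: "K \<ge> 0" unfolding K_def
      using fp psi_closed nrm_nonneg norm_ML_nonneg by (intro sum_list_nonneg) (auto intro!: mult_nonneg_nonneg)
    have bound: "nrm C (rank_image C \<psi> (Ts k) \<ominus> \<pi> a) \<le> e * K"
      if e: "\<forall>m\<in>CT. norm_ML A (h k m) \<le> e * norm_ML A m" for e k
    proof -
      have "rank_image C \<psi> (Ts k) \<ominus> \<pi> a = (rank_image C \<psi> (Ts k) \<ominus> \<pi> a) \<otimes> rank_image C \<psi> frame_pairs"
        using R pi_closed[OF a] frame by simp
      also have "\<dots> = rank_image C \<psi> (map (map_prod (h k) id) frame_pairs)"
        using R pi_closed[OF a] frame_pairs_CT h hpsi by (intro rank_image_left_mult) auto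
      finally have eq: "rank_image C \<psi> (Ts k) \<ominus> \<pi> a = rank_image C \<psi> (map (map_prod (h k) id) frame_pairs)" .
      have "nrm C (rank_image C \<psi> (Ts k) \<ominus> \<pi> a) \<le>
          (\<Sum>(x, y)\<leftarrow>map (map_prod (h k) id) frame_pairs. nrm C (\<psi> x) * nrm C (\<psi> y))"
        unfolding eq
      proof (rule nrm_rank_image, clarsimp)
        fix x y assume "(x, y) \<in> set frame_pairs"
        then show "\<psi> (h k x) \<in> carrier C \<and> \<psi> y \<in> carrier C" using fp h psi_closed by blast
      qed
      also have "\<dots> = (\<Sum>(x, y)\<leftarrow>frame_pairs. nrm C (\<psi> (h k x)) * nrm C (\<psi> y))"
        unfolding map_map by (intro arg_cong[of _ _ sum_list] map_cong) auto
      also have "\<dots> \<le> (\<Sum>(x, y)\<leftarrow>frame_pairs. e * (norm_ML A x * nrm C (\<psi> y)))"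
      proof (rule sum_list_mono, clarsimp)
        fix x y assume "(x, y) \<in> set frame_pairs"
        then have "nrm C (\<psi> (h k x)) \<le> e * norm_ML A x" "0 \<le> nrm C (\<psi> y)"
          using e fp nrm_psi[OF h, of x k] nrm_nonneg psi_closed order_trans by blast+
        then show "nrm C (\<psi> (h k x)) * nrm C (\<psi> y) \<le> e * (norm_ML A x * nrm C (\<psi> y))"
          using mult_right_mono by (fastforce simp: mult.assoc[symmetric])
      qed
      also have "\<dots> = e * K" by (simp add: K_def sum_list_const_mult[symmetric] split_def)
      finally show ?thesis .
    qed
    show ?thesis unfolding converges_def
    proof (rule LIMSEQ_I)
      fix r :: real assume r: "r > 0"
      define e where "e = r / (K + 1)"
      have e: "e > 0" "e * K < r" using r K by (auto simp: e_def field_simps)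
      have "\<forall>\<^sub>F k in sequentially. \<forall>m\<in>CT. norm_ML A (h k m) \<le> e * norm_ML A m"
        using T e(1) by (simp add: finite_rank_tendsto_def h_def)
      then obtain k0 where k0: "\<And>k. k \<ge> k0 \<Longrightarrow> \<forall>m\<in>CT. norm_ML A (h k m) \<le> e * norm_ML A m"
        by (auto simp: eventually_sequentially)
      have "norm (nrm C (rank_image C \<psi> (Ts k) \<ominus> \<pi> a) - 0) < r" if "k \<ge> k0" for k
        using bound[OF k0[OF that]] e nrm_nonneg R pi_closed[OF a] by simp
      then show "\<exists>k0. \<forall>k\<ge>k0. norm (nrm C (rank_image C \<psi> (Ts k) \<ominus> \<pi> a) - 0) < r" by blast
    qed
  qed
  then show ?thesis
    by unfold_locales
      (simp_all add: psi_closed psi_add psi_scale pi_closed pi_add pi_scale pi_mult pi_star pi_one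
        psi_left psi_right psi_inner)
qed

end

section \<open>The spanning monomials\<close>

context torus_rep
begin

abbreviation "u m \<equiv> \<pi> (character m)"
abbreviation "v \<equiv> \<psi> (\<lambda>z. 1)"

definition mono :: "int ^ 'd \<Rightarrow> nat \<Rightarrow> nat \<Rightarrow> int ^ 'd \<Rightarrow> 'c" where
  "mono m k l n = u m \<otimes> v [^] k \<otimes> star C v [^] l \<otimes> star C (u n)"

definition monomials :: "'c set" where
  "monomials = {mono m k l n |m k l n. True}"

lemmas pow_0 = monoid.nat_pow_0[OF ring.is_monoid[OF is_ring]]
  and pow_Suc = monoid.nat_pow_Suc[OF ring.is_monoid[OF is_ring]]
  and pow_Suc2 = monoid.nat_pow_Suc2[OF ring.is_monoid[OF is_ring]]
  and pow_closed = monoid.nat_pow_closed[OF ring.is_monoid[OF is_ring]]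

declare pow_Suc [simp del]

lemma u_closed [simp]: "u m \<in> carrier C" and v_closed [simp]: "v \<in> carrier C"
  and v_star_closed [simp]: "star C v \<in> carrier C"
  and v_pow_closed [simp]: "v [^] (k::nat) \<in> carrier C"
  and v_star_pow_closed [simp]: "star C v [^] (k::nat) \<in> carrier C"
  by (simp_all add: pi_closed psi_closed star_closed CT_intros pow_closed)

lemma v_pow_swap: "y \<in> carrier C \<Longrightarrow> v [^] (k::nat) \<otimes> (v \<otimes> y) = v \<otimes> (v [^] k \<otimes> y)"
  and v_star_pow_swap:
    "y \<in> carrier C \<Longrightarrow> star C v [^] (k::nat) \<otimes> (star C v \<otimes> y) = star C v \<otimes> (star C v [^] k \<otimes> y)"
  using pow_Suc[of v k] pow_Suc2[of v k] pow_Suc[of "star C v" k] pow_Suc2[of "star C v" k]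
  by (simp_all add: mult_assoc[symmetric])

lemma u_mult: "u m \<otimes> u n = u (m + n)"
proof -
  have "u (m + n) = \<pi> (\<lambda>z. character m z * character n z)" by (simp add: character_add[abs_def])
  then show ?thesis by (simp add: pi_mult CT_intros)
qed

lemma u_zero: "u 0 = \<one>"
  using pi_one by (simp add: character_0[abs_def])

lemma u_star: "star C (u m) = u (- m)"
  using pi_star[of "character m"] by (simp add: CT_intros character_cnj[abs_def])

lemma psi_eq: "m \<in> CT \<Longrightarrow> \<psi> m = \<pi> m \<otimes> v"
  using psi_left[of m "\<lambda>z. 1"] by (simp add: CT_intros left_act_def)

lemma v_u: "v \<otimes> u n = u (B n) \<otimes> v"
  using psi_right[of "\<lambda>z. 1" "character n"] psi_left[of "character (B n)" "\<lambda>z. 1"]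
  by (simp add: CT_intros left_act_def right_act_def alpha_character)

lemma v_star_u_v: "star C v \<otimes> (u m \<otimes> v) = \<pi> (transfer A (character m))"
  using psi_inner[of "\<lambda>z. 1" "character m"] psi_eq[of "character m"] by (simp add: CT_intros inner_ML_def)

lemma v_star_u_v_in: "star C v \<otimes> (u (B n) \<otimes> v) = u n"
  by (simp add: v_star_u_v transfer_B)

lemma v_star_u_v_out: "\<nexists>n. m = B n \<Longrightarrow> star C v \<otimes> (u m \<otimes> v) = \<zero>"
  using pi_scale[of "\<lambda>z. 1" 0] by (simp add: v_star_u_v transfer_not_B CT_intros pi_one)

lemma v_star_v: "star C v \<otimes> v = \<one>"
  using v_star_u_v[of 0] transfer_one by (simp add: character_0[abs_def] pi_one)

lemma B_uminus: "B (- n) = - B n"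
  by (simp add: matrix_vector_mult_def vec_eq_iff sum_negf)

lemma u_v_star: "u n \<otimes> star C v = star C v \<otimes> u (B n)"
  using arg_cong[OF v_u[of "- n"], of "star C"] by (simp add: star_mult u_star B_uminus)

text \<open>
  The relations \<open>v u n = u (B n) v\<close> and its adjoint move all characters to the outside of a monomial.
\<close>

lemma v_pow_u: "v [^] k \<otimes> u n = u ((B ^^ k) n) \<otimes> v [^] (k::nat)"
proof (induction k arbitrary: n)
  case (Suc k)
  have "v [^] Suc k \<otimes> u n = v [^] k \<otimes> (u (B n) \<otimes> v)" by (simp add: pow_Suc mult_assoc v_u)
  also have "\<dots> = (u ((B ^^ k) (B n)) \<otimes> v [^] k) \<otimes> v" by (simp add: Suc mult_assoc[symmetric])
  finally show ?case by (simp add: pow_Suc mult_assoc funpow_swap1)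
qed (simp add: pow_0)

lemma u_v_star_pow: "u n \<otimes> star C v [^] k = star C v [^] (k::nat) \<otimes> u ((B ^^ k) n)"
proof (induction k arbitrary: n)
  case (Suc k)
  have "u n \<otimes> star C v [^] Suc k = star C v [^] k \<otimes> (u ((B ^^ k) n) \<otimes> star C v)"
    by (simp add: pow_Suc mult_assoc[symmetric] Suc)
  then show ?case by (simp add: u_v_star pow_Suc mult_assoc)
qed (simp add: pow_0)

lemma mono_alt: "mono m k l n = u m \<otimes> (v [^] k \<otimes> (star C v [^] l \<otimes> u (- n)))"
  by (simp add: mono_def mult_assoc u_star)

lemma mono_closed [simp]: "mono m k l n \<in> carrier C"
  by (simp add: mono_alt)

lemma mono_zero: "mono 0 0 0 0 = \<one>"
  by (simp add: mono_alt pow_0 u_zero)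

lemma u_mono: "u p \<otimes> mono m k l n = mono (p + m) k l n"
  by (simp add: mono_alt mult_assoc[symmetric] u_mult)

lemma v_mono: "v \<otimes> mono m k l n = mono (B m) (Suc k) l n"
proof -
  have "v \<otimes> mono m k l n = (v \<otimes> u m) \<otimes> (v [^] k \<otimes> (star C v [^] l \<otimes> u (- n)))"
    by (simp add: mono_alt mult_assoc)
  then show ?thesis by (simp add: v_u mono_alt mult_assoc pow_Suc v_pow_swap)
qed

lemma v_star_mono_Suc:
  "star C v \<otimes> mono (B m) (Suc k) l n = mono m k l n"
  "\<nexists>n. m' = B n \<Longrightarrow> star C v \<otimes> mono m' (Suc k) l n = \<zero>"
proof -
  have *: "star C v \<otimes> mono m (Suc k) l n =
    (star C v \<otimes> (u m \<otimes> v)) \<otimes> (v [^] k \<otimes> (star C v [^] l \<otimes> u (- n)))" for m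
    by (simp add: mono_alt mult_assoc pow_Suc v_pow_swap)
  show "star C v \<otimes> mono (B m) (Suc k) l n = mono m k l n"
    unfolding * v_star_u_v_in by (simp add: mono_alt)
  show "\<nexists>n. m' = B n \<Longrightarrow> star C v \<otimes> mono m' (Suc k) l n = \<zero>"
    unfolding * by (simp add: v_star_u_v_out)
qed

lemma mono_u: "mono m k l n \<otimes> u p = mono m k l (n - p)"
  by (simp add: mono_alt mult_assoc u_mult)

lemma mono_v_Suc:
  "mono m k (Suc l) (B n) \<otimes> v = mono m k l n"
  "\<nexists>n. n' = B n \<Longrightarrow> mono m k (Suc l) n' \<otimes> v = \<zero>"
proof -
  have *: "mono m k (Suc l) n \<otimes> v = u m \<otimes> (v [^] k \<otimes> (star C v [^] l \<otimes> (star C v \<otimes> (u (- n) \<otimes> v))))" for n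
    by (simp add: mono_alt mult_assoc pow_Suc)
  show "mono m k (Suc l) (B n) \<otimes> v = mono m k l n"
    unfolding * B_uminus[symmetric] v_star_u_v_in by (simp add: mono_alt)
  have "\<nexists>n. - n' = B n" if "\<nexists>n. n' = B n"
  proof
    assume "\<exists>n. - n' = B n"
    then obtain n where "- n' = B n" ..
    then have "n' = B (- n)" using equation_minus_iff[of n' "B n"] by (simp add: B_uminus)
    then show False using that by blast
  qed
  then show "\<nexists>n. n' = B n \<Longrightarrow> mono m k (Suc l) n' \<otimes> v = \<zero>"
    unfolding * by (simp add: v_star_u_v_out)
qed

lemma mono_v_0: "mono m k 0 n \<otimes> v = mono (m + (B ^^ k) (- n)) (Suc k) 0 0"
proof -
  have "mono m k 0 n \<otimes> v = u m \<otimes> ((v [^] k \<otimes> u (- n)) \<otimes> v)"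
    by (simp add: mono_alt mult_assoc pow_0)
  also have "\<dots> = (u m \<otimes> u ((B ^^ k) (- n))) \<otimes> (v [^] k \<otimes> v)"
    by (simp add: v_pow_u mult_assoc)
  finally show ?thesis by (simp add: u_mult mono_alt pow_0 pow_Suc u_zero)
qed

lemma star_v_pow: "star C (v [^] k) = star C v [^] (k::nat)"
  and star_v_star_pow: "star C (star C v [^] k) = v [^] (k::nat)"
  by (induction k) (simp_all add: pow_0 pow_Suc2 star_mult star_star, simp_all add: pow_Suc flip: pow_Suc2)

lemma star_mono: "star C (mono m k l n) = mono n l k m"
  by (simp add: mono_alt star_mult u_star star_v_pow star_v_star_pow mult_assoc)

text \<open>
  Inserting the frame decomposition of the unit moves \<open>star v\<close> past \<open>u m\<close>; this is what makes the
  span of the monomials invariant under multiplication by \<open>star v\<close>.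
\<close>

lemma frame_insert:
  assumes S: "closed_subspace S" and a: "a \<in> carrier C" and x: "x \<in> carrier C"
    and step: "\<And>s. s \<in> frame_box \<Longrightarrow> a \<otimes> (u s \<otimes> (v \<otimes> (star C v \<otimes> (star C (u s) \<otimes> x)))) \<in> S"
  shows "a \<otimes> x \<in> S"
proof -
  define pr where "pr s = (character s, \<lambda>z. frame_const * character s z)" for s :: "int ^ 'd"
  have "a \<otimes> (rank_image C \<psi> (map pr ss) \<otimes> x) \<in> S" if "set ss \<subseteq> frame_box" for ss
    using that
  proof (induction ss)
    case Nil
    then show ?case using S a x by (simp add: rank_image_def closed_subspace_def)
  next
    case (Cons s ss)
    have r: "rank_image C \<psi> (map pr ss) \<in> carrier C"
      by (rule rank_image_closed) (auto simp: pr_def intro!: psi_closed CT_intros)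
    have "\<psi> (\<lambda>z. frame_const * character s z) = frame_const \<odot> (u s \<otimes> v)"
      by (simp add: psi_scale psi_eq[of "character s"] CT_intros)
    then have "a \<otimes> (rank_image C \<psi> (map pr (s # ss)) \<otimes> x) =
      cnj frame_const \<odot> (a \<otimes> (u s \<otimes> (v \<otimes> (star C v \<otimes> (star C (u s) \<otimes> x))))) \<oplus>
      a \<otimes> (rank_image C \<psi> (map pr ss) \<otimes> x)"
      using r a x by (simp add: rank_image_def pr_def psi_eq[of "character s"] CT_intros star_smult star_mult
        distrib_left distrib_right smult_mult_left smult_mult_right mult_assoc star_closed)
    then show ?case using S Cons step[of s] by (simp add: closed_subspace_def)
  qed
  from this[of frame_list] show ?thesis
    using frame x by (simp add: frame_list frame_pairs_def pr_def[abs_def])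
qed

lemma monomials_closed: "monomials \<subseteq> carrier C"
  by (auto simp: monomials_def)

lemma monomialsE:
  assumes "x \<in> monomials" obtains m k l n where "x = mono m k l n"
  using assms by (auto simp: monomials_def)

lemma monomialsI: "mono m k l n \<in> monomials"
  by (auto simp: monomials_def)

lemma closed_subspace_monomials: "closed_subspace (closed_span monomials)"
  by (rule closed_subspace_span[OF monomials_closed])

lemma mono_in_span [simp]: "mono m k l n \<in> closed_span monomials"
  using closed_span_superset monomialsI by blast

lemma u_span: "x \<in> closed_span monomials \<Longrightarrow> u p \<otimes> x \<in> closed_span monomials"
  by (rule closed_span_left_mult[OF u_closed monomials_closed]) (auto elim!: monomialsE simp: u_mono)

lemma v_span: "x \<in> closed_span monomials \<Longrightarrow> v \<otimes> x \<in> closed_span monomials"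
  by (rule closed_span_left_mult[OF v_closed monomials_closed]) (auto elim!: monomialsE simp: v_mono)

lemma v_star_span: "x \<in> closed_span monomials \<Longrightarrow> star C v \<otimes> x \<in> closed_span monomials"
proof (rule closed_span_left_mult[OF v_star_closed monomials_closed])
  fix x assume "x \<in> monomials"
  then obtain m k l n where x: "x = mono m k l n" by (auto simp: monomials_def)
  have zero: "\<zero> \<in> closed_span monomials" using closed_subspace_monomials by (simp add: closed_subspace_def)
  show "star C v \<otimes> x \<in> closed_span monomials"
  proof (cases k)
    case (Suc k')
    then show ?thesis
      by (cases "\<exists>m'. m = B m'") (auto simp: x v_star_mono_Suc zero)
  next
    case 0
    have "(star C v \<otimes> u m) \<otimes> (star C v [^] l \<otimes> u (- n)) \<in> closed_span monomials"
    proof (rule frame_insert[OF closed_subspace_monomials])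
      fix s assume "s \<in> frame_box"
      have "star C v \<otimes> u m \<otimes> (u s \<otimes> (v \<otimes> (star C v \<otimes> (star C (u s) \<otimes> (star C v [^] l \<otimes> u (- n)))))) =
        (star C v \<otimes> ((u m \<otimes> u s) \<otimes> v)) \<otimes> (star C v \<otimes> ((u (- s) \<otimes> star C v [^] l) \<otimes> u (- n)))"
        by (simp add: mult_assoc u_star)
      also have "\<dots> = (star C v \<otimes> (u (m + s) \<otimes> v)) \<otimes> (star C v [^] Suc l \<otimes> u (- (n - (B ^^ l) (- s))))"
        by (simp add: u_mult u_v_star_pow mult_assoc pow_Suc v_star_pow_swap)
      also have "\<dots> \<in> closed_span monomials"
      proof (cases "\<exists>y. m + s = B y")
        case True
        then obtain y where "m + s = B y" ..
        then have "(star C v \<otimes> (u (m + s) \<otimes> v)) \<otimes> (star C v [^] Suc l \<otimes> u (- (n - (B ^^ l) (- s)))) =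
          mono y 0 (Suc l) (n - (B ^^ l) (- s))"
          by (simp add: v_star_u_v_in mono_alt pow_0)
        then show ?thesis by simp
      qed (simp add: v_star_u_v_out zero)
      finally show "star C v \<otimes> u m \<otimes> (u s \<otimes> (v \<otimes> (star C v \<otimes> (star C (u s) \<otimes> (star C v [^] l \<otimes> u (- n)))))) \<in> closed_span monomials" .
    qed simp_all
    then show ?thesis by (simp add: x 0 mono_alt pow_0 mult_assoc)
  qed
qed

text \<open>
  Trigonometric polynomials preserve the span; they approximate \<open>f\<close> uniformly and \<open>\<pi>\<close> is contractive.
\<close>

lemma pi_span:
  assumes f: "f \<in> CT" and x: "x \<in> closed_span monomials"
  shows "\<pi> f \<otimes> x \<in> closed_span monomials"
proof -
  have xc: "x \<in> carrier C" using x closed_subspace_monomials by (auto simp: closed_subspace_def)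
  have trig: "\<pi> g \<otimes> x \<in> closed_span monomials" if "g \<in> trig_polys" for g
    using that
  proof induction
    case (scale c m)
    have "\<pi> (\<lambda>z. c * character m z) \<otimes> x = c \<odot> (u m \<otimes> x)"
      using xc by (simp add: pi_scale CT_intros smult_mult_left)
    then show ?case using closed_subspace_monomials u_span[OF x] by (simp add: closed_subspace_def)
  next
    case (add f g)
    then have "\<pi> (\<lambda>z. f z + g z) \<otimes> x = \<pi> f \<otimes> x \<oplus> \<pi> g \<otimes> x"
      using xc by (simp add: pi_add pi_closed distrib_right trig_polys_CT)
    then show ?case using add closed_subspace_monomials by (simp add: closed_subspace_def)
  qed
  have "\<exists>g. g \<in> trig_polys \<and> (\<forall>z. cmod (f z - g z) < 1 / Suc n)" for n
    using trig_polys_dense[OF f, of "1 / Suc n"] by (metis of_nat_0_less_iff zero_less_Suc zero_less_divide_1_iff)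
  then obtain g where g: "\<And>n. g n \<in> trig_polys" "\<And>n z. cmod (f z - g n z) < 1 / Suc n" by metis
  have gCT: "g n \<in> CT" for n using g trig_polys_CT by blast
  have le: "nrm C (\<pi> (g n) \<ominus> \<pi> f) \<le> inverse (real (Suc n))" for n
  proof -
    have "\<pi> (g n) \<ominus> \<pi> f = \<pi> (\<lambda>z. g n z + (-1) * f z)"
      using f gCT CT_intros(4)[OF CT_intros(1)[of "-1"] f] by (simp only: pi_add pi_scale minus_scale pi_closed)
    also have "nrm C \<dots> \<le> sup_norm (\<lambda>z. g n z + (-1) * f z)"
      using f gCT by (intro nrm_pi CT_intros)
    also have "\<dots> \<le> inverse (real (Suc n))"
      by (rule sup_norm_least)
        (use g(2)[of _ n] in \<open>simp add: norm_minus_commute inverse_eq_divide less_imp_le\<close>)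
    finally show ?thesis .
  qed
  have "converges C (\<lambda>n. \<pi> (g n)) (\<pi> f)"
    unfolding converges_def
    by (rule tendsto_sandwich[OF _ _ tendsto_const LIMSEQ_inverse_real_of_nat])
      (use le nrm_nonneg pi_closed f gCT in auto)
  then have "converges C (\<lambda>n. \<pi> (g n) \<otimes> x) (\<pi> f \<otimes> x)"
    by (intro converges_mult_right pi_closed xc f gCT)
  then show ?thesis
    by (rule closed_subspace_limit[OF closed_subspace_monomials, rotated 2])
      (use trig g xc f pi_closed in auto)
qed

lemma generators_preserve_span:
  assumes x: "x \<in> closed_span monomials" and f: "f \<in> CT"
  shows "\<pi> f \<otimes> x \<in> closed_span monomials" "star C (\<pi> f) \<otimes> x \<in> closed_span monomials"
    "\<psi> f \<otimes> x \<in> closed_span monomials" "star C (\<psi> f) \<otimes> x \<in> closed_span monomials"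
proof -
  have xc: "x \<in> carrier C" using x closed_subspace_monomials by (auto simp: closed_subspace_def)
  show "\<pi> f \<otimes> x \<in> closed_span monomials" by (rule pi_span[OF f x])
  have star: "star C (\<pi> f) \<otimes> x \<in> closed_span monomials" if "x \<in> closed_span monomials" for x
    using pi_span[OF CT_intros(5)[OF f] that] pi_star[OF f] by simp
  show "star C (\<pi> f) \<otimes> x \<in> closed_span monomials" by (rule star[OF x])
  have "\<psi> f \<otimes> x = \<pi> f \<otimes> (v \<otimes> x)" using xc f by (simp add: psi_eq[of f] pi_closed mult_assoc)
  then show "\<psi> f \<otimes> x \<in> closed_span monomials" using pi_span[OF f v_span[OF x]] by simp
  have "star C (\<psi> f) \<otimes> x = star C v \<otimes> (star C (\<pi> f) \<otimes> x)"
    using xc f by (simp add: psi_eq[of f] pi_closed mult_assoc star_mult star_closed)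
  then show "star C (\<psi> f) \<otimes> x \<in> closed_span monomials" using v_star_span[OF star[OF x]] by simp
qed

end

section \<open>KMS states\<close>

context cstar_algebra
begin

lemma stateD:
  assumes "state C \<phi>"
  shows state_add: "x \<in> carrier C \<Longrightarrow> y \<in> carrier C \<Longrightarrow> \<phi> (x \<oplus> y) = \<phi> x + \<phi> y"
    and state_scale: "x \<in> carrier C \<Longrightarrow> \<phi> (c \<odot> x) = c * \<phi> x"
    and state_one: "\<phi> \<one> = 1"
    and state_zero: "\<phi> \<zero> = 0"
    and state_minus: "x \<in> carrier C \<Longrightarrow> y \<in> carrier C \<Longrightarrow> \<phi> (x \<ominus> y) = \<phi> x - \<phi> y"
proof -
  show add: "\<phi> (x \<oplus> y) = \<phi> x + \<phi> y" if "x \<in> carrier C" "y \<in> carrier C" for x y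
    using assms that by (auto simp: state_def)
  show scale: "\<phi> (c \<odot> x) = c * \<phi> x" if "x \<in> carrier C" for x c
    using assms that by (auto simp: state_def)
  show "\<phi> \<one> = 1" using assms by (auto simp: state_def)
  show "\<phi> \<zero> = 0" using scale[of \<zero> 0] by simp
  show "\<phi> (x \<ominus> y) = \<phi> x - \<phi> y" if "x \<in> carrier C" "y \<in> carrier C" for x y
    using that by (simp add: minus_scale add scale)
qed

lemma state_continuous:
  assumes "state C \<phi>" "\<And>n. s n \<in> carrier C" "x \<in> carrier C" "converges C s x"
  shows "(\<lambda>n. \<phi> (s n)) \<longlonglongrightarrow> \<phi> x"
proof -
  have "(\<lambda>n. 2 * nrm C (s n \<ominus> x)) \<longlonglongrightarrow> 0"
    using assms(4) by (simp add: converges_def tendsto_mult_right_zero)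
  then have "(\<lambda>n. \<phi> (s n) - \<phi> x) \<longlonglongrightarrow> 0"
    by (rule Lim_null_comparison[rotated])
      (use assms state_bounded[OF assms(1), of "s _ \<ominus> x"] in \<open>auto simp: state_minus\<close>)
  then show ?thesis by (simp add: LIM_zero_iff)
qed

text \<open>
  Two functionals that depend linearly and continuously on their argument agree on a closed span
  as soon as they agree on the spanning set.
\<close>

lemma states_agree_on_span:
  assumes \<phi>: "state C \<phi>" and \<phi>': "state C \<phi>'" and M: "M \<subseteq> carrier C"
    and T: "\<And>x. x \<in> carrier C \<Longrightarrow> T x \<in> carrier C"
      "\<And>x y. x \<in> carrier C \<Longrightarrow> y \<in> carrier C \<Longrightarrow> T (x \<oplus> y) = T x \<oplus> T y"
      "\<And>c x. x \<in> carrier C \<Longrightarrow> T (c \<odot> x) = c \<odot> T x"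
      "\<And>s x. (\<And>n. s n \<in> carrier C) \<Longrightarrow> x \<in> carrier C \<Longrightarrow> converges C s x \<Longrightarrow> converges C (\<lambda>n. T (s n)) (T x)"
    and S: "\<And>x. x \<in> carrier C \<Longrightarrow> S x \<in> carrier C"
      "\<And>x y. x \<in> carrier C \<Longrightarrow> y \<in> carrier C \<Longrightarrow> S (x \<oplus> y) = S x \<oplus> S y"
      "\<And>c x. x \<in> carrier C \<Longrightarrow> S (c \<odot> x) = c \<odot> S x"
      "\<And>s x. (\<And>n. s n \<in> carrier C) \<Longrightarrow> x \<in> carrier C \<Longrightarrow> converges C s x \<Longrightarrow> converges C (\<lambda>n. S (s n)) (S x)"
    and eq: "\<And>x. x \<in> M \<Longrightarrow> \<phi> (T x) = r * \<phi>' (S x)"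
    and x: "x \<in> closed_span M"
  shows "\<phi> (T x) = r * \<phi>' (S x)"
proof -
  let ?E = "{x \<in> carrier C. \<phi> (T x) = r * \<phi>' (S x)}"
  have "closed_subspace ?E"
    unfolding closed_subspace_def
  proof (intro conjI ballI allI impI)
    show "\<zero> \<in> ?E" using T(3)[of \<zero> 0] S(3)[of \<zero> 0] T(1)[of \<zero>] S(1)[of \<zero>] \<phi> \<phi>'
      by (simp add: state_zero)
    fix s x assume s: "\<forall>n. s n \<in> ?E" and x: "x \<in> carrier C" "converges C s x"
    have sc: "s n \<in> carrier C" for n using s by blast
    have 1: "(\<lambda>n. \<phi> (T (s n))) \<longlonglongrightarrow> \<phi> (T x)"
      by (rule state_continuous[OF \<phi> T(1)[OF sc] T(1)[OF x(1)] T(4)[OF sc x]])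
    have "(\<lambda>n. r * \<phi>' (S (s n))) \<longlonglongrightarrow> r * \<phi>' (S x)"
      by (intro tendsto_mult_left state_continuous[OF \<phi>' S(1)[OF sc] S(1)[OF x(1)] S(4)[OF sc x]])
    then show "x \<in> ?E" using LIMSEQ_unique[OF 1] s x(1) by simp
  qed (use T S \<phi> \<phi>' in \<open>auto simp: state_add state_scale algebra_simps\<close>)
  then have "closed_span M \<subseteq> ?E" by (rule closed_span_least) (use M eq in auto)
  then show ?thesis using x by auto
qed

end

locale torus_dynamics = torus_rep A N C \<psi> \<pi>
  for A :: "int ^ 'd ^ ('d :: finite)" and N :: nat
    and C :: "('c, 'm) cstar_scheme" (structure)
    and \<psi> :: "('d torus \<Rightarrow> complex) \<Rightarrow> 'c"
    and \<pi> :: "('d torus \<Rightarrow> complex) \<Rightarrow> 'c" +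
  fixes \<sigma> :: "real \<Rightarrow> 'c \<Rightarrow> 'c"
  assumes dynamics: "dynamics C \<sigma>"
    and sigma_u: "\<sigma> t (u m) = u m"
    and sigma_v: "\<sigma> t v = cis t \<odot> v"
    and spanned: "carrier C = closed_span monomials"
begin

lemma sigma_hom: "\<sigma> t \<in> star_hom C C"
  using dynamics by (auto simp: dynamics_def star_aut_def)

lemma sigma_closed [simp]: "x \<in> carrier C \<Longrightarrow> \<sigma> t x \<in> carrier C"
  and sigma_mult: "x \<in> carrier C \<Longrightarrow> y \<in> carrier C \<Longrightarrow> \<sigma> t (x \<otimes> y) = \<sigma> t x \<otimes> \<sigma> t y"
  and sigma_add: "x \<in> carrier C \<Longrightarrow> y \<in> carrier C \<Longrightarrow> \<sigma> t (x \<oplus> y) = \<sigma> t x \<oplus> \<sigma> t y"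
  and sigma_one: "\<sigma> t \<one> = \<one>"
  and sigma_scale: "x \<in> carrier C \<Longrightarrow> \<sigma> t (c \<odot> x) = c \<odot> \<sigma> t x"
  and sigma_star: "x \<in> carrier C \<Longrightarrow> \<sigma> t (star C x) = star C (\<sigma> t x)"
  using sigma_hom[of t] by (auto simp: star_hom_def ring_hom_def)

definition homogeneous :: "int \<Rightarrow> 'c \<Rightarrow> bool" where
  "homogeneous j x \<longleftrightarrow> x \<in> carrier C \<and> (\<forall>t. \<sigma> t x = cis (j * t) \<odot> x)"

lemma homogeneous_mult: "homogeneous i x \<Longrightarrow> homogeneous j y \<Longrightarrow> homogeneous (i + j) (x \<otimes> y)"
  by (auto simp: homogeneous_def sigma_mult smult_mult_left smult_mult_right scale_scale cis_mult
      algebra_simps)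

lemma homogeneous_u: "homogeneous 0 (u m)"
  by (simp add: homogeneous_def sigma_u)

lemma homogeneous_v: "homogeneous 1 v"
  by (simp add: homogeneous_def sigma_v)

lemma homogeneous_v_star: "homogeneous (-1) (star C v)"
  by (simp add: homogeneous_def sigma_star sigma_v star_smult cis_cnj)

lemma homogeneous_one: "homogeneous 0 \<one>"
  by (simp add: homogeneous_def sigma_one)

lemma homogeneous_pow: "homogeneous j x \<Longrightarrow> homogeneous (j * k) (x [^] (k::nat))"
proof (induction k)
  case (Suc k)
  then show ?case using homogeneous_mult[of "j * k" "x [^] k" j x] by (simp add: pow_Suc algebra_simps)
qed (simp add: pow_0 homogeneous_one)

lemma homogeneous_mono: "homogeneous (int k - int l) (mono m k l n)"
proof -
  have "homogeneous (0 + (1 * int k + (-1 * int l + 0))) (u m \<otimes> (v [^] k \<otimes> (star C v [^] l \<otimes> u (- n))))"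
    by (intro homogeneous_mult homogeneous_u homogeneous_pow homogeneous_v homogeneous_v_star)
  then show ?thesis by (simp add: mono_alt)
qed

lemma homogeneous_extension:
  assumes "homogeneous j x"
  shows "analytic_extension C \<sigma> x (\<lambda>z. exp (\<i> * j * z) \<odot> x)"
proof -
  have x: "x \<in> carrier C" using assms by (simp add: homogeneous_def)
  have "((\<lambda>h. nrm C ((1 / h) \<odot> (exp (\<i> * j * (z + h)) \<odot> x \<ominus> exp (\<i> * j * z) \<odot> x) \<ominus>
      (\<i> * j * exp (\<i> * j * z)) \<odot> x)) \<longlongrightarrow> 0) (at 0)" for z
  proof -
    have "((\<lambda>z. exp (\<i> * j * z)) has_field_derivative (\<i> * j * exp (\<i> * j * z))) (at z)"
      by (auto intro!: derivative_eq_intros)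
    then have "((\<lambda>h. (exp (\<i> * j * (z + h)) - exp (\<i> * j * z)) / h) \<longlongrightarrow> \<i> * j * exp (\<i> * j * z)) (at 0)"
      by (simp add: DERIV_def)
    then have "((\<lambda>h. cmod ((exp (\<i> * j * (z + h)) - exp (\<i> * j * z)) / h - \<i> * j * exp (\<i> * j * z)) * nrm C x) \<longlongrightarrow> 0) (at 0)"
      by (intro tendsto_mult_left_zero tendsto_norm_zero) (simp add: LIM_zero_iff)
    moreover have "(1 / h) \<odot> (a \<odot> x \<ominus> b \<odot> x) \<ominus> c \<odot> x = ((a - b) / h - c) \<odot> x" for a b c h
    proof -
      have e: "(a - b) / h - c = (1 / h) * a + ((1 / h) * (- 1 * b) + - 1 * c)"
        by (simp add: diff_divide_distrib)
      show ?thesis unfolding e using x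
        by (simp only: minus_scale scale_scale scale_add_left scale_add_right scale_closed) (simp add: minus_scale scale_scale add_assoc)
    qed
    ultimately show ?thesis using x by (simp add: nrm_smult)
  qed
  then have "entire C (\<lambda>z. exp (\<i> * j * z) \<odot> x)"
    unfolding entire_def using x by (intro conjI allI bexI[of _ "(\<i> * j * exp (\<i> * j * _)) \<odot> x"]) auto
  then show ?thesis
    using assms by (auto simp: analytic_extension_def homogeneous_def cis_conv_exp mult_ac)
qed

lemma homogeneous_analytic: "homogeneous j x \<Longrightarrow> analytic_elem C \<sigma> x"
  unfolding analytic_elem_def using homogeneous_extension by (auto simp: homogeneous_def)

lemma state_eqI:
  assumes "state C \<phi>" "state C \<phi>'" "\<And>m k l n. \<phi> (mono m k l n) = \<phi>' (mono m k l n)" "x \<in> carrier C"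
  shows "\<phi> x = \<phi>' x"
proof -
  have "\<phi> x = 1 * \<phi>' x"
    by (rule states_agree_on_span[OF assms(1,2) monomials_closed, where T="\<lambda>x. x" and S="\<lambda>x. x"])
      (use assms in \<open>auto simp: spanned[symmetric] elim!: monomialsE\<close>)
  then show ?thesis by simp
qed

subsection \<open>Existence\<close>

definition is_trace_state :: "('c \<Rightarrow> complex) \<Rightarrow> bool" where
  "is_trace_state \<phi> \<longleftrightarrow> state C \<phi> \<and>
     (\<forall>m k l n. \<phi> (mono m k l n) = (if k = l \<and> m = n then 1 / of_nat N ^ k else 0))"

context
  fixes \<phi> :: "'c \<Rightarrow> complex"
  assumes \<phi>: "is_trace_state \<phi>"
begin

lemma trace_state: "state C \<phi>"
  and trace_mono: "\<phi> (mono m k l n) = (if k = l \<and> m = n then 1 / of_nat N ^ k else 0)"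
  using \<phi> by (auto simp: is_trace_state_def)

lemma trace_invariant: assumes "x \<in> carrier C" shows "\<phi> (\<sigma> t x) = \<phi> x"
proof -
  have "state C (\<lambda>x. \<phi> (\<sigma> t x))"
    unfolding state_def
  proof (intro conjI ballI allI)
    fix x y assume x: "x \<in> carrier C"
    show "\<phi> (\<sigma> t (c \<odot> x)) = c * \<phi> (\<sigma> t x)" for c
      using x trace_state by (simp add: sigma_scale state_scale)
    show "\<phi> (\<sigma> t (star C x \<otimes> x)) \<in> \<real>\<^sub>\<ge>\<^sub>0"
      using trace_state x by (simp add: state_def sigma_mult sigma_star star_closed)
    assume "y \<in> carrier C"
    then show "\<phi> (\<sigma> t (x \<oplus> y)) = \<phi> (\<sigma> t x) + \<phi> (\<sigma> t y)"
      using x trace_state by (simp add: sigma_add state_add)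
  qed (use trace_state in \<open>simp add: sigma_one state_one\<close>)
  moreover have "\<phi> (\<sigma> t (mono m k l n)) = \<phi> (mono m k l n)" for m k l n
    using homogeneous_mono[of k l m n] state_scale[OF trace_state, of "mono m k l n"]
    by (auto simp: homogeneous_def trace_mono)
  ultimately show ?thesis using state_eqI[OF _ trace_state] assms by blast
qed

definition twisted_trace :: "int \<Rightarrow> 'c \<Rightarrow> bool" where
  "twisted_trace j c \<longleftrightarrow> c \<in> carrier C \<and> (\<forall>d\<in>carrier C. \<phi> (d \<otimes> c) = of_nat N powi j * \<phi> (c \<otimes> d))"

lemma twisted_traceI:
  assumes c: "c \<in> carrier C" and eq: "\<And>m k l n. \<phi> (mono m k l n \<otimes> c) = of_nat N powi j * \<phi> (c \<otimes> mono m k l n)"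
  shows "twisted_trace j c"
  unfolding twisted_trace_def
proof (intro conjI ballI c)
  fix d assume d: "d \<in> carrier C"
  show "\<phi> (d \<otimes> c) = of_nat N powi j * \<phi> (c \<otimes> d)"
    by (rule states_agree_on_span[OF trace_state trace_state monomials_closed,
        where T="\<lambda>d. d \<otimes> c" and S="\<lambda>d. c \<otimes> d"])
      (use c d eq in \<open>auto simp: spanned[symmetric] distrib_left distrib_right smult_mult_left smult_mult_right
        converges_mult_left converges_mult_right elim!: monomialsE\<close>)
qed

lemma twisted_trace_mult:
  assumes "twisted_trace i a" "twisted_trace j b"
  shows "twisted_trace (i + j) (a \<otimes> b)"
  unfolding twisted_trace_def
proof (intro conjI ballI)
  have c: "a \<in> carrier C" "b \<in> carrier C" using assms by (auto simp: twisted_trace_def)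
  then show "a \<otimes> b \<in> carrier C" by simp
  fix d assume d: "d \<in> carrier C"
  have "\<phi> (d \<otimes> (a \<otimes> b)) = \<phi> ((d \<otimes> a) \<otimes> b)" using c d by (simp add: mult_assoc)
  also have "\<dots> = of_nat N powi j * \<phi> (b \<otimes> (d \<otimes> a))"
    using assms(2) c d unfolding twisted_trace_def by simp
  also have "\<phi> (b \<otimes> (d \<otimes> a)) = \<phi> ((b \<otimes> d) \<otimes> a)" using c d by (simp add: mult_assoc)
  also have "\<dots> = of_nat N powi i * \<phi> (a \<otimes> (b \<otimes> d))"
    using assms(1) c d unfolding twisted_trace_def by simp
  finally show "\<phi> (d \<otimes> (a \<otimes> b)) = of_nat N powi (i + j) * \<phi> (a \<otimes> b \<otimes> d)"
    using c d N_nonzero by (simp add: mult_assoc power_int_add)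
qed

text \<open>
  The formula for \<open>\<phi>\<close> is symmetric under exchanging \<open>(m, k)\<close> and \<open>(n, l)\<close>, which is the adjoint on
  monomials.
\<close>

lemma state_star: "x \<in> carrier C \<Longrightarrow> \<phi> (star C x) = cnj (\<phi> x)"
proof -
  assume "x \<in> carrier C"
  then have "x \<in> closed_span monomials" by (simp add: spanned)
  moreover have "closed_subspace {x \<in> carrier C. \<phi> (star C x) = cnj (\<phi> x)}"
    unfolding closed_subspace_def
  proof (intro conjI ballI allI impI)
    fix s x assume s: "\<forall>n. s n \<in> {x \<in> carrier C. \<phi> (star C x) = cnj (\<phi> x)}"
      and x: "x \<in> carrier C" "converges C s x"
    have "(\<lambda>n. \<phi> (star C (s n))) \<longlonglongrightarrow> \<phi> (star C x)"
      by (rule state_continuous[OF trace_state]) (use s x star_closed converges_star in auto)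
    moreover have "(\<lambda>n. cnj (\<phi> (s n))) \<longlonglongrightarrow> cnj (\<phi> x)"
      using state_continuous[OF trace_state _ x] s by (intro tendsto_cnj) auto
    ultimately show "x \<in> {x \<in> carrier C. \<phi> (star C x) = cnj (\<phi> x)}"
      using s x LIMSEQ_unique by auto
  qed (use trace_state in \<open>auto simp: state_zero state_add state_scale star_add star_smult star_closed\<close>)
  moreover have "monomials \<subseteq> {x \<in> carrier C. \<phi> (star C x) = cnj (\<phi> x)}"
    by (auto elim!: monomialsE simp: star_mono trace_mono)
  ultimately show ?thesis using closed_span_least by blast
qed

lemma twisted_trace_u: "twisted_trace 0 (u p)"
  by (rule twisted_traceI) (auto simp: mono_u u_mono trace_mono algebra_simps)

text \<open>
  Both sides vanish unless \<open>l = k + 1\<close> and \<open>n = B m\<close>; in that case \<open>v\<close> cancels one factor \<open>v*\<close> on the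
  left-hand side and adds a factor \<open>v\<close> on the right-hand side, so the values are \<open>N\<^sup>-\<^sup>k\<close> and
  \<open>N\<^sup>-\<^sup>l\<close>.
\<close>

lemma twisted_trace_v: "twisted_trace 1 v"
proof (rule twisted_traceI)
  fix m k l n
  show "\<phi> (mono m k l n \<otimes> v) = of_nat N powi 1 * \<phi> (v \<otimes> mono m k l n)"
  proof (cases l)
    case 0
    then show ?thesis by (simp add: mono_v_0 v_mono trace_mono)
  next
    case (Suc l')
    show ?thesis
    proof (cases "\<exists>q. n = B q")
      case True
      then show ?thesis using Suc N_nonzero by (auto simp: mono_v_Suc v_mono trace_mono B_inj_iff)
    next
      case False
      then show ?thesis using Suc state_zero[OF trace_state] by (auto simp: mono_v_Suc v_mono trace_mono)
    qed
  qed
qed simp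

lemma twisted_trace_v_star: "twisted_trace (-1) (star C v)"
  unfolding twisted_trace_def
proof (intro conjI ballI)
  fix d assume d: "d \<in> carrier C"
  have "\<phi> (d \<otimes> star C v) = cnj (\<phi> (v \<otimes> star C d))"
    using d state_star[of "v \<otimes> star C d"] by (simp add: star_mult star_star star_closed)
  also have "\<phi> (v \<otimes> star C d) = \<phi> (star C d \<otimes> v) / of_nat N"
    using twisted_trace_v d N_nonzero by (auto simp: twisted_trace_def star_closed)
  also have "cnj \<dots> = \<phi> (star C v \<otimes> d) / of_nat N"
    using d state_star[of "star C d \<otimes> v"] by (simp add: star_mult star_star star_closed)
  finally show "\<phi> (d \<otimes> star C v) = of_nat N powi (- 1) * \<phi> (star C v \<otimes> d)"
    by (simp add: power_int_minus field_simps)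
qed simp

lemma twisted_trace_pow: "twisted_trace j x \<Longrightarrow> twisted_trace (j * k) (x [^] (k::nat))"
proof (induction k)
  case 0 show ?case using twisted_trace_u[of 0] by (simp add: pow_0 u_zero)
next
  case (Suc k)
  then show ?case using twisted_trace_mult[of "j * k" "x [^] k" j x] by (simp add: pow_Suc algebra_simps)
qed

lemma twisted_trace_mono: "twisted_trace (int k - int l) (mono m k l n)"
proof -
  have "twisted_trace (0 + (1 * int k + (-1 * int l + 0))) (u m \<otimes> (v [^] k \<otimes> (star C v [^] l \<otimes> u (- n))))"
    by (intro twisted_trace_mult twisted_trace_u twisted_trace_pow twisted_trace_v twisted_trace_v_star)
  then show ?thesis by (simp add: mono_alt)
qed

text \<open>
  For \<open>c\<close> homogeneous of degree \<open>j\<close>, invariance of \<open>\<phi>\<close> gives \<open>\<phi> (c (\<sigma>\<^sub>t d)) = e\<^sup>-\<^sup>i\<^sup>j\<^sup>t \<phi> (c d)\<close>.  Both sides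
  are restrictions of entire functions of \<open>t\<close>, so they agree at \<open>t = \<i> log N\<close>, where the right-hand side
  is \<open>N\<^sup>j \<phi> (c d) = \<phi> (d c)\<close>.  For \<open>N = 1\<close> the claim is that \<open>\<phi>\<close> is an invariant trace.
\<close>

lemma trace_KMS: "KMS C \<sigma> (ln (real N)) \<phi>"
proof (cases "N = 1")
  case True
  have "\<phi> (x \<otimes> y) = \<phi> (y \<otimes> x)" if x: "x \<in> carrier C" and y: "y \<in> carrier C" for x y
  proof -
    have "\<phi> (x \<otimes> y) = 1 * \<phi> (y \<otimes> x)"
    proof (rule states_agree_on_span[OF trace_state trace_state monomials_closed,
        where T="\<lambda>y. x \<otimes> y" and S="\<lambda>y. y \<otimes> x"])
      fix y assume "y \<in> monomials"
      then obtain m k l n where y: "y = mono m k l n" by (rule monomialsE)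
      have "of_nat N = (1 :: complex)" using True by simp
      then show "\<phi> (x \<otimes> y) = 1 * \<phi> (y \<otimes> x)"
        using twisted_trace_mono[of k l m n] x unfolding twisted_trace_def by (simp add: y)
    qed (use x y in \<open>simp_all add: spanned[symmetric] distrib_left distrib_right smult_mult_left smult_mult_right
        converges_mult_left converges_mult_right\<close>)
    then show ?thesis by simp
  qed
  then show ?thesis using True trace_state trace_invariant by (simp add: KMS_def)
next
  case False
  then have N1: "N > 1" using N_nonzero by linarith
  let ?\<beta> = "ln (real N)"
  have "\<phi> (d \<otimes> c) = \<phi> (c \<otimes> g (\<i> * of_real ?\<beta>))"
    if c: "c \<in> carrier C" and d: "d \<in> carrier C" and g: "analytic_extension C \<sigma> d g" for c d g
  proof -
    have gc: "g z \<in> carrier C" for z using g by (auto simp: analytic_extension_def entire_def)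
    have "\<phi> (d \<otimes> c) = 1 * \<phi> (c \<otimes> g (\<i> * of_real ?\<beta>))"
    proof (rule states_agree_on_span[OF trace_state trace_state monomials_closed,
        where T="\<lambda>c. d \<otimes> c" and S="\<lambda>c. c \<otimes> g (\<i> * of_real ?\<beta>)"])
      fix c assume "c \<in> monomials"
      then obtain m k l n where "c = mono m k l n" by (rule monomialsE)
      then obtain j where j: "homogeneous j c" "twisted_trace j c"
        using homogeneous_mono twisted_trace_mono by metis
      then have cc: "c \<in> carrier C" by (simp add: homogeneous_def)
      define F where "F z = \<phi> (c \<otimes> g z) - exp (- (\<i> * j * z)) * \<phi> (c \<otimes> d)" for z
      have deriv: "\<exists>D. ((\<lambda>z. \<phi> (c \<otimes> g z)) has_field_derivative D) (at z)" for z
      proof -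
        obtain D where D: "D \<in> carrier C"
          and lim: "((\<lambda>h. nrm C ((1 / h) \<odot> (g (z + h) \<ominus> g z) \<ominus> D)) \<longlongrightarrow> 0) (at 0)"
          using g unfolding analytic_extension_def entire_def by blast
        have bound: "cmod ((\<phi> (c \<otimes> g (z + h)) - \<phi> (c \<otimes> g z)) / h - \<phi> (c \<otimes> D)) \<le>
            2 * nrm C c * nrm C ((1 / h) \<odot> (g (z + h) \<ominus> g z) \<ominus> D)" for h
        proof -
          let ?y = "(1 / h) \<odot> (g (z + h) \<ominus> g z) \<ominus> D"
          have y: "?y \<in> carrier C" using gc D by simp
          have "c \<otimes> ?y = (1 / h) \<odot> (c \<otimes> g (z + h) \<ominus> c \<otimes> g z) \<ominus> c \<otimes> D"
            using gc D cc by (simp add: minus_scale distrib_left smult_mult_right)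
          then have "(\<phi> (c \<otimes> g (z + h)) - \<phi> (c \<otimes> g z)) / h - \<phi> (c \<otimes> D) = \<phi> (c \<otimes> ?y)"
            using gc D cc trace_state by (simp add: state_minus state_scale)
          also have "cmod \<dots> \<le> 2 * nrm C (c \<otimes> ?y)" using state_bounded[OF trace_state] cc y by simp
          also have "\<dots> \<le> 2 * (nrm C c * nrm C ?y)" using nrm_mult[OF cc y] by simp
          finally show ?thesis by (simp add: mult.assoc)
        qed
        have "((\<lambda>h. 2 * nrm C c * nrm C ((1 / h) \<odot> (g (z + h) \<ominus> g z) \<ominus> D)) \<longlongrightarrow> 0) (at 0)"
          by (rule tendsto_mult_right_zero[OF lim])
        then have "((\<lambda>h. (\<phi> (c \<otimes> g (z + h)) - \<phi> (c \<otimes> g z)) / h - \<phi> (c \<otimes> D)) \<longlongrightarrow> 0) (at 0)"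
          by (rule Lim_null_comparison[rotated]) (use bound in auto)
        then show ?thesis by (auto simp: DERIV_def LIM_zero_iff)
      qed
      have "(\<lambda>z. \<phi> (c \<otimes> g z)) holomorphic_on UNIV"
        using deriv by (simp add: holomorphic_on_open)
      then have hol: "F holomorphic_on UNIV"
        unfolding F_def by (rule holomorphic_on_diff) (auto intro!: holomorphic_intros)
      have zero: "F z = 0" if "z \<in> \<real>" for z
      proof -
        from that obtain t where t: "z = of_real t" by (rule Reals_cases)
        have "\<sigma> t (cis (- (j * t)) \<odot> c) = c"
          using j(1) cc by (simp add: homogeneous_def sigma_scale scale_scale cis_mult)
        then have "\<phi> (c \<otimes> g z) = \<phi> (\<sigma> t (cis (- (j * t)) \<odot> c) \<otimes> \<sigma> t d)"
          using g by (simp add: analytic_extension_def t)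
        also have "\<phi> (\<sigma> t (cis (- (j * t)) \<odot> c) \<otimes> \<sigma> t d) = \<phi> (\<sigma> t ((cis (- (j * t)) \<odot> c) \<otimes> d))"
          using cc d by (simp add: sigma_mult)
        also have "\<dots> = cis (- (j * t)) * \<phi> (c \<otimes> d)"
          using cc d trace_state by (simp add: trace_invariant smult_mult_left state_scale)
        finally show ?thesis by (simp add: F_def t cis_conv_exp mult_ac)
      qed
      have limit: "(0::complex) islimpt \<real>"
      proof (rule islimpt_approachable[THEN iffD2], intro allI impI)
        fix e :: real assume "e > 0"
        then show "\<exists>x'\<in>\<real>. x' \<noteq> 0 \<and> dist x' (0::complex) < e"
          by (intro bexI[of _ "of_real (e / 2)"]) auto
      qed
      have "F (\<i> * of_real ?\<beta>) = 0"
        by (rule analytic_continuation[OF hol open_UNIV connected_UNIV subset_UNIV UNIV_I limit zero UNIV_I])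
      moreover have "exp (- (\<i> * of_int j * (\<i> * of_real ?\<beta>))) = (of_nat N powi j :: complex)"
      proof -
        have "- (\<i> * of_int j * (\<i> * of_real ?\<beta>)) = complex_of_real (of_int j * ?\<beta>)"
          by (simp add: complex_eq_iff)
        also have "exp \<dots> = of_real (exp (of_int j * ?\<beta>))" by (rule exp_of_real)
        also have "exp (of_int j * ?\<beta>) = real N powi j"
          using N1 exp_power_int[of ?\<beta> j] by simp
        finally show ?thesis by simp
      qed
      ultimately show "\<phi> (d \<otimes> c) = 1 * \<phi> (c \<otimes> g (\<i> * of_real ?\<beta>))"
        using j(2) d by (simp add: F_def twisted_trace_def)
    qed (use c d gc in \<open>simp_all add: spanned[symmetric] distrib_left distrib_right smult_mult_left smult_mult_right
        converges_mult_left converges_mult_right\<close>)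
    then show ?thesis by simp
  qed
  then show ?thesis using N1 trace_state by (auto simp: KMS_def analytic_elem_def)
qed

end

subsection \<open>Uniqueness\<close>

context
  fixes \<phi> \<beta>
  assumes kms: "KMS C \<sigma> \<beta> \<phi>" and \<beta>: "\<beta> \<ge> 0"
begin

lemma kms_state: "state C \<phi>"
  using kms by (simp add: KMS_def)

lemma kms_homogeneous:
  assumes "homogeneous i a" "homogeneous j b"
  shows "\<phi> (a \<otimes> b) = exp (- \<beta> * i) * \<phi> (b \<otimes> a)"
proof (cases "\<beta> = 0")
  case True
  then show ?thesis using kms assms by (auto simp: KMS_def homogeneous_def)
next
  case False
  have c: "a \<in> carrier C" "b \<in> carrier C" using assms by (auto simp: homogeneous_def)
  have "\<phi> (a \<otimes> b) = \<phi> (b \<otimes> (exp (\<i> * i * (\<i> * of_real \<beta>)) \<odot> a))"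
    using kms False homogeneous_extension[OF assms(1)] homogeneous_analytic assms by (auto simp: KMS_def)
  also have "\<i> * of_int i * (\<i> * of_real \<beta>) = complex_of_real (- \<beta> * i)" by (simp add: complex_eq_iff)
  also have "exp \<dots> = of_real (exp (- \<beta> * i))" by (rule exp_of_real)
  finally show ?thesis using c kms_state by (simp add: smult_mult_right state_scale)
qed

text \<open>
  At positive \<open>\<beta>\<close> the KMS condition against the unit multiplies the value by a factor other than one; at
  \<open>\<beta> = 0\<close> the invariance does so, at a time when the dynamics acts by \<open>-1\<close>.
\<close>

lemma kms_off_diagonal: assumes "k \<noteq> l" shows "\<phi> (mono m k l n) = 0"
proof (cases "\<beta> = 0")
  case True
  define t where "t = pi / (real k - real l)"
  have "\<phi> (\<sigma> t (mono m k l n)) = \<phi> (mono m k l n)" using kms True by (auto simp: KMS_def)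
  moreover have "\<sigma> t (mono m k l n) = (-1) \<odot> mono m k l n"
    using homogeneous_mono[of k l m n] assms by (simp add: homogeneous_def t_def)
  ultimately show ?thesis using kms_state by (simp add: state_scale)
next
  case False
  have "\<phi> (mono m k l n) = exp (- \<beta> * (int k - int l)) * \<phi> (mono m k l n)"
    using kms_homogeneous[OF homogeneous_mono[of k l m n] homogeneous_one] by simp
  moreover have "exp (- \<beta> * (int k - int l)) \<noteq> 1" using False assms by simp
  ultimately show ?thesis by (metis mult_cancel_right1 of_real_eq_1_iff)
qed

text \<open>
  Insert the frame after \<open>u m\<close> and move \<open>v* u s*\<close> to the front: each of the \<open>N\<^sup>d\<close> terms becomes
  \<open>e\<^sup>-\<^sup>\<beta> \<phi> (v* u m v)\<close>, with weight \<^term>\<open>frame_const\<close>.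
\<close>

lemma kms_u_frame: "\<phi> (u m) = of_real (N * exp (- \<beta>)) * \<phi> (star C v \<otimes> (u m \<otimes> v))"
proof -
  define pr where "pr s = (character s, \<lambda>z. frame_const * character s z)" for s :: "int ^ 'd"
  define X where "X = \<phi> (star C v \<otimes> (u m \<otimes> v))"
  have fc: "cnj frame_const = frame_const" by (simp add: frame_const_def)
  have "\<phi> (u m \<otimes> rank_image C \<psi> (map pr ss)) = of_nat (length ss) * frame_const * of_real (exp (- \<beta>)) * X" for ss
  proof (induction ss)
    case Nil
    then show ?case using kms_state by (simp add: rank_image_def state_zero)
  next
    case (Cons s ss)
    have r: "rank_image C \<psi> (map pr ss) \<in> carrier C"
      by (rule rank_image_closed) (auto simp: pr_def intro!: psi_closed CT_intros)
    have "\<psi> (\<lambda>z. frame_const * character s z) = frame_const \<odot> (u s \<otimes> v)"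
      by (simp add: psi_scale psi_eq[of "character s"] CT_intros)
    then have "u m \<otimes> rank_image C \<psi> (map pr (s # ss)) =
      frame_const \<odot> ((u (m + s) \<otimes> v) \<otimes> (star C v \<otimes> u (- s))) \<oplus> u m \<otimes> rank_image C \<psi> (map pr ss)"
      using r by (simp add: rank_image_def pr_def psi_eq[of "character s"] CT_intros star_smult star_mult u_star
        distrib_left smult_mult_right mult_assoc u_mult[symmetric] fc)
    moreover have "\<phi> ((u (m + s) \<otimes> v) \<otimes> (star C v \<otimes> u (- s))) = exp (- \<beta>) * X"
    proof -
      have "homogeneous 1 (u (m + s) \<otimes> v)" "homogeneous (-1) (star C v \<otimes> u (- s))"
        using homogeneous_mult[OF homogeneous_u homogeneous_v] homogeneous_mult[OF homogeneous_v_star homogeneous_u] by auto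
      then have "\<phi> ((u (m + s) \<otimes> v) \<otimes> (star C v \<otimes> u (- s))) =
          exp (- \<beta>) * \<phi> ((star C v \<otimes> u (- s)) \<otimes> (u (m + s) \<otimes> v))"
        using kms_homogeneous[of 1 "u (m + s) \<otimes> v" "-1"] by simp
      also have "(star C v \<otimes> u (- s)) \<otimes> (u (m + s) \<otimes> v) = star C v \<otimes> ((u (- s) \<otimes> u (m + s)) \<otimes> v)"
        by (simp add: mult_assoc)
      also have "\<dots> = star C v \<otimes> (u m \<otimes> v)" by (simp add: u_mult)
      finally show ?thesis by (simp add: X_def)
    qed
    ultimately show ?case using Cons r kms_state by (simp add: state_add state_scale algebra_simps)
  qed
  from this[of frame_list] have "\<phi> (u m) = of_nat (N ^ CARD('d)) * frame_const * of_real (exp (- \<beta>)) * X"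
    using frame distinct_card[OF frame_list(2)] 
    by (simp add: frame_list card_frame_box frame_pairs_def pr_def[abs_def])
  then show ?thesis using N_nonzero by (simp add: frame_const_def X_def)
qed

lemma kms_temperature: "N * exp (- \<beta>) = 1"
proof -
  have "1 = complex_of_real (N * exp (- \<beta>))"
    using kms_u_frame[of 0] kms_state v_star_v by (simp add: u_zero state_one)
  then show ?thesis by (metis of_real_eq_1_iff)
qed

lemma kms_u_B: "\<phi> (u (B n)) = \<phi> (u n)"
  and kms_u_not_B: "\<nexists>n. m = B n \<Longrightarrow> \<phi> (u m) = 0"
  using kms_u_frame[of "B n"] kms_u_frame[of m] kms_state
  by (simp_all add: kms_temperature v_star_u_v_in v_star_u_v_out state_zero)

lemma kms_u_range: "\<phi> (u m) \<noteq> 0 \<Longrightarrow> m \<in> range (B ^^ k)"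
proof (induction k arbitrary: m)
  case (Suc k)
  then obtain n where n: "m = B n" using kms_u_not_B by blast
  then have "n \<in> range (B ^^ k)" using Suc kms_u_B by metis
  then show ?case using n by auto
qed simp

lemma kms_unique:
  assumes escape: "\<And>m. m \<noteq> 0 \<Longrightarrow> \<exists>k. m \<notin> range (B ^^ k)"
  shows "\<phi> (mono m k l n) = (if k = l \<and> m = n then 1 / of_nat N ^ k else 0)"
proof (cases "k = l")
  case True
  have u0: "\<phi> (u p) = (if p = 0 then 1 else 0)" for p
    using escape[of p] kms_u_range[of p] kms_state by (auto simp: u_zero state_one)
  have B0: "B 0 = 0" by (simp add: matrix_vector_mult_def vec_eq_iff)
  have core: "\<phi> (star C v [^] k \<otimes> (u p \<otimes> v [^] k)) = (if p = 0 then 1 else 0)" for p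
  proof (induction k arbitrary: p)
    case 0 show ?case by (simp add: pow_0 u0)
  next
    case (Suc k)
    have *: "star C v [^] Suc k \<otimes> (u p \<otimes> v [^] Suc k) =
        star C v [^] k \<otimes> ((star C v \<otimes> (u p \<otimes> v)) \<otimes> v [^] k)"
      unfolding pow_Suc[of "star C v"] pow_Suc2[OF v_closed] by (simp add: mult_assoc)
    show ?case
    proof (cases "\<exists>q. p = B q")
      case True
      then obtain q where q: "p = B q" ..
      then have "p = 0 \<longleftrightarrow> q = 0" using B_inj[of q 0] B0 by auto
      then show ?thesis unfolding * using Suc[of q] by (simp add: q v_star_u_v_in)
    next
      case False
      then have "p \<noteq> 0" using B0 by metis
      then show ?thesis unfolding * using False kms_state by (simp add: v_star_u_v_out state_zero)
    qed
  qed
  have "\<phi> (mono m k k n) = \<phi> (mono m k 0 0 \<otimes> mono 0 0 k n)"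
    by (simp add: mono_alt pow_0 u_zero mult_assoc)
  also have "\<dots> = exp (- \<beta> * (int k - int 0)) * \<phi> (mono 0 0 k n \<otimes> mono m k 0 0)"
    by (rule kms_homogeneous[OF homogeneous_mono homogeneous_mono])
  also have "mono 0 0 k n \<otimes> mono m k 0 0 = star C v [^] k \<otimes> ((u (- n) \<otimes> u m) \<otimes> v [^] k)"
    by (simp add: mono_alt pow_0 u_zero mult_assoc)
  also have "\<phi> \<dots> = (if m = n then 1 else 0)"
    by (simp only: u_mult core) (auto simp: add_eq_0_iff)
  also have "exp (- \<beta> * (int k - int 0)) = 1 / real N ^ k"
  proof -
    have "exp (- \<beta>) = 1 / N" using kms_temperature N_nonzero by (simp add: field_simps)
    moreover have "exp (- \<beta> * (int k - int 0)) = exp (- \<beta>) ^ k"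
      by (simp add: exp_of_nat_mult[symmetric] mult.commute)
    ultimately show ?thesis by (simp add: power_one_over)
  qed
  finally show ?thesis using True by simp
qed (simp add: kms_off_diagonal)

end

end

section \<open>The universal seminorm\<close>

abbreviation "generators \<equiv> ModGen ` CT \<union> AlgGen ` CT"
abbreviation "M_gen m \<equiv> gen (ModGen m)"
abbreviation "C_gen f \<equiv> gen (AlgGen f)"

lemma free_ML_simps [simp]:
  "carrier (free_ML p) = words generators"
  "x \<otimes>\<^bsub>free_ML p\<^esub> y = x * y"
  "\<one>\<^bsub>free_ML p\<^esub> = 1"
  "\<zero>\<^bsub>free_ML p\<^esub> = 0"
  "x \<oplus>\<^bsub>free_ML p\<^esub> y = x + y"
  "c \<odot>\<^bsub>free_ML p\<^esub> x = single 0 c * x"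
  "star (free_ML p) x = nc_star x"
  "nrm (free_ML p) = p"
  by (simp_all add: free_ML_def)

lemma generators_words: "m \<in> CT \<Longrightarrow> M_gen m \<in> words generators" "f \<in> CT \<Longrightarrow> C_gen f \<in> words generators"
  by (simp_all add: words_gen)

lemmas words_intros = generators_words words_add words_mult words_one words_zero words_scale words_star CT_intros

lemma single_Word_Cons:
  "single (Word ((g, b) # ls)) c = (if b then nc_star (gen g) else gen g) * single (Word ls) c"
  by (simp add: gen_def nc_star_single star_word_def mult_single plus_word_def)

context nonsingular
begin

definition frame_poly :: "'d generator nc_poly" where
  "frame_poly = rank_image (free_ML (\<lambda>x. 0)) M_gen frame_pairs"

text \<open>
  The defining relations of \<^locale>\<open>torus_rep\<close>, one clause for each axiom and in the same order, as pairs
  of elements of the free algebra.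
\<close>

inductive_set relators :: "('d generator nc_poly \<times> 'd generator nc_poly) set" where
  "m \<in> CT \<Longrightarrow> n \<in> CT \<Longrightarrow> (M_gen (\<lambda>z. m z + n z), M_gen m + M_gen n) \<in> relators"
| "m \<in> CT \<Longrightarrow> (M_gen (\<lambda>z. c * m z), single 0 c * M_gen m) \<in> relators"
| "f \<in> CT \<Longrightarrow> g \<in> CT \<Longrightarrow> (C_gen (\<lambda>z. f z + g z), C_gen f + C_gen g) \<in> relators"
| "f \<in> CT \<Longrightarrow> (C_gen (\<lambda>z. c * f z), single 0 c * C_gen f) \<in> relators"
| "f \<in> CT \<Longrightarrow> g \<in> CT \<Longrightarrow> (C_gen (\<lambda>z. f z * g z), C_gen f * C_gen g) \<in> relators"
| "f \<in> CT \<Longrightarrow> (C_gen (\<lambda>z. cnj (f z)), nc_star (C_gen f)) \<in> relators"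
| "(C_gen (\<lambda>z. 1), 1) \<in> relators"
| "f \<in> CT \<Longrightarrow> m \<in> CT \<Longrightarrow> (M_gen (left_act f m), C_gen f * M_gen m) \<in> relators"
| "m \<in> CT \<Longrightarrow> g \<in> CT \<Longrightarrow> (M_gen (right_act A m g), M_gen m * C_gen g) \<in> relators"
| "m \<in> CT \<Longrightarrow> n \<in> CT \<Longrightarrow> (nc_star (M_gen m) * M_gen n, C_gen (inner_ML A m n)) \<in> relators"
| "(frame_poly, 1) \<in> relators"

lemma frame_poly_words: "frame_poly \<in> words generators"
proof -
  have "rank_image (free_ML (\<lambda>x. 0)) M_gen xs \<in> words generators" if "set xs \<subseteq> CT \<times> CT" for xs :: "'d rank_list"
    using that by (induction xs) (auto simp: rank_image_def intro!: words_intros)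
  then show ?thesis using frame_pairs_CT by (simp add: frame_poly_def)
qed

lemma relators_words: "(x, y) \<in> relators \<Longrightarrow> x \<in> words generators \<and> y \<in> words generators"
  by (induction rule: relators.induct)
    (auto intro!: words_intros frame_poly_words left_act_CT right_act_CT inner_ML_CT)

text \<open>
  An identity between images of the free algebra holds in the completion exactly if the seminorm
  kills the difference.
\<close>

lemma torus_rep_iff:
  assumes "seminormed_star_algebra (free_ML p)"
  shows "torus_rep A N (completion (free_ML p)) (\<lambda>m. embed (free_ML p) (M_gen m))
      (\<lambda>f. embed (free_ML p) (C_gen f)) \<longleftrightarrow> (\<forall>(x, y)\<in>relators. p (x - y) = 0)"
    (is "torus_rep A N ?K ?\<psi> ?\<pi> \<longleftrightarrow> ?R")
proof -
  interpret F: seminormed_star_algebra "free_ML p" by (rule assms)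
  interpret K: cstar_algebra ?K by (rule F.completion_cstar)
  let ?e = "embed (free_ML p)"
  have e: "?e x = ?e y \<longleftrightarrow> p (x - y) = 0" if "x \<in> words generators" "y \<in> words generators" for x y
    using F.embed_eq_iff[of x y] that free_minus[of x generators y p] by (simp add: free_ML_def)
  have R: "?R \<longleftrightarrow> (\<forall>(x, y)\<in>relators. ?e x = ?e y)" using e relators_words by blast
  have hom2: "?e (x + y) = ?e x \<oplus>\<^bsub>?K\<^esub> ?e y" "?e (x * y) = ?e x \<otimes>\<^bsub>?K\<^esub> ?e y"
    if "x \<in> words generators" "y \<in> words generators" for x y
    using F.embed_add[of x y] F.embed_mult[of x y] that by simp_all
  have hom1: "?e (single 0 c * x) = c \<odot>\<^bsub>?K\<^esub> ?e x" "?e (nc_star x) = star ?K (?e x)" "?e x \<in> carrier ?K"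
    if "x \<in> words generators" for x c
    using F.embed_scale[of x c] F.embed_star[of x] F.embed_closed[of x] that by simp_all
  note hom = hom1 hom2
  have hom0: "?e 1 = \<one>\<^bsub>?K\<^esub>" "?e 0 = \<zero>\<^bsub>?K\<^esub>"
    using F.embed_one F.embed_zero by simp_all
  have "?e (rank_image (free_ML (\<lambda>x. 0)) M_gen xs) = rank_image ?K ?\<psi> xs \<and>
      rank_image (free_ML (\<lambda>x. 0)) M_gen xs \<in> words generators" if "set xs \<subseteq> CT \<times> CT" for xs :: "'d rank_list"
    using that by (induction xs) (auto simp: rank_image_def hom hom0 words_intros)
  then have frame: "?e frame_poly = rank_image ?K ?\<psi> frame_pairs"
    using frame_pairs_CT by (simp add: frame_poly_def)
  note s = hom hom0 words_intros frame
  show ?thesis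
  proof
    assume "torus_rep A N ?K ?\<psi> ?\<pi>"
    then interpret T: torus_rep A N ?K ?\<psi> ?\<pi> .
    have "?e x = ?e y" if "(x, y) \<in> relators" for x y
      using that
      by (induction rule: relators.induct)
        (simp_all add: s T.psi_add T.psi_scale T.pi_add T.pi_scale T.pi_mult T.pi_star T.pi_one T.psi_left
          T.psi_right T.psi_inner T.frame)
    then show ?R unfolding R by blast
  next
    assume ?R
    then have r: "?e x = ?e y" if "(x, y) \<in> relators" for x y using that unfolding R by blast
    note r' = relators.intros[THEN r]
    show "torus_rep A N ?K ?\<psi> ?\<pi>"
    proof unfold_locales
      fix m n :: "'d torus \<Rightarrow> complex" and c assume m: "m \<in> CT"
      show "?\<psi> m \<in> carrier ?K" "?\<pi> m \<in> carrier ?K" using m by (simp_all add: s)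
      show "?\<psi> (\<lambda>z. c * m z) = c \<odot>\<^bsub>?K\<^esub> ?\<psi> m" "?\<pi> (\<lambda>z. c * m z) = c \<odot>\<^bsub>?K\<^esub> ?\<pi> m"
        using m r'(2)[of m c] r'(4)[of m c] by (simp_all add: s)
      show "?\<pi> (\<lambda>z. cnj (m z)) = star ?K (?\<pi> m)" using m r'(6)[of m] by (simp add: s)
      assume n: "n \<in> CT"
      show "?\<psi> (\<lambda>z. m z + n z) = ?\<psi> m \<oplus>\<^bsub>?K\<^esub> ?\<psi> n" "?\<pi> (\<lambda>z. m z + n z) = ?\<pi> m \<oplus>\<^bsub>?K\<^esub> ?\<pi> n"
        "?\<pi> (\<lambda>z. m z * n z) = ?\<pi> m \<otimes>\<^bsub>?K\<^esub> ?\<pi> n"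
        using m n r'(1)[of m n] r'(3)[of m n] r'(5)[of m n] by (simp_all add: s)
      show "?\<psi> (left_act m n) = ?\<pi> m \<otimes>\<^bsub>?K\<^esub> ?\<psi> n" "?\<psi> (right_act A m n) = ?\<psi> m \<otimes>\<^bsub>?K\<^esub> ?\<pi> n"
        "star ?K (?\<psi> m) \<otimes>\<^bsub>?K\<^esub> ?\<psi> n = ?\<pi> (inner_ML A m n)"
        using m n r'(8)[of m n] r'(9)[of m n] r'(10)[of m n] by (simp_all add: s)
    next
      show "?\<pi> (\<lambda>z. 1) = \<one>\<^bsub>?K\<^esub>" using r'(7) by (simp add: s)
      show "rank_image ?K ?\<psi> frame_pairs = \<one>\<^bsub>?K\<^esub>" using r'(11) by (simp add: s)
    qed
  qed
qed

lemma covariant_seminorms_iff: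
  "p \<in> covariant_seminorms A \<longleftrightarrow> seminormed_star_algebra (free_ML p) \<and> (\<forall>(x, y)\<in>relators. p (x - y) = 0)"
  unfolding covariant_seminorms_def
  using torus_rep_iff torus_rep.covariant_rep covariant_rep.torus_rep nonsingular_axioms by blast

text \<open>
  The norms of the generators are bounded by \<^const>\<open>sup_norm\<close> and \<^const>\<open>norm_ML\<close> in every covariant
  representation, and a polynomial involves finitely many words.
\<close>

lemma seminorm_bounded:
  assumes "x \<in> words generators"
  shows "\<exists>b. \<forall>p\<in>covariant_seminorms A. p x \<le> b"
proof -
  have sn: "seminormed_star_algebra (free_ML p)" if "p \<in> covariant_seminorms A" for p
    using that covariant_seminorms_iff by blast
  have g: "\<exists>b\<ge>0. \<forall>p\<in>covariant_seminorms A. p (gen g) \<le> b" if "g \<in> generators" for g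
  proof -
    have T: "torus_rep A N (completion (free_ML p)) (\<lambda>m. embed (free_ML p) (M_gen m))
        (\<lambda>f. embed (free_ML p) (C_gen f))" if "p \<in> covariant_seminorms A" for p
      using that torus_rep_iff covariant_seminorms_iff by blast
    have e: "nrm (completion (free_ML p)) (embed (free_ML p) (gen g)) = p (gen g)"
      if "p \<in> covariant_seminorms A" for p
      using seminormed_star_algebra.embed_nrm[OF sn[OF that], of "gen g"] words_gen[OF \<open>g \<in> generators\<close>] by simp
    from \<open>g \<in> generators\<close> show ?thesis
    proof
      assume "g \<in> ModGen ` CT"
      then obtain m where m: "g = ModGen m" "m \<in> CT" by blast
      then have "\<forall>p\<in>covariant_seminorms A. p (gen g) \<le> norm_ML A m"
        using torus_rep.nrm_psi[OF T m(2)] e by simp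
      then show ?thesis using norm_ML_nonneg m by blast
    next
      assume "g \<in> AlgGen ` CT"
      then obtain f where f: "g = AlgGen f" "f \<in> CT" by blast
      then have "\<forall>p\<in>covariant_seminorms A. p (gen g) \<le> sup_norm f"
        using torus_rep.nrm_pi[OF T f(2)] e by simp
      then show ?thesis using sup_norm_nonneg f by blast
    qed
  qed
  show ?thesis using assms
  proof (induction x rule: words_induct)
    case zero
    have "p 0 \<le> 0" if "p \<in> covariant_seminorms A" for p
      using seminormed_star_algebra.nrm_zero_element[OF sn[OF that]] by simp
    then show ?case by blast
  next
    case (single w c)
    have "\<exists>b\<ge>0. \<forall>p\<in>covariant_seminorms A. p (single (Word ls) c) \<le> b" if "fst ` set ls \<subseteq> generators" for ls
      using that
    proof (induction ls)
      case Nil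
      have "p (single (Word []) c) \<le> cmod c" if "p \<in> covariant_seminorms A" for p
      proof -
        interpret seminormed_star_algebra "free_ML p" by (rule sn[OF that])
        have "p (single 0 c * 1) = cmod c * p 1" using nrm_smult[of 1 c] by (simp add: words_one)
        then show ?thesis using nrm_one_le by (simp add: zero_word_def mult_left_le)
      qed
      then show ?case using norm_ge_zero by blast
    next
      case (Cons l ls)
      obtain h b where l: "l = (h, b)" "h \<in> generators" using Cons.prems by (cases l) auto
      obtain b1 where b1: "b1 \<ge> 0" "\<And>p. p \<in> covariant_seminorms A \<Longrightarrow> p (gen h) \<le> b1" using g[OF l(2)] by blast
      obtain b2 where b2: "b2 \<ge> 0" "\<And>p. p \<in> covariant_seminorms A \<Longrightarrow> p (single (Word ls) c) \<le> b2"
        using Cons by auto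
      have "p (single (Word (l # ls)) c) \<le> b1 * b2" if p: "p \<in> covariant_seminorms A" for p
      proof -
        interpret seminormed_star_algebra "free_ML p" by (rule sn[OF p])
        let ?y = "if b then nc_star (gen h) else gen h"
        have w: "gen h \<in> words generators" "single (Word ls) c \<in> words generators"
          using words_gen[OF l(2)] Cons.prems by (simp_all add: words_single)
        then have "p ?y = p (gen h)" using nrm_star[of "gen h"] by simp
        moreover have "?y \<in> words generators" using w by (simp add: words_star)
        ultimately have "p (?y * single (Word ls) c) \<le> p (gen h) * p (single (Word ls) c)"
          using nrm_mult[of ?y "single (Word ls) c"] w by simp
        also have "\<dots> \<le> b1 * b2"
          using b1 b2 p w nrm_nonneg[of "single (Word ls) c"] by (intro mult_mono) auto
        finally show ?thesis by (simp add: l single_Word_Cons)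
      qed
      then show ?case using b1(1) b2(1) by (intro exI[of _ "b1 * b2"]) auto
    qed
    from this[of "letters w"] single show ?case by auto
  next
    case (add x y)
    then obtain a b where ab: "\<And>p. p \<in> covariant_seminorms A \<Longrightarrow> p x \<le> a" "\<And>p. p \<in> covariant_seminorms A \<Longrightarrow> p y \<le> b"
      by blast
    have "p (x + y) \<le> a + b" if p: "p \<in> covariant_seminorms A" for p
      using seminormed_star_algebra.nrm_triangle[OF sn[OF p], of x y] add ab[OF p] by simp
    then show ?case by blast
  qed
qed

lemma universal_upper:
  assumes "x \<in> words generators" "p \<in> covariant_seminorms A"
  shows "p x \<le> universal_norm A x"
  unfolding universal_norm_def
  by (rule cSUP_upper[OF assms(2)]) (use seminorm_bounded[OF assms(1)] in \<open>auto intro: bdd_aboveI2\<close>)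

text \<open>
  All conditions on a covariant seminorm pass to suprema, because covariance is expressed by
  relations.
\<close>

lemma universal_seminorm:
  assumes ne: "covariant_seminorms A \<noteq> {}"
  shows "seminormed_star_algebra (free_ML (universal_norm A))"
    and "\<forall>(x, y)\<in>relators. universal_norm A (x - y) = 0"
proof -
  have sn: "seminormed_star_algebra (free_ML p)" if "p \<in> covariant_seminorms A" for p
    using that covariant_seminorms_iff by blast
  have least: "universal_norm A x \<le> b" if "\<And>p. p \<in> covariant_seminorms A \<Longrightarrow> p x \<le> b" for x b
    unfolding universal_norm_def using ne that by (rule cSUP_least)
  note up = universal_upper
  have nn: "0 \<le> p x" if "x \<in> words generators" "p \<in> covariant_seminorms A" for p x
    using seminormed_star_algebra.nrm_nonneg[OF sn[OF that(2)], of x] that by simp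
  have U0: "0 \<le> universal_norm A x" if "x \<in> words generators" for x
    using ne nn[OF that] up[OF that] order_trans by blast
  show "\<forall>(x, y)\<in>relators. universal_norm A (x - y) = 0"
  proof clarify
    fix x y assume xy: "(x, y) \<in> relators"
    have "universal_norm A (x - y) \<le> 0" by (rule least) (use covariant_seminorms_iff xy in fastforce)
    moreover have "x - y \<in> words generators" using relators_words[OF xy] words_minus by blast
    ultimately show "universal_norm A (x - y) = 0" using U0 by (intro antisym)
  qed
  show "seminormed_star_algebra (free_ML (universal_norm A))"
  proof (intro seminormed_star_algebra.intro seminormed_star_algebra_axioms.intro)
    show "star_algebra (free_ML (universal_norm A))" unfolding free_ML_def by (rule star_algebra_free)
    fix x assume "x \<in> carrier (free_ML (universal_norm A))"
    then have x: "x \<in> words generators" by simp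
    show "0 \<le> nrm (free_ML (universal_norm A)) x" using U0[OF x] by simp
    fix c
    have le: "universal_norm A (single 0 c * x) \<le> cmod c * universal_norm A x" if x: "x \<in> words generators" for x c
    proof (rule least)
      fix p assume p: "p \<in> covariant_seminorms A"
      show "p (single 0 c * x) \<le> cmod c * universal_norm A x"
        using seminormed_star_algebra.nrm_smult[OF sn[OF p], of x c] x up[OF x p] by (simp add: mult_left_mono)
    qed
    have "cmod c * universal_norm A x \<le> universal_norm A (single 0 c * x)"
    proof (cases "c = 0")
      case False
      have "single 0 (1 / c) * (single 0 c * x) = x"
        using False by (simp add: mult.assoc[symmetric] mult_single)
      then show ?thesis
        using le[OF words_scale[OF x, of c], of "1 / c"] False by (simp add: norm_divide field_simps)
    qed (use U0[OF words_scale[OF x, of 0]] in simp)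
    then show "nrm (free_ML (universal_norm A)) (c \<odot>\<^bsub>free_ML (universal_norm A)\<^esub> x) =
        cmod c * nrm (free_ML (universal_norm A)) x" using le[OF x, of c] by simp
    have sx: "nc_star x * x \<in> words generators" using x by (intro words_mult words_star)
    have sq: "p (nc_star x * x) = (p x)\<^sup>2" if p: "p \<in> covariant_seminorms A" for p
      using seminormed_star_algebra.cstar_identity[OF sn[OF p], of x] x by simp
    have "universal_norm A (nc_star x * x) \<le> (universal_norm A x)\<^sup>2"
      by (rule least) (use up[OF x] nn[OF x] in \<open>simp add: sq power_mono\<close>)
    moreover have "universal_norm A x \<le> sqrt (universal_norm A (nc_star x * x))"
    proof (rule least)
      fix p assume p: "p \<in> covariant_seminorms A"
      show "p x \<le> sqrt (universal_norm A (nc_star x * x))"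
        using up[OF sx p] sq[OF p] by (simp add: real_le_rsqrt)
    qed
    then have "(universal_norm A x)\<^sup>2 \<le> universal_norm A (nc_star x * x)"
      using U0[OF x] U0[OF sx] by (metis power_mono real_sqrt_pow2)
    ultimately show "nrm (free_ML (universal_norm A)) (star (free_ML (universal_norm A)) x
        \<otimes>\<^bsub>free_ML (universal_norm A)\<^esub> x) = (nrm (free_ML (universal_norm A)) x)\<^sup>2" by simp
    fix y assume "y \<in> carrier (free_ML (universal_norm A))"
    then have y: "y \<in> words generators" by simp
    have "universal_norm A (x + y) \<le> universal_norm A x + universal_norm A y"
    proof (rule least)
      fix p assume p: "p \<in> covariant_seminorms A"
      show "p (x + y) \<le> universal_norm A x + universal_norm A y"
        using seminormed_star_algebra.nrm_triangle[OF sn[OF p], of x y] x y up[OF x p] up[OF y p] by simp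
    qed
    then show "nrm (free_ML (universal_norm A)) (x \<oplus>\<^bsub>free_ML (universal_norm A)\<^esub> y) \<le>
        nrm (free_ML (universal_norm A)) x + nrm (free_ML (universal_norm A)) y" by simp
    have "universal_norm A (x * y) \<le> universal_norm A x * universal_norm A y"
    proof (rule least)
      fix p assume p: "p \<in> covariant_seminorms A"
      have "p (x * y) \<le> p x * p y"
        using seminormed_star_algebra.nrm_mult[OF sn[OF p], of x y] x y by simp
      also have "\<dots> \<le> universal_norm A x * universal_norm A y"
        using up[OF x p] up[OF y p] nn[OF x p] nn[OF y p] by (intro mult_mono) auto
      finally show "p (x * y) \<le> universal_norm A x * universal_norm A y" .
    qed
    then show "nrm (free_ML (universal_norm A)) (x \<otimes>\<^bsub>free_ML (universal_norm A)\<^esub> y) \<le>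
        nrm (free_ML (universal_norm A)) x * nrm (free_ML (universal_norm A)) y" by simp
  qed
qed

end

section \<open>A covariant representation over the discrete torus\<close>

text \<open>
  The Hilbert space has an orthonormal basis indexed by the points \<open>(z, j)\<close> of the discrete set
  \<open>\<T>\<^sup>d \<times> \<int>\<close>.  Functions act by multiplication and the bimodule by weighted composition with
  \<open>\<sigma>\<^sub>A\<close>, which raises the second coordinate by one.  All vectors needed have finite support, because
  the fibres of \<open>\<sigma>\<^sub>A\<close> are finite.
\<close>

context nonsingular
begin

fun point_op :: "'d generator \<times> bool \<Rightarrow> ('d torus \<times> int \<Rightarrow> complex) \<Rightarrow> 'd torus \<times> int \<Rightarrow> complex" where
  "point_op (AlgGen f, b) \<xi> (w, j) = (if b then cnj (f w) else f w) * \<xi> (w, j)"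
| "point_op (ModGen m, False) \<xi> (w, j) = m w * \<xi> (torus_map A w, j - 1) / sqrt N"
| "point_op (ModGen m, True) \<xi> (z, j) = (\<Sum>w\<in>fibre A z. cnj (m w) * \<xi> (w, j + 1)) / sqrt N"

lemma sqrt_N [simp]: "complex_of_real (sqrt N) * complex_of_real (sqrt N) = N"
  by (simp flip: of_real_mult)

lemma point_inner:
  "point_op (ModGen m, True) (point_op (ModGen n, False) \<xi>) (z, j) = inner_ML A m n z * \<xi> (z, j)"
proof -
  have "point_op (ModGen m, True) (point_op (ModGen n, False) \<xi>) (z, j) =
      (\<Sum>w\<in>fibre A z. cnj (m w) * (n w * \<xi> (z, j) / sqrt N)) / sqrt N"
    by (simp add: fibre_def)
  also have "\<dots> = (\<Sum>w\<in>fibre A z. cnj (m w) * n w) * \<xi> (z, j) / (complex_of_real (sqrt N) * complex_of_real (sqrt N))"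
    by (simp add: sum_divide_distrib sum_distrib_right sum_distrib_left mult_ac del: sqrt_N)
  finally show ?thesis by (simp add: inner_ML_def transfer_fibre)
qed

text \<open>
  On each level \<open>j\<close> the rank-one operators of the bimodule act as they do on functions, so the frame
  relation in the representation is \<open>finite_rank_frame\<close>.
\<close>

lemma point_rank_one:
  "point_op (ModGen x, False) (point_op (ModGen y, True) \<xi>) (w, j) =
    right_act A x (inner_ML A y (\<lambda>w. \<xi> (w, j))) w"
proof -
  have "point_op (ModGen x, False) (point_op (ModGen y, True) \<xi>) (w, j) =
      x w * (\<Sum>w'\<in>fibre A (torus_map A w). cnj (y w') * \<xi> (w', j)) / (complex_of_real (sqrt N) * complex_of_real (sqrt N))"
    by (simp del: sqrt_N)
  then show ?thesis by (simp add: right_act_def alpha_def inner_ML_def transfer_fibre)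
qed

definition fibre_pairs :: "('d torus \<times> int) set \<Rightarrow> (('d torus \<times> int) \<times> 'd torus) set" where
  "fibre_pairs S = Sigma S (\<lambda>(z, j). fibre A z)"

lemma supp_point_op:
  "supp (point_op (ModGen m, False) \<xi>) \<subseteq> (\<lambda>((z, j), w). (w, j + 1)) ` fibre_pairs (supp \<xi>)"
  "supp (point_op (ModGen m, True) \<xi>) \<subseteq> (\<lambda>(w, j). (torus_map A w, j - 1)) ` supp \<xi>"
  "supp (point_op (AlgGen f, b) \<xi>) \<subseteq> supp \<xi>"
proof -
  show "supp (point_op (ModGen m, False) \<xi>) \<subseteq> (\<lambda>((z, j), w). (w, j + 1)) ` fibre_pairs (supp \<xi>)"
  proof clarify
    fix w j assume "(w, j) \<in> supp (point_op (ModGen m, False) \<xi>)"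
    then have "((torus_map A w, j - 1), w) \<in> fibre_pairs (supp \<xi>)"
      by (auto simp: supp_def fibre_pairs_def fibre_def)
    then show "(w, j) \<in> (\<lambda>((z, j), w). (w, j + 1)) ` fibre_pairs (supp \<xi>)"
      by (rule rev_image_eqI) simp
  qed
  show "supp (point_op (ModGen m, True) \<xi>) \<subseteq> (\<lambda>(w, j). (torus_map A w, j - 1)) ` supp \<xi>"
  proof clarify
    fix z j assume "(z, j) \<in> supp (point_op (ModGen m, True) \<xi>)"
    then have "\<exists>w\<in>fibre A z. \<xi> (w, j + 1) \<noteq> 0"
      by (rule contrapos_pp) (simp add: supp_def)
    then obtain w where "w \<in> fibre A z" "(w, j + 1) \<in> supp \<xi>" by (auto simp: supp_def)
    then show "(z, j) \<in> (\<lambda>(w, j). (torus_map A w, j - 1)) ` supp \<xi>"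
      by (auto simp: fibre_def intro!: rev_image_eqI[of "(w, j + 1)"])
  qed
  show "supp (point_op (AlgGen f, b) \<xi>) \<subseteq> supp \<xi>" by (auto simp: supp_def)
qed

lemma finite_fibre_pairs: "finite S \<Longrightarrow> finite (fibre_pairs S)"
  unfolding fibre_pairs_def by (rule finite_SigmaI) (auto simp: fibre_finite)

lemma finite_supp_point_op: assumes "finite (supp \<xi>)" shows "finite (supp (point_op (g, b) \<xi>))"
proof (cases g)
  case (ModGen m)
  then show ?thesis
    using assms finite_subset[OF supp_point_op(1)[of m \<xi>]] finite_subset[OF supp_point_op(2)[of m \<xi>]]
    by (cases b) (auto simp: finite_fibre_pairs)
next
  case (AlgGen f)
  then show ?thesis using assms finite_subset[OF supp_point_op(3)] by blast
qed

lemma point_op_adjoint: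
  assumes \<xi>: "finite (supp \<xi>)" and \<eta>: "finite (supp \<eta>)"
  shows "ip (point_op (g, False) \<xi>) \<eta> = ip \<xi> (point_op (g, True) \<eta>)"
proof (cases g)
  case (AlgGen f)
  have "ip (point_op (g, False) \<xi>) \<eta> = (\<Sum>i\<in>supp \<xi>. cnj (point_op (g, False) \<xi> i) * \<eta> i)"
    using \<xi> supp_point_op(3) AlgGen by (intro ip_superset) auto
  then show ?thesis by (auto simp: ip_def AlgGen intro!: sum.cong)
next
  case (ModGen m)
  let ?S = "fibre_pairs (supp \<xi>)"
  have "ip (point_op (g, False) \<xi>) \<eta> =
      (\<Sum>i\<in>(\<lambda>((z, j), w). (w, j + 1)) ` ?S. cnj (point_op (g, False) \<xi> i) * \<eta> i)"
    using \<xi> supp_point_op(1) ModGen by (intro ip_superset) (auto simp: finite_fibre_pairs)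
  also have "\<dots> = (\<Sum>((z, j), w)\<in>?S. cnj (m w * \<xi> (z, j) / sqrt N) * \<eta> (w, j + 1))"
    by (subst sum.reindex)
      (auto simp: inj_on_def fibre_pairs_def fibre_def ModGen intro!: sum.cong)
  also have "\<dots> = (\<Sum>(z, j)\<in>supp \<xi>. \<Sum>w\<in>fibre A z. cnj (m w * \<xi> (z, j) / sqrt N) * \<eta> (w, j + 1))"
    unfolding fibre_pairs_def using \<xi> fibre_finite by (subst sum.Sigma[symmetric]) (auto simp: case_prod_beta)
  also have "\<dots> = ip \<xi> (point_op (g, True) \<eta>)"
    unfolding ip_def by (intro sum.cong) (auto simp: ModGen sum_distrib_left sum_divide_distrib mult_ac)
  finally show ?thesis .
qed

lemma l2_multiplication:
  assumes f: "f \<in> CT" and \<xi>: "finite (supp \<xi>)"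
  shows "l2 (\<lambda>(w, j). f w * \<xi> (w, j)) \<le> sup_norm f * l2 \<xi>"
proof -
  let ?\<eta> = "\<lambda>(w, j). f w * \<xi> (w, j)"
  have "l2 ?\<eta> = L2_set (\<lambda>i. cmod (?\<eta> i)) (supp \<xi>)" by (rule l2_superset[OF \<xi>]) (auto simp: supp_def)
  also have "\<dots> \<le> L2_set (\<lambda>i. sup_norm f * cmod (\<xi> i)) (supp \<xi>)"
    by (rule L2_set_mono) (auto simp: norm_mult intro!: mult_right_mono sup_norm_upper[OF f])
  also have "\<dots> = sup_norm f * l2 \<xi>"
    using sup_norm_nonneg[OF f] by (simp add: l2_def L2_set_right_distrib)
  finally show ?thesis .
qed

lemma point_op_bound:
  assumes "g \<in> generators"
  shows "\<exists>c\<ge>0. \<forall>\<xi>. finite (supp \<xi>) \<longrightarrow> l2 (point_op (g, False) \<xi>) \<le> c * l2 \<xi>"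
  using assms
proof
  assume "g \<in> AlgGen ` CT"
  then obtain f where f: "g = AlgGen f" "f \<in> CT" by blast
  have "point_op (g, False) \<xi> = (\<lambda>(w, j). f w * \<xi> (w, j))" for \<xi> by (auto simp: f fun_eq_iff)
  then show ?thesis using l2_multiplication[OF f(2)] sup_norm_nonneg[OF f(2)] by auto
next
  assume "g \<in> ModGen ` CT"
  then obtain m where m: "g = ModGen m" "m \<in> CT" by blast
  let ?b = "sup_norm (inner_ML A m m)"
  have CT: "inner_ML A m m \<in> CT" using m by (intro inner_ML_CT)
  have "l2 (point_op (g, False) \<xi>) \<le> sqrt ?b * l2 \<xi>" if \<xi>: "finite (supp \<xi>)" for \<xi>
  proof -
    let ?T = "point_op (g, False) \<xi>"
    have eq: "point_op (g, True) ?T = (\<lambda>(z, j). inner_ML A m m z * \<xi> (z, j))"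
      unfolding m(1) using point_inner[of m m \<xi>] by (auto simp: fun_eq_iff)
    have "(l2 ?T)\<^sup>2 = cmod (ip ?T ?T)" by (simp add: ip_self norm_power)
    also have "ip ?T ?T = ip \<xi> (point_op (g, True) ?T)"
      by (rule point_op_adjoint[OF \<xi> finite_supp_point_op[OF \<xi>]])
    also have "cmod \<dots> \<le> l2 \<xi> * l2 (point_op (g, True) ?T)"
      by (intro ip_le finite_supp_point_op \<xi>)
    also have "\<dots> \<le> l2 \<xi> * (?b * l2 \<xi>)"
      unfolding eq by (intro mult_left_mono l2_multiplication[OF CT \<xi>]) simp
    finally have "(l2 ?T)\<^sup>2 \<le> ?b * (l2 \<xi>)\<^sup>2" by (simp add: power2_eq_square mult_ac)
    then have "l2 ?T \<le> sqrt (?b * (l2 \<xi>)\<^sup>2)" by (rule real_le_rsqrt)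
    then show ?thesis by (simp add: real_sqrt_mult)
  qed
  then show ?thesis using sup_norm_nonneg[OF CT] by (intro exI[of _ "sqrt ?b"]) auto
qed

sublocale point: bounded_star_rep "generators :: 'd generator set" point_op
proof
  fix l :: "'d generator \<times> bool" and \<xi> \<eta> :: "'d torus \<times> int \<Rightarrow> complex" and c
  obtain g b where l: "l = (g, b)" by force
  show "point_op l (\<lambda>i. \<xi> i + \<eta> i) = (\<lambda>i. point_op l \<xi> i + point_op l \<eta> i)"
    by (cases g; cases b) (auto simp: l fun_eq_iff distrib_left sum.distrib add_divide_distrib)
  show "point_op l (\<lambda>i. c * \<xi> i) = (\<lambda>i. c * point_op l \<xi> i)"
    by (cases g; cases b) (auto simp: l fun_eq_iff sum_distrib_left mult_ac)
qed (use finite_supp_point_op point_op_adjoint point_op_bound in auto)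

lemma point_relators: "(x, y) \<in> relators \<Longrightarrow> point.rep x \<xi> = point.rep y \<xi>"
proof (induction arbitrary: \<xi> rule: relators.induct)
  case (10 m n)
  show ?case
    unfolding point.rep_mult point.rep_gen point.rep_star_gen using point_inner[of m n \<xi>] by (auto simp: fun_eq_iff)
next
  case 11
  have "point.rep (rank_image (free_ML (\<lambda>x. 0)) M_gen xs) \<xi> (w, j) = finite_rank A xs (\<lambda>w. \<xi> (w, j)) w" for xs w j
    by (induction xs) (auto simp: rank_image_def finite_rank_def point.rep_add point.rep_mult point.rep_gen
        point.rep_star_gen point_rank_one simp del: point_op.simps)
  then show ?case
    by (auto simp: frame_poly_def fun_eq_iff point.rep_one finite_rank_frame)
qed (auto simp: fun_eq_iff point.rep_add point.rep_scale point.rep_mult point.rep_gen point.rep_star_gen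
    point.rep_one point.rep_single zero_word_def left_act_def right_act_def alpha_def distrib_right add_divide_distrib)

lemma point_covariant: "point.opnorm \<in> covariant_seminorms A"
  unfolding covariant_seminorms_iff
  using point.opnorm_seminorm point.opnorm_eq_0 point_relators relators_words
  by (auto simp: free_ML_def)

lemma CP_seminormed: "seminormed_star_algebra (free_ML (universal_norm A))"
  using universal_seminorm(1) point_covariant by blast

lemma CP_torus_rep: "torus_rep A N (CP A) (j_M A) (j_CT A)"
  unfolding CP_def j_M_def[abs_def] j_CT_def[abs_def]
  using torus_rep_iff[OF CP_seminormed] universal_seminorm(2) point_covariant by blast

end

section \<open>Dilation matrices\<close>

lemma tendsto_zero_recursion:
  fixes x y :: "nat \<Rightarrow> complex"
  assumes rec: "\<And>k. x (Suc k) = a * x k + y k" and y: "y \<longlonglongrightarrow> 0" and a: "cmod a < 1"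
  shows "x \<longlonglongrightarrow> 0"
proof (rule LIMSEQ_I)
  fix e :: real assume e: "e > 0"
  define b where "b = e * (1 - cmod a) / 2"
  have "b > 0" using e a by (simp add: b_def)
  then obtain K where K: "\<And>k. k \<ge> K \<Longrightarrow> cmod (y k) < b"
    using LIMSEQ_D[OF y] by auto
  have bound: "cmod (x (K + j)) \<le> cmod a ^ j * cmod (x K) + e / 2" for j
  proof (induction j)
    case (Suc j)
    have "cmod (x (K + Suc j)) \<le> cmod a * cmod (x (K + j)) + cmod (y (K + j))"
      using rec[of "K + j"] norm_triangle_ineq[of "a * x (K + j)" "y (K + j)"] by (simp add: norm_mult)
    also have "\<dots> \<le> cmod a * (cmod a ^ j * cmod (x K) + e / 2) + b"
      using Suc K[of "K + j"] by (intro add_mono mult_left_mono) auto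
    also have "\<dots> = cmod a ^ Suc j * cmod (x K) + e / 2"
      by (simp add: b_def field_simps)
    finally show ?case .
  qed (use e in simp)
  have "(\<lambda>j. cmod a ^ j * cmod (x K)) \<longlonglongrightarrow> 0"
    using a by (intro tendsto_mult_left_zero LIMSEQ_realpow_zero) auto
  then obtain J where J: "\<And>j. j \<ge> J \<Longrightarrow> cmod a ^ j * cmod (x K) < e / 2"
    using order_tendstoD(2)[of _ 0 sequentially "e / 2"] e by (auto simp: eventually_sequentially)
  have "norm (x k - 0) < e" if k: "k \<ge> K + J" for k
  proof -
    have "J \<le> k - K" "K + (k - K) = k" using k by auto
    then show ?thesis using bound[of "k - K"] J[of "k - K"] by simp
  qed
  then show "\<exists>k0. \<forall>k\<ge>k0. norm (x k - 0) < e" by blast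
qed

text \<open>
  Some nonzero polynomial in the matrix annihilates a given vector.  Its linear factors are removed one
  by one: a factor whose root is no eigenvalue can be cancelled, and a factor with root of modulus
  less than one does not affect whether the orbit tends to zero.
\<close>

lemma orbit_tendsto_zero:
  fixes T :: "complex ^ 'n ^ ('n :: finite)"
  assumes ev: "\<And>a x. x \<noteq> 0 \<Longrightarrow> T *v x = a *s x \<Longrightarrow> cmod a < 1"
  shows "(\<lambda>k. (((*v) T) ^^ k) y $ i) \<longlonglongrightarrow> 0"
proof -
  define f where "f = (*v) T"
  define ev_at where "ev_at M p y = (\<Sum>i<M. coeff p i *s (f ^^ i) y)" for M p y
  have f_add: "f (x + y) = f x + f y" and f_scale: "f (a *s x) = a *s f x" for x y a
    by (simp_all add: f_def matrix_vector_right_distrib vector_scalar_commute)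
  have f_sum: "f (\<Sum>i\<in>I. g i) = (\<Sum>i\<in>I. f (g i))" if "finite I" for I :: "nat set" and g
    using that by induction (auto simp: f_add, simp add: f_def)
  have pow_add: "(f ^^ k) (x + y) = (f ^^ k) x + (f ^^ k) y"
    and pow_scale: "(f ^^ k) (a *s x) = a *s (f ^^ k) x" for k x y a
    by (induction k) (simp_all add: f_add f_scale)
  have f_ev: "f (ev_at M q y) = ev_at M q (f y)" for M q y
    by (simp add: ev_at_def f_sum f_scale funpow_swap1)
  have ev_mult: "ev_at (Suc M) ([:- a, 1:] * q) y = f (ev_at M q y) - a *s ev_at M q y"
    if "degree q < M" for M q a y
  proof -
    have "coeff ([:- a, 1:] * q) i = coeff (pCons 0 q) i - a * coeff q i" for i
      by (simp add: mult_pCons_left)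
    then have "ev_at (Suc M) ([:- a, 1:] * q) y =
        (\<Sum>i<Suc M. coeff (pCons 0 q) i *s (f ^^ i) y) - (\<Sum>i<Suc M. (a * coeff q i) *s (f ^^ i) y)"
      by (simp add: ev_at_def vec.scale_left_diff_distrib sum_subtractf del: sum.lessThan_Suc)
    also have "(\<Sum>i<Suc M. coeff (pCons 0 q) i *s (f ^^ i) y) = f (ev_at M q y)"
      by (subst sum.lessThan_Suc_shift) (simp add: ev_at_def f_sum f_scale)
    also have "(\<Sum>i<Suc M. (a * coeff q i) *s (f ^^ i) y) = a *s ev_at M q y"
      using that by (simp add: ev_at_def coeff_eq_0 vec.scale_sum_right)
    finally show ?thesis .
  qed
  have main: "(\<lambda>k. (f ^^ k) y $ i) \<longlonglongrightarrow> 0"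
    if "p \<noteq> 0" "degree p < M" "ev_at M p y = 0" for p M y i
    using that
  proof (induction "degree p" arbitrary: p M y i)
    case 0
    then obtain c where c: "p = [:c:]" "c \<noteq> 0" by (metis degree_0_id degree_eq_zeroE pCons_0_0)
    obtain M' where "M = Suc M'" using 0 by (cases M) auto
    then have "c *s y = 0" using 0(4)
      by (simp add: ev_at_def c coeff_pCons sum.lessThan_Suc_shift del: sum.lessThan_Suc)
    then have "y = 0" using c by simp
    moreover have "(f ^^ k) 0 = 0" for k by (induction k) (simp_all add: f_def)
    ultimately show ?case by simp
  next
    case (Suc n)
    have "\<not> constant (poly p)" using Suc(2) by (simp add: constant_degree)
    then obtain a where "poly p a = 0" using fundamental_theorem_of_algebra by blast
    then obtain q where q: "p = [:- a, 1:] * q" by (metis dvdE poly_eq_0_iff_dvd)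
    have q0: "q \<noteq> 0" using q Suc(3) by auto
    have "degree p = Suc (degree q)" unfolding q using q0 by (subst degree_mult_eq) auto
    then have dq: "degree q = n" using Suc(2) by simp
    obtain M' where M: "M = Suc M'" "degree q < M'" using Suc(2,4) dq by (cases M) auto
    have w: "f (ev_at M' q y) = a *s ev_at M' q y"
      using ev_mult[OF M(2), of a y] Suc(5)[unfolded M(1) q] by simp
    show ?case
    proof (cases "cmod a < 1")
      case True
      let ?z = "f y - a *s y"
      have ev_diff: "ev_at M' q ?z = ev_at M' q (f y) - a *s ev_at M' q y"
      proof -
        have "(f ^^ k) ?z = (f ^^ k) (f y) - a *s (f ^^ k) y" for k
          using pow_add[of k ?z "a *s y"] by (simp add: pow_scale)
        then show ?thesis
          by (simp add: ev_at_def vec.scale_sum_right vec.scale_right_diff_distrib sum_subtractf mult.commute)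
      qed
      then have "ev_at M' q ?z = 0" using w by (simp add: f_ev)
      then have lim: "(\<lambda>k. (f ^^ k) ?z $ i) \<longlonglongrightarrow> 0"
        using Suc(1)[of q M' ?z i] q0 M(2) dq by simp
      show ?thesis
      proof (rule tendsto_zero_recursion[OF _ lim True])
        fix k
        have "(f ^^ k) (f y) = (f ^^ k) ?z + a *s (f ^^ k) y"
          using pow_add[of k ?z "a *s y"] by (simp add: pow_scale)
        then show "(f ^^ Suc k) y $ i = a * (f ^^ k) y $ i + (f ^^ k) ?z $ i"
          by (simp add: funpow_swap1)
      qed
    next
      case False
      then have "ev_at M' q y = 0" using ev[of "ev_at M' q y" a] w by (auto simp: f_def)
      then show ?thesis using Suc(1)[of q M' y i] q0 M(2) dq by simp
    qed
  qed
  obtain p :: "complex poly" and M where "p \<noteq> 0" "degree p < M" "ev_at M p y = 0"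
  proof (cases "inj_on (\<lambda>i. (f ^^ i) y) {..DIM(complex ^ 'n)}")
    case False
    then obtain i j where ij: "i \<noteq> j" "(f ^^ i) y = (f ^^ j) y" by (auto simp: inj_on_def)
    let ?p = "monom 1 i - monom 1 j :: complex poly"
    have "coeff ?p i = 1" using ij by simp
    then have "?p \<noteq> 0" by force
    moreover have "degree ?p < Suc (i + j)"
      by (rule le_imp_less_Suc, rule degree_diff_le) (auto intro: order_trans[OF degree_monom_le])
    moreover have "ev_at (Suc (i + j)) ?p y = 0"
      using ij(2) by (simp add: ev_at_def vec.scale_left_diff_distrib sum_subtractf if_distrib[of "\<lambda>c. c *s _"]
        cong: if_cong del: sum.lessThan_Suc)
    ultimately show ?thesis using that by blast
  next
    case inj: True
    let ?S = "(\<lambda>i. (f ^^ i) y) ` {..DIM(complex ^ 'n)}"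
    have "card ?S = Suc (DIM(complex ^ 'n))" using card_image[OF inj] by simp
    then have "dependent ?S" by (intro dependent_biggerset) auto
    then obtain u where u: "\<exists>v\<in>?S. u v \<noteq> 0" "(\<Sum>v\<in>?S. u v *\<^sub>R v) = 0"
      by (auto simp: dependent_finite)
    define p where "p = (\<Sum>i\<le>DIM(complex ^ 'n). monom (complex_of_real (u ((f ^^ i) y))) i)"
    have cp: "coeff p i = (if i \<le> DIM(complex ^ 'n) then of_real (u ((f ^^ i) y)) else 0)" for i
      by (simp add: p_def coeff_sum)
    have "p \<noteq> 0" using u(1) cp by (auto simp: poly_eq_iff)
    moreover have "degree p < Suc (DIM(complex ^ 'n))"
      by (rule le_imp_less_Suc, rule degree_le) (simp add: cp)
    moreover have "ev_at (Suc (DIM(complex ^ 'n))) p y = 0"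
    proof -
      have "ev_at (Suc (DIM(complex ^ 'n))) p y = (\<Sum>i\<le>DIM(complex ^ 'n). of_real (u ((f ^^ i) y)) *s (f ^^ i) y)"
        unfolding ev_at_def lessThan_Suc_atMost by (intro sum.cong) (auto simp: cp)
      also have "\<dots> = (\<Sum>i\<le>DIM(complex ^ 'n). u ((f ^^ i) y) *\<^sub>R (f ^^ i) y)"
        by (intro sum.cong) (auto simp: vec_eq_iff complex_eq_iff)
      also have "\<dots> = (\<Sum>v\<in>?S. u v *\<^sub>R v)"
        using sum.reindex[OF inj, of "\<lambda>v. u v *\<^sub>R v"] unfolding o_def by (rule sym)
      finally show ?thesis using u(2) by simp
    qed
    ultimately show ?thesis using that by blast
  qed
  then show ?thesis using main[of p M y i] by (simp add: f_def)
qed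

context nonsingular
begin

text \<open>
  If \<open>m = B\<^sup>k n\<^sub>k\<close> for all \<open>k\<close>, then the coordinates of \<open>n\<^sub>k\<close> are the pairings of \<open>m\<close> with
  \<open>A\<^sup>-\<^sup>k e\<^sub>i\<close>, which tend to zero because the eigenvalues of \<open>A\<^sup>-\<^sup>1\<close> have modulus less than one.  Being
  integers, they vanish for some \<open>k\<close>, so \<open>m = 0\<close>.
\<close>

lemma dilation_escape:
  assumes dil: "dilation_matrix A" and m: "m \<noteq> 0"
  shows "\<exists>k. m \<notin> range (B ^^ k)"
proof (rule ccontr)
  assume "\<nexists>k. m \<notin> range (B ^^ k)"
  then have "\<forall>k. \<exists>n. m = (B ^^ k) n" by (auto simp: image_iff)
  then obtain n where n: "\<And>k. m = (B ^^ k) (n k)" by metis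
  define M where "M = (\<chi> i j. complex_of_int (A $ i $ j))"
  have "det M = of_int (det A)" by (simp add: M_def det_def)
  then have "invertible M" using det_nonzero by (simp add: invertible_det_nz)
  then obtain T where T: "M ** T = mat 1" "T ** M = mat 1" by (auto simp: invertible_def)
  have MT: "M *v (T *v x) = x" for x using T(1) by (simp add: matrix_vector_mul_assoc)
  define pair where "pair n x = (\<Sum>i\<in>UNIV. complex_of_int (n $ i) * x $ i)" for n :: "int ^ 'd" and x
  have pair_B: "pair (B n) x = pair n (M *v x)" for n x
  proof -
    have "pair n (M *v x) = (\<Sum>i\<in>UNIV. \<Sum>j\<in>UNIV. of_int (n $ i) * (of_int (A $ i $ j) * x $ j))"
      by (simp add: pair_def matrix_vector_mult_def M_def sum_distrib_left)
    also have "\<dots> = (\<Sum>j\<in>UNIV. \<Sum>i\<in>UNIV. of_int (n $ i) * (of_int (A $ i $ j) * x $ j))"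
      by (rule sum.swap)
    also have "\<dots> = pair (B n) x"
      by (auto simp: pair_def matrix_vector_mult_def transpose_def sum_distrib_right intro!: sum.cong)
    finally show ?thesis ..
  qed
  have pair_pow: "pair ((B ^^ k) n) ((((*v) T) ^^ k) x) = pair n x" for k n x
    by (induction k arbitrary: n x) (simp_all add: pair_B MT)
  have ev: "cmod a < 1" if "x \<noteq> 0" "T *v x = a *s x" for a x
  proof -
    have x: "x = a *s (M *v x)" using MT[of x] that(2) by (simp add: vector_scalar_commute)
    have a: "a \<noteq> 0" using x that(1) by auto
    have "(1 / a) *s x = (1 / a) *s (a *s (M *v x))" using x by simp
    also have "\<dots> = M *v x" using a by (simp add: vec.scale_scale)
    finally have "M *v x = (1 / a) *s x" by simp
    then have "cmod (1 / a) > 1" using dil that(1) unfolding dilation_matrix_def M_def by blast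
    then show ?thesis using a by (simp add: norm_divide field_simps)
  qed
  have lim: "(\<lambda>k. complex_of_int (n k $ i)) \<longlonglongrightarrow> 0" for i
  proof -
    have "pair m ((((*v) T) ^^ k) (axis i 1)) = of_int (n k $ i)" for k
      using pair_pow[of k "n k" "axis i 1"] n[of k]
      by (simp add: pair_def axis_def if_distrib[of "(*) _"] cong: if_cong)
    moreover have "(\<lambda>k. pair m ((((*v) T) ^^ k) (axis i 1))) \<longlonglongrightarrow> (\<Sum>j\<in>UNIV. of_int (m $ j) * 0)"
      unfolding pair_def by (intro tendsto_sum tendsto_mult_left orbit_tendsto_zero ev)
    ultimately show ?thesis by simp
  qed
  have "\<forall>i. \<forall>\<^sub>F k in sequentially. cmod (complex_of_int (n k $ i)) < 1"
    by (intro allI order_tendstoD(2)[OF tendsto_norm_zero[OF lim] zero_less_one])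
  then have "\<forall>\<^sub>F k in sequentially. \<forall>i. cmod (complex_of_int (n k $ i)) < 1"
    by (simp add: eventually_all_finite)
  then obtain k where k: "\<And>i. cmod (complex_of_int (n k $ i)) < 1" by (auto simp: eventually_sequentially)
  have "n k $ i = 0" for i
  proof -
    have "\<bar>real_of_int (n k $ i)\<bar> < 1" using k[of i] by simp
    then show ?thesis by linarith
  qed
  then have "n k = 0" by (simp add: vec_eq_iff)
  moreover have "(B ^^ k) 0 = 0" by (induction k) (simp_all add: matrix_vector_mult_def vec_eq_iff)
  ultimately show False using n[of k] m by simp
qed

end

context nonsingular
begin

sublocale CP: torus_rep A N "CP A" "j_M A" "j_CT A"
  by (rule CP_torus_rep)

sublocale F: seminormed_star_algebra "free_ML (universal_norm A)"
  by (rule CP_seminormed)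

abbreviation "emb \<equiv> embed (free_ML (universal_norm A))"

lemma emb_simps:
  "x \<in> words generators \<Longrightarrow> emb x \<in> carrier (CP A)"
  "x \<in> words generators \<Longrightarrow> y \<in> words generators \<Longrightarrow> emb (x + y) = emb x \<oplus>\<^bsub>CP A\<^esub> emb y"
  "x \<in> words generators \<Longrightarrow> y \<in> words generators \<Longrightarrow> emb (x * y) = emb x \<otimes>\<^bsub>CP A\<^esub> emb y"
  "x \<in> words generators \<Longrightarrow> emb (single 0 c * x) = c \<odot>\<^bsub>CP A\<^esub> emb x"
  "x \<in> words generators \<Longrightarrow> emb (nc_star x) = star (CP A) (emb x)"
  "emb 1 = \<one>\<^bsub>CP A\<^esub>" "emb 0 = \<zero>\<^bsub>CP A\<^esub>"
  "emb (M_gen m) = j_M A m" "emb (C_gen f) = j_CT A f"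
  using F.embed_closed[of x] F.embed_add[of x y] F.embed_mult[of x y] F.embed_scale[of x c] F.embed_star[of x]
    F.embed_one F.embed_zero
  by (simp_all add: CP_def j_M_def j_CT_def)

lemma emb_power: "x \<in> words generators \<Longrightarrow> x ^ k \<in> words generators \<and> emb (x ^ k) = emb x [^]\<^bsub>CP A\<^esub> k"
  by (induction k) (simp_all add: emb_simps words_intros CP.pow_0 CP.pow_Suc power_Suc2 del: power_Suc)

text \<open>
  The closed span of the monomials contains the unit and is stable under left multiplication by the
  generators and their adjoints, so it contains all words.
\<close>

lemma CP_spanned: "carrier (CP A) = CP.closed_span CP.monomials"
proof
  let ?S = "CP.closed_span CP.monomials"
  have S: "CP.closed_subspace ?S" by (rule CP.closed_subspace_monomials)
  then show "?S \<subseteq> carrier (CP A)" by (simp add: CP.closed_subspace_def)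
  have one: "\<one>\<^bsub>CP A\<^esub> \<in> ?S" using CP.mono_in_span[of 0 0 0 0] by (simp add: CP.mono_zero)
  have letter: "emb (if b then nc_star (gen g) else gen g) \<otimes>\<^bsub>CP A\<^esub> y \<in> ?S"
    if "g \<in> generators" "y \<in> ?S" for g b y
    using that CP.generators_preserve_span[of y] by (auto simp: emb_simps generators_words)
  have emb_S: "emb x \<in> ?S" if "x \<in> words generators" for x
    using that
  proof (induction x rule: words_induct)
    case zero
    then show ?case using S by (simp add: emb_simps CP.closed_subspace_def)
  next
    case (add x y)
    then show ?case using S by (simp add: emb_simps CP.closed_subspace_def)
  next
    case (single w c)
    have "emb (single (Word ls) c) \<in> ?S" if "fst ` set ls \<subseteq> generators" for ls
      using that
    proof (induction ls)
      case Nil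
      have "emb (single (Word []) c) = c \<odot>\<^bsub>CP A\<^esub> \<one>\<^bsub>CP A\<^esub>"
        using emb_simps(4)[OF words_one, of c] by (simp add: zero_word_def emb_simps)
      then show ?case using S one by (simp add: CP.closed_subspace_def)
    next
      case (Cons l ls)
      obtain g b where l: "l = (g, b)" "g \<in> generators" using Cons.prems by (cases l) auto
      have ls: "fst ` set ls \<subseteq> generators" using Cons.prems by simp
      have w: "(if b then nc_star (gen g) else gen g) \<in> words generators" "single (Word ls) c \<in> words generators"
        using words_gen[OF l(2)] ls by (simp_all add: words_single words_star)
      show ?case unfolding l(1) single_Word_Cons emb_simps(3)[OF w]
        by (rule letter[OF l(2) Cons.IH[OF ls]])
    qed
    from this[of "letters w"] single show ?case by simp
  qed
  show "carrier (CP A) \<subseteq> ?S"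
  proof
    fix X assume X: "X \<in> carrier (CP A)"
    show "X \<in> ?S"
      by (rule F.completion_induct[folded CP_def, of X "\<lambda>X. X \<in> ?S", OF X])
        (use emb_S in simp, rule CP.closed_subspace_limit[OF S])
  qed
qed

section \<open>The trace state\<close>

text \<open>
  The state is the mean, over the torus, of the vector states of the basis vectors at height zero.
  The mean is taken over the \<open>q\<close>-torsion points, which annihilate all characters of size below \<open>q\<close>.
\<close>

definition torsion_point :: "nat \<Rightarrow> ('d \<Rightarrow> nat) \<Rightarrow> 'd torus" where
  "torsion_point q g = torus_exp (\<chi> i. real (g i) / real q)"

abbreviation "torsion_grid q \<equiv> PiE (UNIV :: 'd set) (\<lambda>_. {..<q})"

lemma sum_torsion_character:
  assumes q: "q > 0" and p: "p $ i \<noteq> 0" "\<bar>p $ i\<bar> < int q"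
  shows "(\<Sum>g\<in>torsion_grid q. character p (torsion_point q g)) = 0"
proof -
  define r where "r i = cis (2 * pi * (of_int (p $ i) / real q))" for i
  have "character p (torsion_point q g) = (\<Prod>i\<in>UNIV. r i ^ g i)" for g
    unfolding character_def torsion_point_def coords_torus_exp
    by (intro prod.cong) (auto simp: r_def cis_power_int Complex.DeMoivre mult_ac)
  then have "(\<Sum>g\<in>torsion_grid q. character p (torsion_point q g)) = (\<Prod>i\<in>UNIV. \<Sum>j<q. r i ^ j)"
    by (simp add: prod_sum_PiE)
  moreover have "(\<Sum>j<q. r i ^ j) = 0"
  proof -
    have "r i ^ q = cis (2 * pi * of_int (p $ i))" using q by (simp add: r_def Complex.DeMoivre)
    then have "r i ^ q = 1" by (simp add: cis_multiple_2pi)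
    moreover have "r i \<noteq> 1"
    proof
      assume "r i = 1"
      then obtain k where k: "real_of_int (p $ i) / real q = of_int k"
        unfolding r_def cis_2pi_eq_1 by (auto elim: Ints_cases)
      then have "real_of_int (p $ i) = real_of_int (k * int q)" using q by (simp add: field_simps)
      then have "p $ i = k * int q" by (simp only: of_int_eq_iff)
      then have "\<bar>k\<bar> * int q < int q" "k \<noteq> 0" using p by (auto simp: abs_mult)
      then show False using q by (simp add: mult_less_cancel_right2)
    qed
    ultimately show ?thesis by (simp add: geometric_sum)
  qed
  ultimately show ?thesis by (auto intro: prod_zero)
qed

definition point_mass :: "'d torus \<times> int \<Rightarrow> 'd torus \<times> int \<Rightarrow> complex" where
  "point_mass i = (\<lambda>k. if k = i then 1 else 0)"

lemma supp_point_mass [simp]: "supp (point_mass i) = {i}"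
  by (auto simp: supp_def point_mass_def)

lemma ip_point_mass: "ip (point_mass i) \<xi> = \<xi> i"
  by (simp add: ip_def) (simp add: point_mass_def)

lemma l2_point_mass: "l2 (point_mass i) = 1"
  by (simp add: l2_def) (simp add: point_mass_def L2_set_def)

definition grid_mean :: "nat \<Rightarrow> 'd generator nc_poly \<Rightarrow> complex" where
  "grid_mean q x = (\<Sum>g\<in>torsion_grid q. point.rep x (point_mass (torsion_point q g, 0)) (torsion_point q g, 0))
     / of_nat q ^ CARD('d)"

lemma grid_mean_add: "grid_mean q (x + y) = grid_mean q x + grid_mean q y"
  and grid_mean_scale: "grid_mean q (single 0 c * x) = c * grid_mean q x"
  by (simp_all add: grid_mean_def point.rep_add point.rep_scale sum.distrib add_divide_distrib sum_distrib_left)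

text \<open>
  A diagonal coefficient of an operator is bounded by its norm on \<open>\<T>\<^sup>d \<times> \<int>\<close>, and this norm is one of the
  covariant seminorms.
\<close>

lemma grid_mean_bound:
  assumes q: "q > 0" and x: "x \<in> words generators"
  shows "cmod (grid_mean q x) \<le> universal_norm A x"
proof -
  have "cmod (point.rep x (point_mass i) i) \<le> universal_norm A x" for i
  proof -
    have "cmod (point.rep x (point_mass i) i) = cmod (ip (point_mass i) (point.rep x (point_mass i)))"
      by (simp add: ip_point_mass)
    also have "\<dots> \<le> l2 (point_mass i) * l2 (point.rep x (point_mass i))"
      using x by (intro ip_le point.rep_supp) auto
    also have "\<dots> \<le> point.opnorm x"
      using point.rep_le_opnorm[OF x, of "point_mass i"] by (simp add: l2_point_mass)
    finally show ?thesis using universal_upper[OF x point_covariant] by simp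
  qed
  then have "cmod (\<Sum>g\<in>torsion_grid q. point.rep x (point_mass (torsion_point q g, 0)) (torsion_point q g, 0))
      \<le> of_nat (card (torsion_grid q)) * universal_norm A x"
    by (intro sum_norm_bound)
  then show ?thesis using q by (simp add: grid_mean_def norm_divide norm_power card_PiE field_simps)
qed

lemma grid_mean_positive: assumes "x \<in> words generators" shows "grid_mean q (nc_star x * x) \<in> \<real>\<^sub>\<ge>\<^sub>0"
proof -
  have "point.rep (nc_star x * x) (point_mass i) i = of_real ((l2 (point.rep x (point_mass i)))\<^sup>2)" for i
    using point.rep_adjoint[OF assms, of "point_mass i" "point.rep x (point_mass i)"] point.rep_supp[OF assms]
    by (simp add: point.rep_mult ip_point_mass[symmetric] ip_self del: of_real_power)
  then have "grid_mean q (nc_star x * x) = of_real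
      ((\<Sum>g\<in>torsion_grid q. (l2 (point.rep x (point_mass (torsion_point q g, 0))))\<^sup>2) / real q ^ CARD('d))"
    by (simp add: grid_mean_def)
  then show ?thesis by (simp only: nonneg_Reals_of_real_iff) (simp add: sum_nonneg)
qed

definition monomial_poly :: "int ^ 'd \<Rightarrow> nat \<Rightarrow> nat \<Rightarrow> int ^ 'd \<Rightarrow> 'd generator nc_poly" where
  "monomial_poly m k l n = C_gen (character m) * M_gen (\<lambda>z. 1) ^ k * nc_star (M_gen (\<lambda>z. 1)) ^ l
     * nc_star (C_gen (character n))"

lemma monomial_poly: "monomial_poly m k l n \<in> words generators" "emb (monomial_poly m k l n) = CP.mono m k l n"
  using emb_power[of "M_gen (\<lambda>z. 1)" k] emb_power[of "nc_star (M_gen (\<lambda>z. 1))" l]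
  by (simp_all add: monomial_poly_def CP.mono_def emb_simps words_intros)

lemma rep_M_power: "point.rep (M_gen (\<lambda>z. 1) ^ k) \<xi> (w, j) = \<xi> ((torus_map A ^^ k) w, j - int k) / of_real (sqrt N) ^ k"
  by (induction k arbitrary: w j) (simp_all add: point.rep_one point.rep_mult point.rep_gen funpow_swap1 algebra_simps)

lemma rep_M_star_power:
  "point.rep (nc_star (M_gen (\<lambda>z. 1)) ^ l) (point_mass (y, j)) =
    (\<lambda>i. 1 / of_real (sqrt N) ^ l * point_mass ((torus_map A ^^ l) y, j - int l) i)"
proof (induction l arbitrary: y j)
  case 0 show ?case by (simp add: point.rep_one)
next
  case (Suc l)
  have step: "point_op (ModGen (\<lambda>z. 1), True) (point_mass (y, j)) =
      (\<lambda>i. 1 / of_real (sqrt N) * point_mass (torus_map A y, j - 1) i)"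
  proof
    fix i show "point_op (ModGen (\<lambda>z. 1), True) (point_mass (y, j)) i =
      1 / of_real (sqrt N) * point_mass (torus_map A y, j - 1) i"
    proof (cases i)
      case (Pair z t)
      have "(\<Sum>w\<in>fibre A z. point_mass (y, j) (w, t + 1)) =
          (\<Sum>w\<in>fibre A z. if w = y then (if t + 1 = j then 1 else 0) else 0)"
        by (intro sum.cong) (auto simp: point_mass_def)
      also have "\<dots> = point_mass (torus_map A y, j - 1) (z, t)"
        using fibre_finite[of z] by (auto simp: point_mass_def fibre_def)
      finally show ?thesis by (simp add: Pair)
    qed
  qed
  show ?case
    unfolding power_Suc2 point.rep_mult point.rep_star_gen step point.rep_vector_scale Suc
    by (simp add: funpow_swap1 algebra_simps)
qed

text \<open>
  The adjoints of \<open>v\<close> move the mass from \<open>(z, 0)\<close> to \<open>(\<sigma>\<^sub>A\<^sup>l z, - l)\<close>, and the powers of \<open>v\<close> read off the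
  value at \<open>(\<sigma>\<^sub>A\<^sup>k z, - k)\<close>; the second coordinate separates different degrees.
\<close>

lemma rep_monomial:
  "point.rep (monomial_poly m k l n) (point_mass (z, 0)) (z, 0) =
    (if k = l then character (m - n) z / of_nat N ^ k else 0)"
proof -
  have "point.rep (nc_star (C_gen (character n))) (point_mass (z, 0)) = (\<lambda>i. cnj (character n z) * point_mass (z, 0) i)"
    by (auto simp: point.rep_star_gen point_mass_def fun_eq_iff)
  then have "point.rep (monomial_poly m k l n) (point_mass (z, 0)) (z, 0) =
      character m z * (cnj (character n z) * (1 / of_real (sqrt N) ^ l *
        point_mass ((torus_map A ^^ l) z, - int l) ((torus_map A ^^ k) z, - int k)) / of_real (sqrt N) ^ k)"
    by (simp add: monomial_poly_def point.rep_mult point.rep_gen rep_M_power rep_M_star_power point.rep_vector_scale)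
  moreover have "complex_of_real (sqrt N) ^ k * complex_of_real (sqrt N) ^ k = of_nat N ^ k"
    by (simp flip: power_mult_distrib)
  ultimately show ?thesis
    by (auto simp: point_mass_def character_diff)
qed

lemma grid_mean_monomial:
  "(\<lambda>q. grid_mean (Suc q) (monomial_poly m k l n)) \<longlonglongrightarrow> (if k = l \<and> m = n then 1 / of_nat N ^ k else 0)"
proof -
  have "\<forall>\<^sub>F q in sequentially. grid_mean (Suc q) (monomial_poly m k l n) = (if k = l \<and> m = n then 1 / of_nat N ^ k else 0)"
  proof (cases "m = n")
    case True
    then show ?thesis by (auto simp: grid_mean_def rep_monomial card_PiE simp del: of_nat_Suc)
  next
    case False
    then obtain i where i: "(m - n) $ i \<noteq> 0" by (auto simp: vec_eq_iff)
    have "grid_mean (Suc q) (monomial_poly m k l n) = 0" if "q \<ge> nat \<bar>(m - n) $ i\<bar>" for q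
    proof -
      have "\<bar>(m - n) $ i\<bar> < int (Suc q)" using that by linarith
      then have "(\<Sum>g\<in>torsion_grid (Suc q). character (m - n) (torsion_point (Suc q) g)) = 0"
        using i by (intro sum_torsion_character) auto
      then show ?thesis
        by (cases "k = l") (simp_all add: grid_mean_def rep_monomial sum_divide_distrib[symmetric])
    qed
    then show ?thesis using False by (auto simp: eventually_sequentially)
  qed
  then show ?thesis by (rule tendsto_eventually)
qed

text \<open>
  The means of order \<open>q\<close> are bounded uniformly by the norm and converge on the monomials, in fact they
  are eventually constant there; hence they converge on the closed span, which is the whole algebra.
\<close>

lemma trace_state_exists:
  obtains \<phi> where "state (CP A) \<phi>"
    "\<And>m k l n. \<phi> (CP.mono m k l n) = (if k = l \<and> m = n then 1 / of_nat N ^ k else 0)"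
proof -
  define \<Phi> where "\<Phi> q = F.extend (grid_mean (Suc q))" for q
  have b: "cmod (grid_mean (Suc q) x) \<le> nrm (free_ML (universal_norm A)) x"
    if "x \<in> carrier (free_ML (universal_norm A))" for q x
    using grid_mean_bound[of "Suc q" x] that by simp
  have add: "\<Phi> q (X \<oplus>\<^bsub>CP A\<^esub> Y) = \<Phi> q X + \<Phi> q Y" if "X \<in> carrier (CP A)" "Y \<in> carrier (CP A)" for q X Y
    unfolding \<Phi>_def CP_def using that b
    by (intro F.extend_add) (auto simp: grid_mean_add grid_mean_scale CP_def)
  have scale: "\<Phi> q (c \<odot>\<^bsub>CP A\<^esub> X) = c * \<Phi> q X" if "X \<in> carrier (CP A)" for q X c
    unfolding \<Phi>_def CP_def using that b
    by (intro F.extend_scale) (auto simp: grid_mean_add grid_mean_scale CP_def)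
  have bound: "cmod (\<Phi> q X) \<le> nrm (CP A) X" if "X \<in> carrier (CP A)" for q X
    unfolding \<Phi>_def CP_def using that b
    by (intro F.extend_bound) (auto simp: grid_mean_add grid_mean_scale CP_def)
  have pos: "\<Phi> q (star (CP A) X \<otimes>\<^bsub>CP A\<^esub> X) \<in> \<real>\<^sub>\<ge>\<^sub>0" if "X \<in> carrier (CP A)" for q X
    unfolding \<Phi>_def CP_def using that b
    by (intro F.extend_positive) (auto simp: grid_mean_add grid_mean_scale grid_mean_positive CP_def)
  have emb: "\<Phi> q (emb x) = grid_mean (Suc q) x" if "x \<in> words generators" for q x
    unfolding \<Phi>_def using that b by (intro F.extend_embed) (auto simp: grid_mean_add grid_mean_scale)
  have diff: "\<Phi> q (X \<ominus>\<^bsub>CP A\<^esub> Y) = \<Phi> q X - \<Phi> q Y" if "X \<in> carrier (CP A)" "Y \<in> carrier (CP A)" for q X Y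
    using that by (simp add: CP.minus_scale add scale)
  have mono: "(\<lambda>q. \<Phi> q (CP.mono m k l n)) \<longlonglongrightarrow> (if k = l \<and> m = n then 1 / of_nat N ^ k else 0)" for m k l n
    using grid_mean_monomial[of m k l n] emb[OF monomial_poly(1)] by (simp add: monomial_poly(2))
  let ?E = "{X \<in> carrier (CP A). Cauchy (\<lambda>q. \<Phi> q X)}"
  have "CP.closed_subspace ?E"
    unfolding CP.closed_subspace_def
  proof (intro conjI ballI allI impI)
    fix s X assume s: "\<forall>n. s n \<in> ?E" and X: "X \<in> carrier (CP A)" "converges (CP A) s X"
    have "Cauchy (\<lambda>q. \<Phi> q X)"
    proof (rule CauchyI)
      fix e :: real assume e: "e > 0"
      have "\<forall>\<^sub>F k in sequentially. nrm (CP A) (s k \<ominus>\<^bsub>CP A\<^esub> X) < e / 3"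
        using X(2) e unfolding converges_def by (intro order_tendstoD(2)) auto
      then obtain k where k: "nrm (CP A) (s k \<ominus>\<^bsub>CP A\<^esub> X) < e / 3" by (auto simp: eventually_sequentially)
      have sk: "s k \<in> carrier (CP A)" "Cauchy (\<lambda>q. \<Phi> q (s k))" using s by auto
      then obtain M where M: "\<And>a b. a \<ge> M \<Longrightarrow> b \<ge> M \<Longrightarrow> cmod (\<Phi> a (s k) - \<Phi> b (s k)) < e / 3"
        using CauchyD[of _ "e / 3"] e by (metis divide_pos_pos zero_less_numeral)
      have near: "cmod (\<Phi> q (s k) - \<Phi> q X) < e / 3" for q
        using bound[of "s k \<ominus>\<^bsub>CP A\<^esub> X" q] k X(1) sk(1) by (simp add: diff)
      have "norm (\<Phi> a X - \<Phi> b X) < e" if "a \<ge> M" "b \<ge> M" for a b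
      proof -
        have "\<Phi> a X - \<Phi> b X = (\<Phi> a (s k) - \<Phi> b (s k)) - (\<Phi> a (s k) - \<Phi> a X) + (\<Phi> b (s k) - \<Phi> b X)" by simp
        also have "norm \<dots> \<le> cmod (\<Phi> a (s k) - \<Phi> b (s k)) + cmod (\<Phi> a (s k) - \<Phi> a X) + cmod (\<Phi> b (s k) - \<Phi> b X)"
          by (intro order_trans[OF norm_triangle_ineq] add_right_mono norm_triangle_ineq4)
        finally show ?thesis using M[OF that] near[of a] near[of b] by simp
      qed
      then show "\<exists>M. \<forall>a\<ge>M. \<forall>b\<ge>M. norm (\<Phi> a X - \<Phi> b X) < e" by blast
    qed
    then show "X \<in> ?E" using X(1) by simp
  next
    show "\<zero>\<^bsub>CP A\<^esub> \<in> ?E" using scale[of "\<zero>\<^bsub>CP A\<^esub>" _ 0] by (simp add: Cauchy_def)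
  qed (auto simp: add scale Cauchy_convergent_iff intro: convergent_add convergent_mult convergent_const)
  then have "carrier (CP A) \<subseteq> ?E"
    unfolding CP_spanned
    by (rule CP.closed_span_least) (auto elim!: CP.monomialsE simp: CP_spanned[symmetric] intro: LIMSEQ_imp_Cauchy[OF mono])
  then have lim: "(\<lambda>q. \<Phi> q X) \<longlonglongrightarrow> lim (\<lambda>q. \<Phi> q X)" if "X \<in> carrier (CP A)" for X
    using that by (auto simp: Cauchy_convergent_iff convergent_LIMSEQ_iff)
  define \<phi> where "\<phi> X = lim (\<lambda>q. \<Phi> q X)" for X
  have mono': "\<phi> (CP.mono m k l n) = (if k = l \<and> m = n then 1 / of_nat N ^ k else 0)" for m k l n
    unfolding \<phi>_def by (rule limI[OF mono])
  have "state (CP A) \<phi>"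
    unfolding state_def
  proof (intro conjI ballI allI)
    fix X assume X: "X \<in> carrier (CP A)"
    show "\<phi> (c \<odot>\<^bsub>CP A\<^esub> X) = c * \<phi> X" for c
      unfolding \<phi>_def scale[OF X] by (rule limI[OF tendsto_mult_left[OF lim[OF X]]])
    have sX: "star (CP A) X \<otimes>\<^bsub>CP A\<^esub> X \<in> carrier (CP A)" using X CP.star_closed by simp
    show "\<phi> (star (CP A) X \<otimes>\<^bsub>CP A\<^esub> X) \<in> \<real>\<^sub>\<ge>\<^sub>0"
      unfolding \<phi>_def
      by (rule Lim_in_closed_set[OF closed_nonneg_Reals_complex _ trivial_limit_sequentially lim[OF sX]])
        (simp add: pos[OF X])
    fix Y assume Y: "Y \<in> carrier (CP A)"
    show "\<phi> (X \<oplus>\<^bsub>CP A\<^esub> Y) = \<phi> X + \<phi> Y"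
      unfolding \<phi>_def add[OF X Y] by (rule limI[OF tendsto_add[OF lim[OF X] lim[OF Y]]])
  next
    show "\<phi> \<one>\<^bsub>CP A\<^esub> = 1" using mono'[of 0 0 0 0] by (simp add: CP.mono_zero)
  qed
  then show ?thesis using that mono' by blast
qed

end

theorem theorem5p3:
  fixes A :: "int ^ 'd ^ ('d :: finite)"
    and N :: nat
    and \<sigma> :: "real \<Rightarrow> 'd cp_elem \<Rightarrow> 'd cp_elem"
  assumes "N = nat \<bar>det A\<bar>"
    and "N \<noteq> 0"
    and "gauge_dynamics A \<sigma>"
  shows "\<exists>\<phi>. KMS (CP A) \<sigma> (ln (real N)) \<phi> \<and>
    (\<forall>(m :: int ^ 'd) (n :: int ^ 'd) (k :: nat) (l :: nat).
       \<phi> (u_bar A m \<otimes>\<^bsub>CP A\<^esub> v_bar A [^]\<^bsub>CP A\<^esub> k \<otimes>\<^bsub>CP A\<^esub> star (CP A) (v_bar A) [^]\<^bsub>CP A\<^esub> l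
            \<otimes>\<^bsub>CP A\<^esub> star (CP A) (u_bar A n))
         = (if k = l \<and> m = n then 1 / of_nat N ^ k else 0)) \<and>
    (dilation_matrix A \<longrightarrow>
       (\<forall>\<beta>\<ge>0. \<forall>\<phi>'. KMS (CP A) \<sigma> \<beta> \<phi>' \<longrightarrow> (\<forall>x\<in>carrier (CP A). \<phi>' x = \<phi> x)))"
proof -
  interpret nonsingular A N using assms(1,2) by unfold_locales
  interpret D: torus_dynamics A N "CP A" "j_M A" "j_CT A" \<sigma>
    using assms(3) CP_spanned
    by unfold_locales (simp_all add: gauge_dynamics_def u_bar_def v_bar_def)
  obtain \<phi> where \<phi>: "state (CP A) \<phi>"
    "\<And>m k l n. \<phi> (CP.mono m k l n) = (if k = l \<and> m = n then 1 / of_nat N ^ k else 0)"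
    using trace_state_exists by blast
  have "D.is_trace_state \<phi>" using \<phi> by (simp add: D.is_trace_state_def)
  then have "KMS (CP A) \<sigma> (ln (real N)) \<phi>" by (rule D.trace_KMS)
  moreover have "\<phi>' x = \<phi> x"
    if "dilation_matrix A" "\<beta> \<ge> 0" "KMS (CP A) \<sigma> \<beta> \<phi>'" "x \<in> carrier (CP A)" for \<beta> \<phi>' x
  proof (rule D.state_eqI[OF D.kms_state[OF that(3,2)] \<phi>(1) _ that(4)])
    show "\<phi>' (CP.mono m k l n) = \<phi> (CP.mono m k l n)" for m k l n
      using D.kms_unique[OF that(3,2) dilation_escape[OF that(1)]] \<phi>(2) by simp
  qed
  ultimately show ?thesis
    using \<phi>(2) by (intro exI[of _ \<phi>]) (simp add: CP.mono_def u_bar_def v_bar_def)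
qed

end
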